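(* Let $\lambda,\sigma_\mu,\sigma_S>0$, $\tau>0$, $m>0$ and $x>0$, and let $S$, $\mu$, $\tilde\mu$ and $P$ be the price, trend, exponential moving average and portfolio processes defined in the context. Put $\mathrm{SNR}=\frac{\sigma_\mu^2}{2\lambda\sigma_S^2}$. Then $$\lim_{T\to\infty}\frac{\mathbb{E}\left[\ln\left(\frac{P_T}{P_0}\right)\right]}{T}=m\,\frac{2\tau(2-m)\,\mathrm{SNR}-m(\lambda\tau+1)}{4\tau(\lambda\tau+1)}.$$ Moreover (viewing the right-hand side, with $m$ and $\tau$ fixed, as a function of $\lambda$ and $\mathrm{SNR}$): (1) if $m<2$, then for a fixed value of the parameter $\lambda$, this asymptotic expected logarithmic return is an increasing function of $\mathrm{SNR}$; (2) for a fixed value of the parameter $\mathrm{SNR}$, it is a decreasing function of $\lambda$.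
   Context: Market model: $(W^S,W^\mu)$ is a two-dimensional Wiener process with uncorrelated components. The risky asset price $S$ and its trend $\mu$ satisfy $$\frac{dS_t}{S_t}=\mu_t\,dt+\sigma_S\,dW^S_t,\qquad d\mu_t=-\lambda\mu_t\,dt+\sigma_\mu\,dW^\mu_t,\qquad \mu_0=0,$$ with constants $\lambda,\sigma_\mu,\sigma_S>0$. Strategy: for a duration $\tau>0$, the exponential moving average of returns $\tilde\mu$ is given by $$d\tilde\mu_t=-\frac1\tau\tilde\mu_t\,dt+\frac1\tau\frac{dS_t}{S_t},\qquad \tilde\mu_0=0.$$ For $m>0$, the portfolio value $P$ is given by $$\frac{dP_t}{P_t}=m\frac{\tilde\mu_t}{\sigma_S^2}\frac{dS_t}{S_t},\qquad P_0=x>0.$$ The quantity $\mathrm{SNR}$ is called the signal-to-noise ratio.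
   Formalization: Item (2) is stated only for m < 2: for m > 2 the right-hand side is strictly increasing in λ (e.g. m = 3), and for m = 2 it is constant, so the claim that it is decreasing in λ fails without this condition. *)

theory Defs
  imports "HOL-Probability.Probability"
begin

text \<open>Processes are indexed by real time, and only times t >= 0 matter. A filtration is used through
  the library locale \<^locale>\<open>filtration\<close>; its values at negative times play no role.\<close>

definition filtered_prob_space :: "'a measure \<Rightarrow> (real \<Rightarrow> 'a measure) \<Rightarrow> bool" where
  "filtered_prob_space M F \<longleftrightarrow>
     prob_space M \<and> filtration (space M) F \<and> (\<forall>t. subalgebra M (F t))"

definition continuous_adapted ::
  "'a measure \<Rightarrow> (real \<Rightarrow> 'a measure) \<Rightarrow> (real \<Rightarrow> 'a \<Rightarrow> real) \<Rightarrow> bool" where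
  "continuous_adapted M F X \<longleftrightarrow>
     (\<forall>t\<ge>0. X t \<in> borel_measurable (F t)) \<and>
     (\<forall>\<omega>\<in>space M. continuous_on {0..} (\<lambda>t. X t \<omega>))"

definition progressive ::
  "(real \<Rightarrow> 'a measure) \<Rightarrow> (real \<Rightarrow> 'a \<Rightarrow> real) \<Rightarrow> bool" where
  "progressive F H \<longleftrightarrow>
     (\<forall>t\<ge>0. (\<lambda>(s, \<omega>). H s \<omega>) \<in> borel_measurable (restrict_space borel {0..t} \<Otimes>\<^sub>M F t))"

text \<open>Two-dimensional Wiener process relative to F with uncorrelated components: the increment over
  [s, t] is centred Gaussian with covariance matrix (t - s) times the identity, and is independent of
  the past F s.\<close>

definition wiener_process2 ::
  "'a measure \<Rightarrow> (real \<Rightarrow> 'a measure) \<Rightarrow> (real \<Rightarrow> 'a \<Rightarrow> real) \<Rightarrow> (real \<Rightarrow> 'a \<Rightarrow> real) \<Rightarrow> bool" where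
  "wiener_process2 M F W1 W2 \<longleftrightarrow>
     continuous_adapted M F W1 \<and> continuous_adapted M F W2 \<and>
     (AE \<omega> in M. W1 0 \<omega> = 0 \<and> W2 0 \<omega> = 0) \<and>
     (\<forall>s t. 0 \<le> s \<and> s < t \<longrightarrow>
        distributed M lborel (\<lambda>\<omega>. (W1 t \<omega> - W1 s \<omega>, W2 t \<omega> - W2 s \<omega>))
          (\<lambda>(x, y). ennreal (normal_density 0 (sqrt (t - s)) x * normal_density 0 (sqrt (t - s)) y)) \<and>
        prob_space.indep_set M (sets (F s))
          {(\<lambda>\<omega>. (W1 t \<omega> - W1 s \<omega>, W2 t \<omega> - W2 s \<omega>)) -` A \<inter> space M | A. A \<in> sets borel})"

text \<open>A simple integrand is given by n, grid points p 0 <= ... <= p n and bounded weights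
  \<xi> i known at time p i; it has the value \<xi> i on the interval from p i (excluded) to p (i + 1).\<close>

definition simple_integrand ::
  "'a measure \<Rightarrow> (real \<Rightarrow> 'a measure) \<Rightarrow> nat \<Rightarrow> (nat \<Rightarrow> real) \<Rightarrow> (nat \<Rightarrow> 'a \<Rightarrow> real) \<Rightarrow> bool" where
  "simple_integrand M F n p \<xi> \<longleftrightarrow>
     0 \<le> p 0 \<and> (\<forall>i<n. p i \<le> p (Suc i)) \<and>
     (\<forall>i<n. \<xi> i \<in> borel_measurable (F (p i)) \<and> (\<exists>B. \<forall>\<omega>\<in>space M. \<bar>\<xi> i \<omega>\<bar> \<le> B))"

definition simple_process ::
  "nat \<Rightarrow> (nat \<Rightarrow> real) \<Rightarrow> (nat \<Rightarrow> 'a \<Rightarrow> real) \<Rightarrow> real \<Rightarrow> 'a \<Rightarrow> real" where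
  "simple_process n p \<xi> s \<omega> = (\<Sum>i<n. \<xi> i \<omega> * indicator {p i<..p (Suc i)} s)"

definition simple_integral ::
  "(real \<Rightarrow> 'a \<Rightarrow> real) \<Rightarrow> nat \<Rightarrow> (nat \<Rightarrow> real) \<Rightarrow> (nat \<Rightarrow> 'a \<Rightarrow> real) \<Rightarrow> real \<Rightarrow> 'a \<Rightarrow> real" where
  "simple_integral W n p \<xi> t \<omega> =
     (\<Sum>i<n. \<xi> i \<omega> * (W (min t (p (Suc i))) \<omega> - W (min t (p i)) \<omega>))"

text \<open>\<open>has_ito_integral M F W H t Y\<close>: the random variable Y is (a version of) the Ito integral of H
  against the Wiener process W over [0, t]. It is the limit in probability of the integrals of simple
  integrands that approximate H, the approximation being that the integral over [0, t] of the squared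
  difference tends to 0 in probability. Such approximations exist iff the progressive process H
  is almost surely square integrable on [0, t], and Y is then almost surely unique.\<close>

definition has_ito_integral ::
  "'a measure \<Rightarrow> (real \<Rightarrow> 'a measure) \<Rightarrow> (real \<Rightarrow> 'a \<Rightarrow> real) \<Rightarrow> (real \<Rightarrow> 'a \<Rightarrow> real) \<Rightarrow>
   real \<Rightarrow> ('a \<Rightarrow> real) \<Rightarrow> bool" where
  "has_ito_integral M F W H t Y \<longleftrightarrow>
     progressive F H \<and> Y \<in> borel_measurable M \<and>
     (\<exists>n p \<xi>.
        (\<forall>k. simple_integrand M F (n k) (p k) (\<xi> k)) \<and>
        (\<forall>\<epsilon>>0. (\<lambda>k. measure M {\<omega>\<in>space M.
            (\<integral>\<^sup>+ s\<in>{0..t}. ennreal ((simple_process (n k) (p k) (\<xi> k) s \<omega> - H s \<omega>)\<^sup>2) \<partial>lborel)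
              > ennreal \<epsilon>}) \<longlonglongrightarrow> 0) \<and>
        (\<forall>\<epsilon>>0. (\<lambda>k. measure M {\<omega>\<in>space M.
            \<bar>simple_integral W (n k) (p k) (\<xi> k) t \<omega> - Y \<omega>\<bar> > \<epsilon>}) \<longlonglongrightarrow> 0))"

text \<open>\<open>ito_differential M F W X a b\<close>: X is an Ito process with \<open>dX\<^sub>t = a\<^sub>t dt + b\<^sub>t dW\<^sub>t\<close>.\<close>

definition ito_differential ::
  "'a measure \<Rightarrow> (real \<Rightarrow> 'a measure) \<Rightarrow> (real \<Rightarrow> 'a \<Rightarrow> real) \<Rightarrow> (real \<Rightarrow> 'a \<Rightarrow> real) \<Rightarrow>
   (real \<Rightarrow> 'a \<Rightarrow> real) \<Rightarrow> (real \<Rightarrow> 'a \<Rightarrow> real) \<Rightarrow> bool" where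
  "ito_differential M F W X a b \<longleftrightarrow>
     continuous_adapted M F X \<and> progressive F a \<and> progressive F b \<and>
     (\<forall>t\<ge>0. (AE \<omega> in M. set_integrable lborel {0..t} (\<lambda>s. a s \<omega>)) \<and>
        has_ito_integral M F W b t (\<lambda>\<omega>. X t \<omega> - X 0 \<omega> - (LINT s:{0..t}|lborel. a s \<omega>)))"

text \<open>\<open>ito_differential_wrt M F W X c K Y\<close>: \<open>dX\<^sub>t = c\<^sub>t dt + K\<^sub>t dY\<^sub>t\<close>, where Y is an Ito process driven
  by W. As usual, \<open>K dY\<close> stands for \<open>K a dt + K b dW\<close> when \<open>dY = a dt + b dW\<close>. The coefficients a, b
  of Y are unique up to null sets of the product of dt and M, so it is immaterial whether
  one asks for the equation for some or for all of them.\<close>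

definition ito_differential_wrt ::
  "'a measure \<Rightarrow> (real \<Rightarrow> 'a measure) \<Rightarrow> (real \<Rightarrow> 'a \<Rightarrow> real) \<Rightarrow> (real \<Rightarrow> 'a \<Rightarrow> real) \<Rightarrow>
   (real \<Rightarrow> 'a \<Rightarrow> real) \<Rightarrow> (real \<Rightarrow> 'a \<Rightarrow> real) \<Rightarrow> (real \<Rightarrow> 'a \<Rightarrow> real) \<Rightarrow> bool" where
  "ito_differential_wrt M F W X c K Y \<longleftrightarrow>
     progressive F c \<and> progressive F K \<and>
     (\<exists>a b. ito_differential M F W Y a b) \<and>
     (\<forall>a b. ito_differential M F W Y a b \<longrightarrow>
        ito_differential M F W X (\<lambda>t \<omega>. c t \<omega> + K t \<omega> * a t \<omega>) (\<lambda>t \<omega>. K t \<omega> * b t \<omega>))"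

text \<open>A relation \<open>dX/X = dZ\<close> means that X does not vanish and \<open>dX = X dZ\<close>; likewise \<open>dS/S\<close> is
  \<open>(1/S) dS\<close>.\<close>

definition price_trend_model ::
  "'a measure \<Rightarrow> (real \<Rightarrow> 'a measure) \<Rightarrow> (real \<Rightarrow> 'a \<Rightarrow> real) \<Rightarrow> (real \<Rightarrow> 'a \<Rightarrow> real) \<Rightarrow>
   real \<Rightarrow> real \<Rightarrow> real \<Rightarrow> (real \<Rightarrow> 'a \<Rightarrow> real) \<Rightarrow> (real \<Rightarrow> 'a \<Rightarrow> real) \<Rightarrow> bool" where
  "price_trend_model M F WS W\<mu> lam \<sigma>\<mu> \<sigma>S S \<mu> \<longleftrightarrow>
     (AE \<omega> in M. \<forall>t\<ge>0. S t \<omega> \<noteq> 0) \<and>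
     ito_differential M F WS S (\<lambda>t \<omega>. S t \<omega> * \<mu> t \<omega>) (\<lambda>t \<omega>. S t \<omega> * \<sigma>S) \<and>
     ito_differential M F W\<mu> \<mu> (\<lambda>t \<omega>. - lam * \<mu> t \<omega>) (\<lambda>t \<omega>. \<sigma>\<mu>) \<and>
     (AE \<omega> in M. \<mu> 0 \<omega> = 0)"

definition ema_of_returns ::
  "'a measure \<Rightarrow> (real \<Rightarrow> 'a measure) \<Rightarrow> (real \<Rightarrow> 'a \<Rightarrow> real) \<Rightarrow>
   real \<Rightarrow> (real \<Rightarrow> 'a \<Rightarrow> real) \<Rightarrow> (real \<Rightarrow> 'a \<Rightarrow> real) \<Rightarrow> bool" where
  "ema_of_returns M F WS \<tau> S \<mu>' \<longleftrightarrow>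
     ito_differential_wrt M F WS \<mu>' (\<lambda>t \<omega>. - (1 / \<tau>) * \<mu>' t \<omega>) (\<lambda>t \<omega>. (1 / \<tau>) * (1 / S t \<omega>)) S \<and>
     (AE \<omega> in M. \<mu>' 0 \<omega> = 0)"

definition portfolio_value ::
  "'a measure \<Rightarrow> (real \<Rightarrow> 'a measure) \<Rightarrow> (real \<Rightarrow> 'a \<Rightarrow> real) \<Rightarrow>
   real \<Rightarrow> real \<Rightarrow> real \<Rightarrow> (real \<Rightarrow> 'a \<Rightarrow> real) \<Rightarrow> (real \<Rightarrow> 'a \<Rightarrow> real) \<Rightarrow> (real \<Rightarrow> 'a \<Rightarrow> real) \<Rightarrow> bool" where
  "portfolio_value M F WS m \<sigma>S x S \<mu>' P \<longleftrightarrow>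
     (AE \<omega> in M. \<forall>t\<ge>0. P t \<omega> \<noteq> 0) \<and>
     ito_differential_wrt M F WS P (\<lambda>t \<omega>. 0)
       (\<lambda>t \<omega>. P t \<omega> * (m * (\<mu>' t \<omega> / \<sigma>S\<^sup>2)) * (1 / S t \<omega>)) S \<and>
     (AE \<omega> in M. P 0 \<omega> = x)"

definition asymptotic_log_return :: "real \<Rightarrow> real \<Rightarrow> real \<Rightarrow> real \<Rightarrow> real" where
  "asymptotic_log_return m \<tau> lam SNR =
     m * ((2 * \<tau> * (2 - m) * SNR - m * (lam * \<tau> + 1)) / (4 * \<tau> * (lam * \<tau> + 1)))"

end

theory Submission
  imports Defs "HOL-Real_Asymp.Real_Asymp"
begin

text \<open>Since \<open>d\<mu>' = (\<mu> - \<mu>') dt / \<tau> + (\<sigma>S / \<tau>) dWS\<close>, the stochastic integral of \<open>\<mu>'\<close> against \<open>WS\<close> can be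
  eliminated from the logarithm of the portfolio, and the terms with \<open>\<mu> \<mu>'\<close> cancel: almost surely
  \<open>ln (P T / P 0) = m \<tau> / (2 \<sigma>S\<^sup>2) (\<mu>' T)\<^sup>2 - m T / (2 \<tau>) + m (1 - m / 2) / \<sigma>S\<^sup>2 \<integral> (\<mu>' s)\<^sup>2 ds\<close>.
  Instead of a general Ito formula this uses the expansion \<open>ln (1 + \<rho>) = \<rho> - \<rho>\<^sup>2 / 2 + O(\<rho>\<^sup>3)\<close> of the relative
  increments of \<open>P\<close> along uniform grids; the errors are sums of martingale differences, which tend to
  0 in probability by stopping them once their accumulated variance exceeds a level. Along a
  subsequence of grids everything converges almost surely, so the rest of the argument is pathwise.
  The second moments of \<open>\<mu>\<close> and \<open>\<mu>'\<close> satisfy a triangular linear system of integral equations,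
  from which the time average of the variance of \<open>\<mu>'\<close> is read off by l'Hopital's rule.\<close>

subsection \<open>Sums over grids\<close>

text \<open>The obstacle is how little \<open>has_ito_integral\<close> supplies: one random variable
  for each single time, a limit in probability along simple integrands chosen for that time alone,
  with no integral process and no isometry. Moreover the integrand of \<open>P\<close> contains
  \<open>P\<close> itself, whose moments are unknown, so mean-square estimates do not apply to it.
  Two devices answer this. The integral of \<mu>' against \<open>WS\<close> can be eliminated
  because the diffusion coefficient \<sigma>S / \<tau> of \<mu>' is a nonzero constant: up to drift,
  the increments of \<open>WS\<close> are multiples of those of \<mu>', and a sum of \<mu>' d\<mu>'
  is half a telescoping sum of squares minus half a quadratic variation. What is left is quadratic
  in \<mu>', so its expectation needs only second moments; their finiteness is derived pathwise from
  the linear integral equations, not assumed.\<close>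

lemma continuous_on_Icc_bounded:
  fixes f :: "real \<Rightarrow> real"
  assumes "continuous_on {u..v} f"
  obtains B where "\<And>s. s \<in> {u..v} \<Longrightarrow> \<bar>f s\<bar> \<le> B"
proof -
  have "bounded (f ` {u..v})" by (intro compact_imp_bounded compact_continuous_image assms) auto
  then obtain B where "\<forall>x\<in>f ` {u..v}. norm x \<le> B" unfolding bounded_iff ..
  then show ?thesis by (intro that[of B]) auto
qed

definition grid :: "real \<Rightarrow> real \<Rightarrow> nat \<Rightarrow> nat \<Rightarrow> real" where
  "grid u v l i = u + real i * ((v - u) / real l)"

text \<open>The last point not after \<open>s\<close> of the grid continued in both directions.
  Composed with it, a function becomes constant on cells, so a left sum is an integral over the
  whole interval and its limit a matter of dominated convergence.\<close>

definition grid_floor :: "real \<Rightarrow> real \<Rightarrow> nat \<Rightarrow> real \<Rightarrow> real" where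
  "grid_floor u v l s = u + of_int \<lfloor>(s - u) / ((v - u) / real l)\<rfloor> * ((v - u) / real l)"

lemma grid_0 [simp]: "grid u v l 0 = u"
  by (simp add: grid_def)

lemma grid_end: "l > 0 \<Longrightarrow> grid u v l l = v"
  by (simp add: grid_def)

lemma grid_Suc: "grid u v l (Suc i) = grid u v l i + (v - u) / real l"
  by (simp add: grid_def algebra_simps add_divide_distrib[symmetric] diff_divide_distrib[symmetric])

lemma grid_mono: "u \<le> v \<Longrightarrow> i \<le> j \<Longrightarrow> grid u v l i \<le> grid u v l j"
  by (simp add: grid_def mult_right_mono divide_right_mono)

lemma grid_ge: "u \<le> v \<Longrightarrow> u \<le> grid u v l i"
  using grid_mono[of u v 0 i l] by simp

lemma grid_le:
  assumes "u \<le> v" "i \<le> l" shows "grid u v l i \<le> v"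
proof (cases "l = 0")
  case False
  then show ?thesis using grid_mono[OF assms(1,2), of l] by (simp add: grid_end)
next
  case True then show ?thesis using assms by (simp add: grid_def)
qed

lemma grid_floor_eq:
  assumes "u < v" "l > 0" "grid u v l i \<le> s" "s < grid u v l (Suc i)"
  shows "grid_floor u v l s = grid u v l i"
proof -
  define D where "D = (v - u) / real l"
  have D: "D > 0" using assms by (simp add: D_def)
  have "real i \<le> (s - u) / D" "(s - u) / D < real i + 1"
    using assms(3,4) D by (simp_all add: grid_def D_def[symmetric] field_simps)
  then have "\<lfloor>(s - u) / D\<rfloor> = int i" by (simp add: floor_eq_iff)
  then show ?thesis by (simp add: grid_floor_def D_def grid_def)
qed

lemma grid_floor_bounds:
  assumes "u < v" "l > 0"
  shows "grid_floor u v l s \<le> s" "s - (v - u) / real l < grid_floor u v l s"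
proof -
  define D where "D = (v - u) / real l"
  have D: "D > 0" using assms by (simp add: D_def)
  have 1: "of_int \<lfloor>(s - u) / D\<rfloor> \<le> (s - u) / D" "(s - u) / D < of_int \<lfloor>(s - u) / D\<rfloor> + 1"
    by linarith+
  show "grid_floor u v l s \<le> s" "s - (v - u) / real l < grid_floor u v l s"
    using 1[unfolded pos_le_divide_eq[OF D] pos_divide_less_eq[OF D]]
    unfolding grid_floor_def D_def[symmetric] by (simp_all add: algebra_simps)
qed

lemma grid_floor_ge:
  assumes "u < v" "l > 0" "u \<le> s" shows "u \<le> grid_floor u v l s"
  using assms by (simp add: grid_floor_def)

lemma grid_floor_tendsto:
  assumes "u < v" shows "(\<lambda>l. grid_floor u v l s) \<longlonglongrightarrow> s"
proof (rule tendsto_sandwich)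
  show "\<forall>\<^sub>F l in sequentially. s - (v - u) / real l \<le> grid_floor u v l s"
    using eventually_gt_at_top[of 0] by eventually_elim (use grid_floor_bounds(2)[OF assms] less_imp_le in blast)
  show "\<forall>\<^sub>F l in sequentially. grid_floor u v l s \<le> s"
    using eventually_gt_at_top[of 0] by eventually_elim (use grid_floor_bounds(1)[OF assms] in blast)
  show "(\<lambda>l. s - (v - u) / real l) \<longlonglongrightarrow> s"
    using tendsto_diff[OF tendsto_const[of s] lim_const_over_n[of "v - u"]] by simp
qed auto

lemma has_integral_grid_floor:
  fixes \<phi> f :: "real \<Rightarrow> real"
  assumes "u < v" "l > 0" and f: "continuous_on {u..v} f" and "n \<le> l"
  shows "((\<lambda>s. \<phi> (grid_floor u v l s) * f s) has_integral
     (\<Sum>i<n. \<phi> (grid u v l i) * integral {grid u v l i..grid u v l (Suc i)} f)) {u..grid u v l n}"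
  using \<open>n \<le> l\<close>
proof (induction n)
  case 0
  then show ?case by (simp add: has_integral_refl)
next
  case (Suc n)
  let ?a = "grid u v l n" and ?b = "grid u v l (Suc n)"
  have le: "u \<le> ?a" "?a \<le> ?b" "?b \<le> v"
    using grid_ge[of u v l n] grid_mono[of u v n "Suc n" l] grid_le[of u v "Suc n" l] assms(1) Suc.prems
    by auto
  have "continuous_on {?a..?b} f"
    by (rule continuous_on_subset[OF f]) (use le in auto)
  then have "(f has_integral integral {?a..?b} f) {?a..?b}"
    by (simp add: integrable_continuous_real integrable_integral)
  then have *: "((\<lambda>s. \<phi> ?a * f s) has_integral \<phi> ?a * integral {?a..?b} f) {?a..?b}"
    by (rule has_integral_mult_right)
  have eq: "\<phi> (grid_floor u v l s) * f s = \<phi> ?a * f s" if "s \<in> {?a..?b} - {?b}" for s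
  proof -
    have "grid_floor u v l s = ?a" by (rule grid_floor_eq) (use assms that in auto)
    then show ?thesis by simp
  qed
  have "((\<lambda>s. \<phi> (grid_floor u v l s) * f s) has_integral \<phi> ?a * integral {?a..?b} f) {?a..?b}"
    by (rule has_integral_spike_finite[where S="{?b}" and f="\<lambda>s. \<phi> ?a * f s", OF _ eq *]) auto
  then have "((\<lambda>s. \<phi> (grid_floor u v l s) * f s) has_integral
    ((\<Sum>i<n. \<phi> (grid u v l i) * integral {grid u v l i..grid u v l (Suc i)} f)
      + \<phi> ?a * integral {?a..?b} f)) {u..?b}"
    using Suc.prems by (intro has_integral_combine[OF le(1,2) Suc.IH]) auto
  then show ?case by (simp only: sum.lessThan_Suc)
qed

text \<open>Covers Riemann sums (with \<open>f = 1\<close>) as well as the drift terms of the discretised processes;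
  \<open>\<phi>\<close> only has to be left-continuous, which admits step functions.\<close>

lemma left_sum_tendsto:
  fixes \<phi> f :: "real \<Rightarrow> real"
  assumes "u < v" and f: "continuous_on {u..v} f" and B: "\<And>s. s \<in> {u..v} \<Longrightarrow> \<bar>\<phi> s\<bar> \<le> B"
    and cont: "\<And>s xs. u < s \<Longrightarrow> s < v \<Longrightarrow> xs \<longlonglongrightarrow> s \<Longrightarrow> \<forall>\<^sub>F l in sequentially. u \<le> xs l \<and> xs l \<le> s
      \<Longrightarrow> (\<lambda>l::nat. \<phi> (xs l)) \<longlonglongrightarrow> \<phi> s"
  shows "(\<lambda>s. \<phi> s * f s) integrable_on {u..v}"
    and "(\<lambda>l. \<Sum>i<l. \<phi> (grid u v l i) * integral {grid u v l i..grid u v l (Suc i)} f)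
       \<longlonglongrightarrow> integral {u..v} (\<lambda>s. \<phi> s * f s)"
proof -
  have sums: "((\<lambda>s. \<phi> (grid_floor u v l s) * f s) has_integral
     (\<Sum>i<l. \<phi> (grid u v l i) * integral {grid u v l i..grid u v l (Suc i)} f)) {u..v}" if "l > 0" for l
    using has_integral_grid_floor[OF assms(1) that f order_refl, of \<phi>] that by (simp add: grid_end)
  have B0: "B \<ge> 0" using B[of u] assms(1) by auto
  have fi: "(\<lambda>s. \<bar>f s\<bar>) integrable_on {u..v}"
    by (intro integrable_continuous_real continuous_intros f)
  \<comment> \<open>\<open>Suc l\<close> keeps clear of the degenerate grid without cells, and the
    open interval keeps clear of the two ends, about which \<open>cont\<close> says nothing.\<close>
  have int: "((\<lambda>s. \<phi> (grid_floor u v (Suc l) s) * f s)) integrable_on {u<..<v}" for l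
    using sums[of "Suc l"] by (auto simp: integrable_on_Icc_iff_Ioo[symmetric] has_integral_iff)
  have h: "(\<lambda>s. B * \<bar>f s\<bar>) integrable_on {u<..<v}"
    using integrable_on_mult_right[OF fi, of B] by (simp add: integrable_on_Icc_iff_Ioo)
  have bnd: "norm (\<phi> (grid_floor u v (Suc l) s) * f s) \<le> B * \<bar>f s\<bar>" if s: "s \<in> {u<..<v}" for l s
  proof -
    have "grid_floor u v (Suc l) s \<in> {u..v}"
      using grid_floor_bounds(1)[OF assms(1), of "Suc l" s] grid_floor_ge[OF assms(1), of "Suc l" s] s by auto
    then show ?thesis
      using B by (simp add: abs_mult mult_right_mono)
  qed
  have lim: "(\<lambda>l. \<phi> (grid_floor u v (Suc l) s) * f s) \<longlonglongrightarrow> \<phi> s * f s"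
    if s: "s \<in> {u<..<v}" for s
  proof -
    have "(\<lambda>l. \<phi> (grid_floor u v (Suc l) s)) \<longlonglongrightarrow> \<phi> s"
    proof (rule cont)
      show "(\<lambda>l. grid_floor u v (Suc l) s) \<longlonglongrightarrow> s"
        using LIMSEQ_Suc[OF grid_floor_tendsto[OF assms(1)]] .
      show "\<forall>\<^sub>F l in sequentially. u \<le> grid_floor u v (Suc l) s \<and> grid_floor u v (Suc l) s \<le> s"
        using grid_floor_bounds(1)[OF assms(1)] grid_floor_ge[OF assms(1)] s by simp
    qed (use s in auto)
    then show ?thesis
      by (intro tendsto_intros)
  qed
  note dominated_convergence[where f="\<lambda>l s. \<phi> (grid_floor u v (Suc l) s) * f s" and g="\<lambda>s. \<phi> s * f s",
      OF int h bnd lim]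
  then have *: "(\<lambda>s. \<phi> s * f s) integrable_on {u..v}"
    "(\<lambda>l. integral {u..v} (\<lambda>s. \<phi> (grid_floor u v (Suc l) s) * f s)) \<longlonglongrightarrow>
     integral {u..v} (\<lambda>s. \<phi> s * f s)"
    by (simp_all add: integrable_on_Icc_iff_Ioo integral_open_interval_real)
  show "(\<lambda>s. \<phi> s * f s) integrable_on {u..v}" by fact
  have "integral {u..v} (\<lambda>s. \<phi> (grid_floor u v (Suc l) s) * f s) =
    (\<Sum>i<Suc l. \<phi> (grid u v (Suc l) i) * integral {grid u v (Suc l) i..grid u v (Suc l) (Suc i)} f)" for l
    using sums[of "Suc l"] by (simp add: integral_unique del: sum.lessThan_Suc)
  with *(2) have "(\<lambda>l. \<Sum>i<Suc l. \<phi> (grid u v (Suc l) i) * integral {grid u v (Suc l) i..grid u v (Suc l) (Suc i)} f)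
    \<longlonglongrightarrow> integral {u..v} (\<lambda>s. \<phi> s * f s)" by (simp del: sum.lessThan_Suc)
  then show "(\<lambda>l. \<Sum>i<l. \<phi> (grid u v l i) * integral {grid u v l i..grid u v l (Suc i)} f)
       \<longlonglongrightarrow> integral {u..v} (\<lambda>s. \<phi> s * f s)"
    by (rule LIMSEQ_imp_Suc)
qed

lemma left_sum_tendsto_continuous:
  fixes \<phi> f :: "real \<Rightarrow> real"
  assumes "u < v" and f: "continuous_on {u..v} f" and \<phi>: "continuous_on {u..v} \<phi>"
  shows "(\<lambda>l. \<Sum>i<l. \<phi> (grid u v l i) * integral {grid u v l i..grid u v l (Suc i)} f)
       \<longlonglongrightarrow> integral {u..v} (\<lambda>s. \<phi> s * f s)"
proof -
  obtain B where B: "\<And>s. s \<in> {u..v} \<Longrightarrow> \<bar>\<phi> s\<bar> \<le> B" using continuous_on_Icc_bounded[OF \<phi>] by blast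
  show ?thesis
  proof (rule left_sum_tendsto(2)[where B = B and \<phi> = \<phi> and f = f, OF assms(1) f B])
    fix s :: real and xs :: "nat \<Rightarrow> real"
    assume *: "u < s" "s < v" "xs \<longlonglongrightarrow> s" "\<forall>\<^sub>F l in sequentially. u \<le> xs l \<and> xs l \<le> s"
    show "(\<lambda>l. \<phi> (xs l)) \<longlonglongrightarrow> \<phi> s"
    proof (rule continuous_on_tendsto_compose[OF \<phi> *(3)])
      show "\<forall>\<^sub>F l in sequentially. xs l \<in> {u..v}" using *(4) by eventually_elim (use * in auto)
    qed (use * in auto)
  qed auto
qed

section \<open>Step functions and simple integrals along grids\<close>

text \<open>The grid points not after \<open>b\<close> form an initial segment, so the sum
  telescopes, up to the first grid point past \<open>b\<close> or up to \<open>v\<close>. That end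
  point lies within one cell of min v b, and \<open>w\<close> is continuous. The difference of two
  such sums is the sum for the indicator of a half-open interval.\<close>

lemma step_increment_sum_tendsto:
  fixes w :: "real \<Rightarrow> real"
  assumes w: "continuous_on {0..} w" and "0 \<le> u" "u < v" "0 \<le> b"
  shows "(\<lambda>l. \<Sum>j<l. if grid u v l j \<le> b then w (grid u v l (Suc j)) - w (grid u v l j) else 0)
    \<longlonglongrightarrow> w (min v b) - w (min u b)"
proof (cases "b < u")
  case True
  have "(\<Sum>j<l. if grid u v l j \<le> b then w (grid u v l (Suc j)) - w (grid u v l j) else 0) = 0" for l
  proof (rule sum.neutral, safe)
    fix j show "(if grid u v l j \<le> b then w (grid u v l (Suc j)) - w (grid u v l j) else 0) = 0"
      using grid_ge[of u v l j] True assms by simp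
  qed
  then show ?thesis using True assms by (simp add: min_def)
next
  case False
  then have ub: "u \<le> b" by simp
  \<comment> \<open>The number of left grid points that are at most \<open>b\<close>, hence the
    index at which the telescoped sum ends.\<close>
  define c where "c l = min l (nat \<lfloor>(b - u) / ((v - u) / real l)\<rfloor> + 1)" for l
  have sum_eq: "(\<Sum>j<l. if grid u v l j \<le> b then w (grid u v l (Suc j)) - w (grid u v l j) else 0)
     = w (grid u v l (c l)) - w u" if "l > 0" for l
  proof -
    define D where "D = (v - u) / real l"
    have D: "D > 0" using assms that by (simp add: D_def)
    have iff: "grid u v l j \<le> b \<longleftrightarrow> j < nat \<lfloor>(b - u) / D\<rfloor> + 1" for j
    proof -
      have "grid u v l j \<le> b \<longleftrightarrow> real j \<le> (b - u) / D"
        using D by (simp add: grid_def D_def[symmetric] pos_le_divide_eq algebra_simps)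
      also have "\<dots> \<longleftrightarrow> int j \<le> \<lfloor>(b - u) / D\<rfloor>" by (simp add: le_floor_iff)
      also have "\<dots> \<longleftrightarrow> j < nat \<lfloor>(b - u) / D\<rfloor> + 1"
        using ub D by (simp add: nat_le_iff le_nat_iff less_Suc_eq_le)
      finally show ?thesis .
    qed
    have "(\<Sum>j<l. if grid u v l j \<le> b then w (grid u v l (Suc j)) - w (grid u v l j) else 0)
       = (\<Sum>j\<in>{..<l} \<inter> {j. grid u v l j \<le> b}. w (grid u v l (Suc j)) - w (grid u v l j))"
      by (subst sum.inter_restrict) auto
    also have "{..<l} \<inter> {j. grid u v l j \<le> b} = {..<c l}"
      by (auto simp: iff c_def D_def[symmetric])
    also have "(\<Sum>j\<in>{..<c l}. w (grid u v l (Suc j)) - w (grid u v l j)) = w (grid u v l (c l)) - w u"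
      by (subst sum_lessThan_telescope) simp
    finally show ?thesis .
  qed
  have bnd: "\<bar>grid u v l (c l) - min v b\<bar> \<le> (v - u) / real l" if "l > 0" for l
  proof -
    define D where "D = (v - u) / real l"
    have D: "D > 0" using assms that by (simp add: D_def)
    define q where "q = \<lfloor>(b - u) / D\<rfloor>"
    have q: "of_int q * D \<le> b - u" "b - u < (of_int q + 1) * D"
      using floor_correct[of "(b - u) / D", unfolded pos_le_divide_eq[OF D] pos_divide_less_eq[OF D]]
      by (simp_all add: q_def)
    have q0: "q \<ge> 0" using ub D by (simp add: q_def)
    have c: "c l = min l (nat q + 1)" by (simp add: c_def q_def D_def)
    show ?thesis
    proof (cases "l \<le> nat q + 1")
      case True
      then have "grid u v l (c l) = v" using that by (simp add: c min_def grid_end)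
      moreover have "(real l - 1) * D \<le> of_int q * D"
        by (rule mult_right_mono) (use True q0 D in linarith)+
      moreover have "real l * D = v - u" using that by (simp add: D_def)
      ultimately show ?thesis using q(1) D unfolding D_def[symmetric]
        by (simp add: algebra_simps min_def)
    next
      case False
      then have "grid u v l (c l) = u + (of_int q + 1) * D"
        using q0 by (simp add: c min_def grid_def D_def)
      moreover have "grid u v l (c l) \<le> v" using assms by (intro grid_le) (auto simp: c_def)
      ultimately show ?thesis using q D unfolding D_def[symmetric] by (simp add: algebra_simps min_def)
    qed
  qed
  have "(\<lambda>l. grid u v l (c l) - min v b) \<longlonglongrightarrow> 0"
  proof (rule Lim_null_comparison[OF _ lim_const_over_n[of "v - u"]])
    show "\<forall>\<^sub>F l in sequentially. norm (grid u v l (c l) - min v b) \<le> (v - u) / real l"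
      using eventually_gt_at_top[of 0] by eventually_elim (use bnd in simp)
  qed
  then have lim: "(\<lambda>l. grid u v l (c l)) \<longlonglongrightarrow> min v b" by (simp add: Lim_null[symmetric])
  have "(\<lambda>l. w (grid u v l (c l))) \<longlonglongrightarrow> w (min v b)"
  proof (rule continuous_on_tendsto_compose[OF w lim])
    show "\<forall>\<^sub>F l in sequentially. grid u v l (c l) \<in> {0..}"
      using grid_ge[of u v] assms by (auto intro!: always_eventually order_trans[of 0 u])
  qed (use assms in auto)
  then have "(\<lambda>l. w (grid u v l (c l)) - w u) \<longlonglongrightarrow> w (min v b) - w u" by (intro tendsto_intros)
  moreover have "\<forall>\<^sub>F l in sequentially. w (grid u v l (c l)) - w u =
    (\<Sum>j<l. if grid u v l j \<le> b then w (grid u v l (Suc j)) - w (grid u v l j) else 0)"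
    using eventually_gt_at_top[of 0] by eventually_elim (simp add: sum_eq)
  ultimately show ?thesis using ub by (simp add: Lim_transform_eventually min_absorb1)
qed

text \<open>Simple integrands are constant on intervals open on the left and closed on the right, so values at
  left grid points converge without any further regularity.\<close>

definition left_locally_constant :: "(real \<Rightarrow> real) \<Rightarrow> bool" where
  "left_locally_constant f \<longleftrightarrow> (\<forall>s>0. \<forall>\<^sub>F r in at_left s. f r = f s)"

lemma left_locally_constant_tendsto:
  assumes "left_locally_constant f" "s > 0" "xs \<longlonglongrightarrow> s" "\<forall>\<^sub>F l in sequentially. xs l \<le> s"
  shows "(\<lambda>l::nat. f (xs l)) \<longlonglongrightarrow> f s"
proof -
  from assms(1,2) obtain b where b: "b < s" "\<And>r. b < r \<Longrightarrow> r < s \<Longrightarrow> f r = f s"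
    unfolding left_locally_constant_def eventually_at_left_field by blast
  have "\<forall>\<^sub>F l in sequentially. f (xs l) = f s"
    using order_tendstoD(1)[OF assms(3) b(1)] assms(4)
    by eventually_elim (use b(2) in \<open>force simp: le_less\<close>)
  then show ?thesis by (rule tendsto_eventually)
qed

lemma left_locally_constant_diff:
  assumes "left_locally_constant f" "left_locally_constant g"
  shows "left_locally_constant (\<lambda>s. f s - g s)"
  unfolding left_locally_constant_def
proof safe
  fix s :: real assume "s > 0"
  with assms have "\<forall>\<^sub>F r in at_left s. f r = f s" "\<forall>\<^sub>F r in at_left s. g r = g s"
    unfolding left_locally_constant_def by auto
  then show "\<forall>\<^sub>F r in at_left s. f r - g r = f s - g s" by eventually_elim simp
qed

lemma left_locally_constant_step_sum:
  assumes "\<And>i. i < n \<Longrightarrow> p i \<le> p (Suc i)"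
  shows "left_locally_constant (\<lambda>s. \<Sum>i<n. c i * indicator {p i<..p (Suc i)} s)"
  unfolding left_locally_constant_def
proof safe
  fix s :: real assume "s > 0"
  have "\<forall>\<^sub>F r in at_left s. (indicator {a<..b} r :: real) = indicator {a<..b} s" for a b :: real
  proof (cases "a < s")
    case True
    have "\<forall>\<^sub>F r in at_left s. r < s" unfolding eventually_at_filter by simp
    moreover have "\<forall>\<^sub>F r in at_left s. a < r"
      using True eventually_at_left_field by blast
    moreover have "\<forall>\<^sub>F r in at_left s. b < s \<longrightarrow> b < r"
      using eventually_at_left_field[of "\<lambda>r. b < r" s] by (cases "b < s") auto
    ultimately show ?thesis by eventually_elim (use True in \<open>auto simp: indicator_def\<close>)
  next
    case False
    have "\<forall>\<^sub>F r in at_left s. r < s" unfolding eventually_at_filter by simp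
    then show ?thesis by eventually_elim (use False in \<open>auto simp: indicator_def\<close>)
  qed
  then have "\<forall>\<^sub>F r in at_left s. \<forall>i\<in>{..<n}. (indicator {p i<..p (Suc i)} r :: real) = indicator {p i<..p (Suc i)} s"
    by (subst eventually_ball_finite_distrib) auto
  then show "\<forall>\<^sub>F r in at_left s. (\<Sum>i<n. c i * indicator {p i<..p (Suc i)} r)
       = (\<Sum>i<n. c i * indicator {p i<..p (Suc i)} s)"
    by eventually_elim (auto intro!: sum.cong)
qed

lemma left_locally_constant_sum_tendsto:
  assumes "left_locally_constant f" "0 \<le> u" "u < v" "\<And>s. s \<in> {u..v} \<Longrightarrow> \<bar>f s\<bar> \<le> B"
  shows "f integrable_on {u..v}"
    and "(\<lambda>l. \<Sum>i<l. f (grid u v l i) * ((v - u) / real l)) \<longlonglongrightarrow> integral {u..v} f"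
proof -
  have cont: "(\<lambda>l::nat. f (xs l)) \<longlonglongrightarrow> f s"
    if "u < s" "s < v" "xs \<longlonglongrightarrow> s" "\<forall>\<^sub>F l in sequentially. u \<le> xs l \<and> xs l \<le> s" for s xs
    using that assms(2) by (intro left_locally_constant_tendsto[OF assms(1)]) (auto elim: eventually_mono)
  note L = left_sum_tendsto[where f="\<lambda>_. 1" and \<phi>=f and B=B and u=u and v=v]
  have "(\<lambda>s. f s * 1) integrable_on {u..v}"
    by (rule L(1)) (use assms cont in auto)
  then show "f integrable_on {u..v}" by simp
  have *: "(\<lambda>l. \<Sum>i<l. f (grid u v l i) * integral {grid u v l i..grid u v l (Suc i)} (\<lambda>_. 1::real))
    \<longlonglongrightarrow> integral {u..v} (\<lambda>s. f s * 1)"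
    by (rule L(2)) (use assms cont in auto)
  have "integral {grid u v l i..grid u v l (Suc i)} (\<lambda>_. 1::real) = (v - u) / real l" for l i
    using grid_mono[of u v i "Suc i" l] assms(3) by (simp add: grid_Suc)
  with * show "(\<lambda>l. \<Sum>i<l. f (grid u v l i) * ((v - u) / real l)) \<longlonglongrightarrow> integral {u..v} f"
    by simp
qed

text \<open>The grid need not contain the jump times p i: in the limit, a cell around a jump
  contributes nothing because the path of \<open>W\<close> is continuous. In this way an integral
  over an arbitrary partition is reached from uniform grids, and two integrands with different
  partitions from the same grids.\<close>

lemma simple_integral_increment_tendsto:
  fixes W :: "real \<Rightarrow> 'a \<Rightarrow> real"
  assumes W: "continuous_on {0..} (\<lambda>t. W t \<omega>)" and "0 \<le> u" "u < v"
    and p: "0 \<le> p 0" "\<And>i. i < n \<Longrightarrow> p i \<le> p (Suc i)"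
  shows "(\<lambda>l. \<Sum>j<l. simple_process n p \<xi> (grid u v l j) \<omega> * (W (grid u v l (Suc j)) \<omega> - W (grid u v l j) \<omega>))
    \<longlonglongrightarrow> simple_integral W n p \<xi> v \<omega> - simple_integral W n p \<xi> u \<omega>"
proof -
  have p0: "0 \<le> p i" if "i \<le> n" for i using that
  proof (induction i)
    case (Suc i) then show ?case using p(2)[of i] by simp
  qed (use p in simp)
  define st where "st l b = (\<Sum>j<l. if grid u v l j \<le> b then W (grid u v l (Suc j)) \<omega> - W (grid u v l j) \<omega> else 0)"
    for l b
  have lim: "(\<lambda>l. st l b) \<longlonglongrightarrow> W (min v b) \<omega> - W (min u b) \<omega>" if "0 \<le> b" for b
    using step_increment_sum_tendsto[OF W assms(2,3) that] by (simp add: st_def)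
  have "(\<lambda>l. \<Sum>i<n. \<xi> i \<omega> * (st l (p (Suc i)) - st l (p i))) \<longlonglongrightarrow>
    (\<Sum>i<n. \<xi> i \<omega> * ((W (min v (p (Suc i))) \<omega> - W (min u (p (Suc i))) \<omega>) - (W (min v (p i)) \<omega> - W (min u (p i)) \<omega>)))"
    by (intro tendsto_intros lim p0) auto
  also have "(\<Sum>i<n. \<xi> i \<omega> * ((W (min v (p (Suc i))) \<omega> - W (min u (p (Suc i))) \<omega>) - (W (min v (p i)) \<omega> - W (min u (p i)) \<omega>)))
    = simple_integral W n p \<xi> v \<omega> - simple_integral W n p \<xi> u \<omega>"
    unfolding simple_integral_def sum_subtractf[symmetric] by (intro sum.cong) (auto simp: algebra_simps)
  also have "(\<lambda>l. \<Sum>i<n. \<xi> i \<omega> * (st l (p (Suc i)) - st l (p i))) =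
    (\<lambda>l. \<Sum>j<l. simple_process n p \<xi> (grid u v l j) \<omega> * (W (grid u v l (Suc j)) \<omega> - W (grid u v l j) \<omega>))"
  proof
    fix l
    \<comment> \<open>As p i \<le> p (Suc i), the indicator of {p i<..p (Suc i)} at a grid point is
      the difference of the two conditions counted by \<open>st\<close>.\<close>
    have "(\<Sum>i<n. \<xi> i \<omega> * (st l (p (Suc i)) - st l (p i))) =
      (\<Sum>i<n. \<Sum>j<l. \<xi> i \<omega> * indicator {p i<..p (Suc i)} (grid u v l j) * (W (grid u v l (Suc j)) \<omega> - W (grid u v l j) \<omega>))"
      unfolding st_def sum_subtractf[symmetric] sum_distrib_left
      using p(2) by (intro sum.cong refl) (force simp: indicator_def)
    also have "\<dots> = (\<Sum>j<l. simple_process n p \<xi> (grid u v l j) \<omega> * (W (grid u v l (Suc j)) \<omega> - W (grid u v l j) \<omega>))"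
      by (subst sum.swap) (simp only: simple_process_def sum_distrib_right)
    finally show "(\<Sum>i<n. \<xi> i \<omega> * (st l (p (Suc i)) - st l (p i))) = \<dots>" .
  qed
  finally show ?thesis .
qed

section \<open>Pathwise formulas for the logarithm and the square\<close>

lemma sum_grid_telescope:
  fixes f :: "real \<Rightarrow> real"
  assumes "l > 0"
  shows "(\<Sum>i<l. f (grid u v l (Suc i)) - f (grid u v l i)) = f v - f u"
  using sum_lessThan_telescope[of "\<lambda>i. f (grid u v l i)" l] assms by (simp add: grid_end)

text \<open>By Cauchy-Schwarz the cross terms are at most the square root of a product of a
  convergent and a vanishing sum. Hence drift and discretisation error leave a quadratic variation
  unchanged.\<close>

lemma sum_square_perturbation_tendsto:
  fixes x z :: "nat \<Rightarrow> nat \<Rightarrow> real"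
  assumes x: "(\<lambda>k. \<Sum>i<r k. (x k i)\<^sup>2) \<longlonglongrightarrow> X" and z: "(\<lambda>k. \<Sum>i<r k. (z k i)\<^sup>2) \<longlonglongrightarrow> 0"
  shows "(\<lambda>k. \<Sum>i<r k. (x k i + z k i)\<^sup>2) \<longlonglongrightarrow> X"
proof -
  let ?x = "\<lambda>k. \<Sum>i<r k. (x k i)\<^sup>2" and ?z = "\<lambda>k. \<Sum>i<r k. (z k i)\<^sup>2"
  have "(\<lambda>k. 2 * sqrt (?x k * ?z k)) \<longlonglongrightarrow> 2 * sqrt (X * 0)"
    by (intro tendsto_intros x z)
  then have cs: "(\<lambda>k. 2 * sqrt (?x k * ?z k)) \<longlonglongrightarrow> 0" by simp
  have "(\<lambda>k. 2 * (\<Sum>i<r k. x k i * z k i)) \<longlonglongrightarrow> 0"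
  proof (rule Lim_null_comparison[OF always_eventually cs], safe)
    fix k
    have "(\<Sum>i<r k. x k i * z k i)\<^sup>2 \<le> ?x k * ?z k" by (rule Cauchy_Schwarz_ineq_sum)
    then have "\<bar>\<Sum>i<r k. x k i * z k i\<bar> \<le> sqrt (?x k * ?z k)" by (rule real_le_rsqrt[OF power2_abs[THEN ord_eq_le_trans]])
    then show "norm (2 * (\<Sum>i<r k. x k i * z k i)) \<le> 2 * sqrt (?x k * ?z k)" by (simp only: real_norm_def abs_mult abs_numeral)
  qed
  with x z have "(\<lambda>k. ?x k + 2 * (\<Sum>i<r k. x k i * z k i) + ?z k) \<longlonglongrightarrow> X + 0 + 0"
    by (intro tendsto_add)
  then show ?thesis
    by (simp add: power2_sum sum.distrib sum_distrib_left algebra_simps)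
qed

text \<open>Drift increments are of order 1 / n, and n of their squares only add up to order 1 / n:
  a drift has no quadratic variation.\<close>

lemma square_sum_le_bound:
  fixes a :: "nat \<Rightarrow> real"
  assumes "\<And>i. i < n \<Longrightarrow> \<bar>a i\<bar> \<le> C / real n"
  shows "(\<Sum>i<n. (a i)\<^sup>2) \<le> C\<^sup>2 / real n"
proof -
  have "(\<Sum>i<n. (a i)\<^sup>2) \<le> (\<Sum>i<n. (C / real n)\<^sup>2)"
    using assms by (intro sum_mono) (metis abs_le_square_iff abs_of_nonneg abs_ge_zero lessThan_iff order_trans)
  also have "\<dots> = C\<^sup>2 / real n" by (simp add: power2_eq_square)
  finally show ?thesis .
qed

lemma strict_mono_compose_tendsto:
  "strict_mono (r :: nat \<Rightarrow> nat) \<Longrightarrow> f \<longlonglongrightarrow> L \<Longrightarrow> (\<lambda>k. f (r k)) \<longlonglongrightarrow> L"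
  using LIMSEQ_subseq_LIMSEQ[of f L r] by (simp add: o_def)

lemma grid_step_integral_bound:
  fixes f :: "real \<Rightarrow> real"
  assumes "u < v" "i < n" and f: "continuous_on {u..v} f" and B: "\<And>s. s \<in> {u..v} \<Longrightarrow> \<bar>f s\<bar> \<le> B"
  shows "\<bar>integral {grid u v n i..grid u v n (Suc i)} f\<bar> \<le> B * (v - u) / real n"
proof -
  have sub: "{grid u v n i..grid u v n (Suc i)} \<subseteq> {u..v}"
    using grid_ge[of u v n i] grid_le[of u v "Suc i" n] assms by auto
  have le: "grid u v n i \<le> grid u v n (Suc i)" using assms by (intro grid_mono) auto
  have "norm (integral {grid u v n i..grid u v n (Suc i)} f) \<le> B * (grid u v n (Suc i) - grid u v n i)"
    by (rule integral_bound[OF le continuous_on_subset[OF f sub]]) (use B sub in auto)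
  then show ?thesis by (simp add: grid_Suc)
qed

lemma left_riemann_sum_continuous:
  fixes \<phi> :: "real \<Rightarrow> real"
  assumes "u < v" and \<phi>: "continuous_on {u..v} \<phi>"
  shows "(\<lambda>l. \<Sum>i<l. \<phi> (grid u v l i) * ((v - u) / real l)) \<longlonglongrightarrow> integral {u..v} \<phi>"
proof -
  have "integral {grid u v l i..grid u v l (Suc i)} (\<lambda>_. 1::real) = (v - u) / real l" for l i
    using grid_mono[of u v i "Suc i" l] assms by (simp add: grid_Suc)
  then show ?thesis
    using left_sum_tendsto_continuous[OF assms(1) continuous_on_const[of _ 1] \<phi>] by simp
qed

lemma grid_increment_eventually_small:
  fixes f :: "real \<Rightarrow> real"
  assumes "u < v" and f: "continuous_on {u..v} f" and "\<epsilon> > 0"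
  shows "\<forall>\<^sub>F n in sequentially. \<forall>i<n. \<bar>f (grid u v n (Suc i)) - f (grid u v n i)\<bar> < \<epsilon>"
proof -
  have "uniformly_continuous_on {u..v} f" using f by (intro compact_uniformly_continuous) auto
  then obtain d where d: "d > 0" "\<And>s t. s \<in> {u..v} \<Longrightarrow> t \<in> {u..v} \<Longrightarrow> dist t s < d \<Longrightarrow> dist (f t) (f s) < \<epsilon>"
    using assms(3) unfolding uniformly_continuous_on_def by metis
  have "\<forall>\<^sub>F n in sequentially. (v - u) / real n < d"
    using order_tendstoD(2)[OF lim_const_over_n d(1)] .
  then show ?thesis
  proof eventually_elim
    case (elim n)
    show ?case
    proof safe
      fix i assume "i < n"
      then have "grid u v n i \<in> {u..v}" "grid u v n (Suc i) \<in> {u..v}"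
        using assms by (auto intro: grid_ge grid_le)
      then show "\<bar>f (grid u v n (Suc i)) - f (grid u v n i)\<bar> < \<epsilon>"
        using d(2)[of "grid u v n i" "grid u v n (Suc i)"] elim assms by (simp add: dist_real_def grid_Suc)
    qed
  qed
qed

text \<open>The remainder has derivative x^2 / (1 + x), which is at most 2 * r^2 between -|r| and
  |r|. One factor |r| is kept apart so that, summed over a grid, the bound is the largest increment
  times the quadratic variation.\<close>

lemma abs_ln_quadratic_bound:
  fixes r :: real
  assumes "\<bar>r\<bar> \<le> 1 / 2"
  shows "\<bar>ln (1 + r) - r + r\<^sup>2 / 2\<bar> \<le> 2 * \<bar>r\<bar> * r\<^sup>2"
proof -
  define g where "g x = ln (1 + x) - x + x\<^sup>2 / 2" for x :: real
  have der: "(g has_real_derivative x\<^sup>2 / (1 + x)) (at x within {- \<bar>r\<bar>..\<bar>r\<bar>})" if "x \<in> {- \<bar>r\<bar>..\<bar>r\<bar>}" for x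
  proof -
    have "1 + x > 0" using that assms by auto
    then show ?thesis unfolding g_def
      by (auto intro!: derivative_eq_intros simp: field_simps power2_eq_square)
  qed
  have bnd: "norm (x\<^sup>2 / (1 + x)) \<le> 2 * r\<^sup>2" if "x \<in> {- \<bar>r\<bar>..\<bar>r\<bar>}" for x
  proof -
    have "1 + x \<ge> 1 / 2" using that assms by auto
    moreover have "x\<^sup>2 \<le> r\<^sup>2" using that by (intro abs_le_square_iff[THEN iffD1]) auto
    ultimately have "x\<^sup>2 / (1 + x) \<le> r\<^sup>2 / (1 / 2)" by (intro frac_le) auto
    with \<open>1 + x \<ge> 1 / 2\<close> show ?thesis by simp
  qed
  have "norm (g r - g 0) \<le> 2 * r\<^sup>2 * norm (r - 0)"
    by (rule field_differentiable_bound[of "{- \<bar>r\<bar>..\<bar>r\<bar>}", OF _ der bnd]) auto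
  then show ?thesis by (simp add: g_def mult_ac)
qed

text \<open>\<open>y\<close> plays the role of the stochastic integral of \<open>p b\<close> against \<open>w\<close>; all limits are only needed
  along a subsequence \<open>r\<close>, which is how they come out of convergence in probability.\<close>

lemma log_increment_sum_tendsto:
  fixes p \<alpha> b w y :: "real \<Rightarrow> real"
  assumes T: "T > 0" and r: "strict_mono r"
    and p: "continuous_on {0..T} p" "\<And>t. t \<in> {0..T} \<Longrightarrow> p t \<noteq> 0"
    and \<alpha>: "continuous_on {0..T} \<alpha>" and b: "continuous_on {0..T} b"
    and y: "\<And>t. t \<in> {0..T} \<Longrightarrow> y t = p t - p 0 - integral {0..t} (\<lambda>s. p s * \<alpha> s)"
    and e_def: "\<And>n i. e n i = (y (grid 0 T n (Suc i)) - y (grid 0 T n i)) / p (grid 0 T n i)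
        - b (grid 0 T n i) * (w (grid 0 T n (Suc i)) - w (grid 0 T n i))"
    and e: "(\<lambda>k. \<Sum>i<r k. e (r k) i) \<longlonglongrightarrow> 0" "(\<lambda>k. \<Sum>i<r k. (e (r k) i)\<^sup>2) \<longlonglongrightarrow> 0"
    and qv: "(\<lambda>k. \<Sum>i<r k. (b (grid 0 T (r k) i))\<^sup>2 *
        ((w (grid 0 T (r k) (Suc i)) - w (grid 0 T (r k) i))\<^sup>2 - T / real (r k))) \<longlonglongrightarrow> 0"
  shows "(\<lambda>k. \<Sum>i<r k. b (grid 0 T (r k) i) * (w (grid 0 T (r k) (Suc i)) - w (grid 0 T (r k) i)))
    \<longlonglongrightarrow> ln (p T / p 0) - integral {0..T} \<alpha> + integral {0..T} (\<lambda>s. (b s)\<^sup>2) / 2"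
proof -
  define t where "t n i = grid 0 T n i" for n i
  define x where "x n i = b (t n i) * (w (t n (Suc i)) - w (t n i))" for n i
  define a where "a n i = integral {t n i..t n (Suc i)} (\<lambda>s. p s * \<alpha> s) / p (t n i)" for n i
  define \<rho> where "\<rho> n i = (p (t n (Suc i)) - p (t n i)) / p (t n i)" for n i
  have tin: "t n i \<in> {0..T}" if "i \<le> n" for n i
    using that T by (auto simp: t_def intro: grid_ge grid_le)
  have p\<alpha>: "continuous_on {0..T} (\<lambda>s. p s * \<alpha> s)" by (intro continuous_intros p \<alpha>)
  have ip: "continuous_on {0..T} (\<lambda>s. 1 / p s)" by (intro continuous_intros p) (use p(2) in auto)
  \<comment> \<open>A relative increment splits into noise \<open>x\<close>, drift \<open>a\<close>,
    and the error \<open>e\<close> made by freezing the coefficient at the left end.\<close>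
  have \<rho>_eq: "\<rho> n i = x n i + (a n i + e n i)" if "i < n" for n i
  proof -
    have "integral {0..t n (Suc i)} (\<lambda>s. p s * \<alpha> s) - integral {0..t n i} (\<lambda>s. p s * \<alpha> s) =
       integral {t n i..t n (Suc i)} (\<lambda>s. p s * \<alpha> s)"
    proof -
      have "continuous_on {0..t n (Suc i)} (\<lambda>s. p s * \<alpha> s)"
        by (rule continuous_on_subset[OF p\<alpha>]) (use tin[of "Suc i" n] that in auto)
      then have "(\<lambda>s. p s * \<alpha> s) integrable_on {0..t n (Suc i)}" by (rule integrable_continuous_real)
      moreover have "0 \<le> t n i" "t n i \<le> t n (Suc i)"
        using tin[of i n] that T by (auto simp: t_def intro!: grid_mono)
      ultimately show ?thesis
        using Henstock_Kurzweil_Integration.integral_combine[of 0 "t n i" "t n (Suc i)" "\<lambda>s. p s * \<alpha> s"] by simp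
    qed
    moreover have "t n i \<in> {0..T}" "t n (Suc i) \<in> {0..T}" using tin that by auto
    ultimately show ?thesis
      using p(2)[of "t n i"]
      by (simp add: \<rho>_def x_def a_def e_def[folded t_def] y divide_simps)
  qed
  obtain B where B: "\<And>s. s \<in> {0..T} \<Longrightarrow> \<bar>p s * \<alpha> s\<bar> \<le> B"
    using continuous_on_Icc_bounded[OF p\<alpha>] by blast
  obtain K where K: "\<And>s. s \<in> {0..T} \<Longrightarrow> \<bar>1 / p s\<bar> \<le> K"
    using continuous_on_Icc_bounded[OF ip] by blast
  have K0: "K > 0" using K[of 0] p(2)[of 0] T by (auto intro: less_le_trans[of 0 "\<bar>1 / p 0\<bar>"])
  have a_bound: "\<bar>a n i\<bar> \<le> (K * (B * T)) / real n" if "i < n" for n i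
  proof -
    have "\<bar>integral {t n i..t n (Suc i)} (\<lambda>s. p s * \<alpha> s)\<bar> \<le> B * T / real n"
      using grid_step_integral_bound[OF T that p\<alpha> B] by (simp add: t_def)
    moreover have "\<bar>1 / p (t n i)\<bar> \<le> K" using K tin that by auto
    ultimately have "\<bar>1 / p (t n i)\<bar> * \<bar>integral {t n i..t n (Suc i)} (\<lambda>s. p s * \<alpha> s)\<bar> \<le> K * (B * T / real n)"
      using K0 by (intro mult_mono) auto
    then show ?thesis by (simp add: a_def abs_mult)
  qed
  \<comment> \<open>The factor 1 / p sits at left end points; in the limit it meets the integrand p
    * \<alpha> and cancels \<open>p\<close>.\<close>
  have a_sum: "(\<lambda>n. \<Sum>i<n. a n i) \<longlonglongrightarrow> integral {0..T} \<alpha>"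
  proof -
    have "(\<lambda>n. \<Sum>i<n. a n i) \<longlonglongrightarrow> integral {0..T} (\<lambda>s. 1 / p s * (p s * \<alpha> s))"
      using left_sum_tendsto_continuous[OF T p\<alpha> ip] by (simp add: a_def t_def)
    also have "integral {0..T} (\<lambda>s. 1 / p s * (p s * \<alpha> s)) = integral {0..T} \<alpha>"
      using p(2) by (intro integral_cong) auto
    finally show ?thesis .
  qed
  have a_sq: "(\<lambda>n. \<Sum>i<n. (a n i)\<^sup>2) \<longlonglongrightarrow> 0"
    by (rule Lim_null_comparison[OF always_eventually lim_const_over_n[of "(K * (B * T))\<^sup>2"]])
      (use square_sum_le_bound a_bound in \<open>auto simp: sum_nonneg\<close>)
  have x_sq: "(\<lambda>k. \<Sum>i<r k. (x (r k) i)\<^sup>2) \<longlonglongrightarrow> integral {0..T} (\<lambda>s. (b s)\<^sup>2)"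
  proof -
    have "(\<lambda>k. \<Sum>i<r k. (b (t (r k) i))\<^sup>2 * ((T - 0) / real (r k))) \<longlonglongrightarrow> integral {0..T} (\<lambda>s. (b s)\<^sup>2)"
      unfolding t_def
      by (intro strict_mono_compose_tendsto[OF r left_riemann_sum_continuous] T continuous_intros b)
    moreover have "(\<Sum>i<r k. (x (r k) i)\<^sup>2) = (\<Sum>i<r k. (b (t (r k) i))\<^sup>2 * ((T - 0) / real (r k)))
       + (\<Sum>i<r k. (b (t (r k) i))\<^sup>2 * ((w (t (r k) (Suc i)) - w (t (r k) i))\<^sup>2 - T / real (r k)))" for k
      unfolding sum.distrib[symmetric] x_def power_mult_distrib distrib_left[symmetric] by simp
    ultimately show ?thesis using tendsto_add[OF _ qv[folded t_def]] by simp
  qed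
  have z_sq: "(\<lambda>k. \<Sum>i<r k. (a (r k) i + e (r k) i)\<^sup>2) \<longlonglongrightarrow> 0"
    by (rule sum_square_perturbation_tendsto[OF strict_mono_compose_tendsto[OF r a_sq] e(2)])
  have \<rho>_sq: "(\<lambda>k. \<Sum>i<r k. (\<rho> (r k) i)\<^sup>2) \<longlonglongrightarrow> integral {0..T} (\<lambda>s. (b s)\<^sup>2)"
    using sum_square_perturbation_tendsto[OF x_sq z_sq] by (simp add: \<rho>_eq)
  have small: "\<forall>\<^sub>F n in sequentially. \<forall>i<n. \<bar>\<rho> n i\<bar> \<le> \<epsilon>" if "\<epsilon> > 0" for \<epsilon>
    using grid_increment_eventually_small[OF T p(1) divide_pos_pos[OF that K0]]
  proof eventually_elim
    case (elim n)
    show ?case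
    proof safe
      fix i assume i: "i < n"
      then have "\<bar>p (t n (Suc i)) - p (t n i)\<bar> \<le> \<epsilon> / K" using elim by (auto simp: t_def less_imp_le)
      moreover have "\<bar>1 / p (t n i)\<bar> \<le> K" using K tin i by auto
      ultimately have "\<bar>p (t n (Suc i)) - p (t n i)\<bar> * \<bar>1 / p (t n i)\<bar> \<le> \<epsilon> / K * K"
        using that K0 by (intro mult_mono) auto
      then show "\<bar>\<rho> n i\<bar> \<le> \<epsilon>" using K0 by (simp add: \<rho>_def abs_mult)
    qed
  qed
  \<comment> \<open>Only p \<noteq> 0 is at hand, and \<open>ln_div\<close> is applied to nonzero
    arguments; the sign of \<open>p\<close> never enters.\<close>
  have ln_sum: "(\<Sum>i<n. ln (1 + \<rho> n i)) = ln (p T / p 0)" if "n > 0" for n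
  proof -
    have "ln (1 + \<rho> n i) = ln (p (t n (Suc i))) - ln (p (t n i))" if "i < n" for i
    proof -
      have nz: "p (t n i) \<noteq> 0" "p (t n (Suc i)) \<noteq> 0" using p(2) tin that by auto
      then have "1 + \<rho> n i = p (t n (Suc i)) / p (t n i)" by (simp add: \<rho>_def diff_divide_distrib)
      then show ?thesis using nz by (simp add: ln_div)
    qed
    then have "(\<Sum>i<n. ln (1 + \<rho> n i)) = (\<Sum>i<n. ln (p (t n (Suc i))) - ln (p (t n i)))"
      by (intro sum.cong) auto
    also have "\<dots> = ln (p T) - ln (p 0)"
      using sum_grid_telescope[OF that, of "\<lambda>s. ln (p s)" 0 T] by (simp add: t_def)
    also have "\<dots> = ln (p T / p 0)" using p(2)[of 0] p(2)[of T] T by (simp add: ln_div)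
    finally show ?thesis .
  qed
  have rem: "(\<lambda>k. ln (p T / p 0) - (\<Sum>i<r k. \<rho> (r k) i) + (\<Sum>i<r k. (\<rho> (r k) i)\<^sup>2) / 2) \<longlonglongrightarrow> 0"
  proof -
    define Q where "Q k = (\<Sum>i<r k. (\<rho> (r k) i)\<^sup>2)" for k
    have Q: "Q \<longlonglongrightarrow> integral {0..T} (\<lambda>s. (b s)\<^sup>2)" using \<rho>_sq unfolding Q_def .
    then have "Bseq Q" by (intro convergent_imp_Bseq convergentI)
    then obtain C where C: "C > 0" "\<And>k. \<bar>Q k\<bar> \<le> C" by (auto simp: Bseq_def)
    show ?thesis
    proof (rule tendstoI)
      fix \<epsilon> :: real assume \<epsilon>: "\<epsilon> > 0"
      \<comment> \<open>The first bound makes the quadratic expansion valid; the second gives 2 * d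
        * C \<le> \<epsilon> / 2, where \<open>C\<close> bounds the sums of squares.\<close>
      define d where "d = min (1 / 2) (\<epsilon> / (4 * C))"
      have d: "d > 0" "d \<le> 1 / 2" "2 * d * C < \<epsilon>" using \<epsilon> C(1) by (auto simp: d_def min_def field_simps)
      have "\<forall>\<^sub>F k in sequentially. \<forall>i<r k. \<bar>\<rho> (r k) i\<bar> \<le> d"
        by (rule eventually_compose_filterlim[OF small[OF d(1)] filterlim_subseq[OF r]])
      moreover have "\<forall>\<^sub>F k in sequentially. r k > 0"
        using eventually_gt_at_top[of 0] by eventually_elim (use seq_suble[OF r] in \<open>auto intro: less_le_trans\<close>)
      ultimately show "\<forall>\<^sub>F k in sequentially. dist (ln (p T / p 0) - (\<Sum>i<r k. \<rho> (r k) i) + (\<Sum>i<r k. (\<rho> (r k) i)\<^sup>2) / 2) 0 < \<epsilon>"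
      proof eventually_elim
        case (elim k)
        have "ln (p T / p 0) - (\<Sum>i<r k. \<rho> (r k) i) + (\<Sum>i<r k. (\<rho> (r k) i)\<^sup>2) / 2 =
          (\<Sum>i<r k. ln (1 + \<rho> (r k) i) - \<rho> (r k) i + (\<rho> (r k) i)\<^sup>2 / 2)"
          using elim by (simp add: sum.distrib sum_subtractf ln_sum sum_divide_distrib)
        also have "\<bar>\<dots>\<bar> \<le> (\<Sum>i<r k. 2 * d * (\<rho> (r k) i)\<^sup>2)"
        proof (rule order_trans[OF sum_abs sum_mono])
          fix i assume "i \<in> {..<r k}"
          then have i: "\<bar>\<rho> (r k) i\<bar> \<le> d" using elim by auto
          then have "\<bar>ln (1 + \<rho> (r k) i) - \<rho> (r k) i + (\<rho> (r k) i)\<^sup>2 / 2\<bar> \<le> 2 * \<bar>\<rho> (r k) i\<bar> * (\<rho> (r k) i)\<^sup>2"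
            using d by (intro abs_ln_quadratic_bound) auto
          also have "\<dots> \<le> 2 * d * (\<rho> (r k) i)\<^sup>2" using i by (intro mult_right_mono) auto
          finally show "\<bar>ln (1 + \<rho> (r k) i) - \<rho> (r k) i + (\<rho> (r k) i)\<^sup>2 / 2\<bar> \<le> 2 * d * (\<rho> (r k) i)\<^sup>2" .
        qed
        also have "\<dots> = 2 * d * Q k" by (simp add: Q_def sum_distrib_left)
        also have "\<dots> \<le> 2 * d * C" using C(2)[of k] d by (intro mult_left_mono) auto
        also have "\<dots> < \<epsilon>" by (rule d)
        finally show ?case by (simp add: dist_real_def)
      qed
    qed
  qed
  have "(\<lambda>k. ln (p T / p 0) + (\<Sum>i<r k. (\<rho> (r k) i)\<^sup>2) / 2 - (\<Sum>i<r k. a (r k) i) - (\<Sum>i<r k. e (r k) i)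
       - (ln (p T / p 0) - (\<Sum>i<r k. \<rho> (r k) i) + (\<Sum>i<r k. (\<rho> (r k) i)\<^sup>2) / 2))
    \<longlonglongrightarrow> ln (p T / p 0) + integral {0..T} (\<lambda>s. (b s)\<^sup>2) / 2 - integral {0..T} \<alpha> - 0 - 0"
    by (intro tendsto_diff tendsto_add tendsto_const tendsto_divide rem e(1) \<rho>_sq
        strict_mono_compose_tendsto[OF r a_sum]) auto
  moreover have "(\<Sum>i<r k. \<rho> (r k) i) = (\<Sum>i<r k. x (r k) i) + ((\<Sum>i<r k. a (r k) i) + (\<Sum>i<r k. e (r k) i))" for k
    by (simp add: \<rho>_eq sum.distrib)
  ultimately show ?thesis unfolding x_def t_def by (simp add: algebra_simps)
qed

text \<open>Discrete integration by parts: the increment of z^2 over a cell is (dz)^2 + 2 * z * dz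
  with dz = \<kappa> * dw plus drift. The left sides telescope, the squares tend to \<kappa>^2 * T,
  the drift part to the integral of z * A; the sum of z * dw is what remains, and \<kappa> \<noteq>
  0 allows solving for it.\<close>

lemma square_increment_sum_tendsto:
  fixes z A w :: "real \<Rightarrow> real"
  assumes T: "T > 0" and r: "strict_mono r" and "\<kappa> \<noteq> 0"
    and z: "continuous_on {0..T} z" and A: "continuous_on {0..T} A"
    and zt: "\<And>t. t \<in> {0..T} \<Longrightarrow> z t = integral {0..t} A + \<kappa> * w t"
    and qv: "(\<lambda>k. \<Sum>i<r k. (w (grid 0 T (r k) (Suc i)) - w (grid 0 T (r k) i))\<^sup>2 - T / real (r k)) \<longlonglongrightarrow> 0"
  shows "(\<lambda>k. \<Sum>i<r k. z (grid 0 T (r k) i) * (w (grid 0 T (r k) (Suc i)) - w (grid 0 T (r k) i)))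
    \<longlonglongrightarrow> (((z T)\<^sup>2 - (z 0)\<^sup>2 - \<kappa>\<^sup>2 * T) / 2 - integral {0..T} (\<lambda>s. z s * A s)) / \<kappa>"
proof -
  define t where "t n i = grid 0 T n i" for n i
  define a where "a n i = integral {t n i..t n (Suc i)} A" for n i
  define dw where "dw n i = w (t n (Suc i)) - w (t n i)" for n i
  have tin: "t n i \<in> {0..T}" if "i \<le> n" for n i
    using that T by (auto simp: t_def intro: grid_ge grid_le)
  have dz: "z (t n (Suc i)) - z (t n i) = \<kappa> * dw n i + a n i" if "i < n" for n i
  proof -
    have "continuous_on {0..t n (Suc i)} A"
      by (rule continuous_on_subset[OF A]) (use tin[of "Suc i" n] that in auto)
    then have "A integrable_on {0..t n (Suc i)}" by (rule integrable_continuous_real)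
    moreover have "0 \<le> t n i" "t n i \<le> t n (Suc i)"
      using tin[of i n] that T by (auto simp: t_def intro!: grid_mono)
    ultimately have "integral {0..t n i} A + a n i = integral {0..t n (Suc i)} A"
      unfolding a_def by (intro Henstock_Kurzweil_Integration.integral_combine)
    then show ?thesis using zt tin[of i n] tin[of "Suc i" n] that by (simp add: dw_def algebra_simps)
  qed
  obtain B where B: "\<And>s. s \<in> {0..T} \<Longrightarrow> \<bar>A s\<bar> \<le> B"
    using continuous_on_Icc_bounded[OF A] by blast
  have a_sq: "(\<lambda>n. \<Sum>i<n. (a n i)\<^sup>2) \<longlonglongrightarrow> 0"
  proof (rule Lim_null_comparison[OF always_eventually lim_const_over_n[of "(B * T)\<^sup>2"]], safe)
    fix n
    have "\<bar>a n i\<bar> \<le> B * T / real n" if "i < n" for i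
      using grid_step_integral_bound[OF T that A B] by (simp add: a_def t_def)
    then show "norm (\<Sum>i<n. (a n i)\<^sup>2) \<le> (B * T)\<^sup>2 / real n"
      using square_sum_le_bound[of n "a n" "B * T"] by (simp add: sum_nonneg)
  qed
  have pos: "\<forall>\<^sub>F k in sequentially. r k > 0"
    using eventually_gt_at_top[of 0] by eventually_elim (use seq_suble[OF r] in \<open>auto intro: less_le_trans\<close>)
  have w_sq: "(\<lambda>k. \<Sum>i<r k. (\<kappa> * dw (r k) i)\<^sup>2) \<longlonglongrightarrow> \<kappa>\<^sup>2 * T"
  proof -
    have "(\<lambda>k. \<kappa>\<^sup>2 * ((\<Sum>i<r k. (dw (r k) i)\<^sup>2 - T / real (r k)) + T)) \<longlonglongrightarrow> \<kappa>\<^sup>2 * (0 + T)"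
      by (intro tendsto_intros qv[folded t_def, folded dw_def])
    moreover have "\<forall>\<^sub>F k in sequentially. \<kappa>\<^sup>2 * ((\<Sum>i<r k. (dw (r k) i)\<^sup>2 - T / real (r k)) + T)
       = (\<Sum>i<r k. (\<kappa> * dw (r k) i)\<^sup>2)"
      using pos by eventually_elim (simp add: sum_subtractf power_mult_distrib sum_distrib_left)
    ultimately show ?thesis by (simp add: Lim_transform_eventually)
  qed
  have dz_sq: "(\<lambda>k. \<Sum>i<r k. (\<kappa> * dw (r k) i + a (r k) i)\<^sup>2) \<longlonglongrightarrow> \<kappa>\<^sup>2 * T"
    by (rule sum_square_perturbation_tendsto[OF w_sq strict_mono_compose_tendsto[OF r a_sq]])
  have za: "(\<lambda>n. \<Sum>i<n. z (t n i) * a n i) \<longlonglongrightarrow> integral {0..T} (\<lambda>s. z s * A s)"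
    using left_sum_tendsto_continuous[OF T A z] by (simp add: a_def t_def)
  have "(\<lambda>k. (((z T)\<^sup>2 - (z 0)\<^sup>2 - (\<Sum>i<r k. (\<kappa> * dw (r k) i + a (r k) i)\<^sup>2)) / 2 - (\<Sum>i<r k. z (t (r k) i) * a (r k) i)) / \<kappa>)
    \<longlonglongrightarrow> (((z T)\<^sup>2 - (z 0)\<^sup>2 - \<kappa>\<^sup>2 * T) / 2 - integral {0..T} (\<lambda>s. z s * A s)) / \<kappa>"
    by (intro tendsto_intros dz_sq strict_mono_compose_tendsto[OF r za]) (use assms in auto)
  moreover have "\<forall>\<^sub>F k in sequentially.
    (((z T)\<^sup>2 - (z 0)\<^sup>2 - (\<Sum>i<r k. (\<kappa> * dw (r k) i + a (r k) i)\<^sup>2)) / 2 - (\<Sum>i<r k. z (t (r k) i) * a (r k) i)) / \<kappa>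
    = (\<Sum>i<r k. z (t (r k) i) * dw (r k) i)"
    using pos
  proof eventually_elim
    case (elim k)
    have "(z T)\<^sup>2 - (z 0)\<^sup>2 = (\<Sum>i<r k. (z (t (r k) (Suc i)))\<^sup>2 - (z (t (r k) i))\<^sup>2)"
      using sum_grid_telescope[OF elim, of "\<lambda>s. (z s)\<^sup>2" 0 T] by (simp add: t_def)
    also have "\<dots> = (\<Sum>i<r k. (\<kappa> * dw (r k) i + a (r k) i)\<^sup>2 + 2 * (z (t (r k) i) * a (r k) i) + 2 * \<kappa> * (z (t (r k) i) * dw (r k) i))"
    proof (rule sum.cong[OF refl])
      fix i assume "i \<in> {..<r k}"
      then have "z (t (r k) (Suc i)) = z (t (r k) i) + (\<kappa> * dw (r k) i + a (r k) i)" using dz[of i "r k"] by simp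
      then show "(z (t (r k) (Suc i)))\<^sup>2 - (z (t (r k) i))\<^sup>2 =
        (\<kappa> * dw (r k) i + a (r k) i)\<^sup>2 + 2 * (z (t (r k) i) * a (r k) i) + 2 * \<kappa> * (z (t (r k) i) * dw (r k) i)"
        by (simp only:) (simp add: power2_eq_square algebra_simps)
    qed
    also have "\<dots> = (\<Sum>i<r k. (\<kappa> * dw (r k) i + a (r k) i)\<^sup>2) + 2 * (\<Sum>i<r k. z (t (r k) i) * a (r k) i)
       + 2 * \<kappa> * (\<Sum>i<r k. z (t (r k) i) * dw (r k) i)"
      by (simp only: sum.distrib sum_distrib_left)
    finally show ?case using \<open>\<kappa> \<noteq> 0\<close> by (simp add: field_simps)
  qed
  ultimately show ?thesis unfolding dw_def t_def by (rule Lim_transform_eventually)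
qed

text \<open>A bridge between the two integrals in play: the error in \<open>has_ito_integral\<close>
  is a nonnegative Lebesgue integral, whereas the grid sums converge to gauge integrals.\<close>

lemma bounded_borel_integral:
  fixes f :: "real \<Rightarrow> real"
  assumes m: "(\<lambda>s. indicator {u..v} s * f s) \<in> borel_measurable borel"
    and B: "\<And>s. s \<in> {u..v} \<Longrightarrow> \<bar>f s\<bar> \<le> B"
  shows "f integrable_on {u..v}"
    and "(\<And>s. s \<in> {u..v} \<Longrightarrow> 0 \<le> f s) \<Longrightarrow>
      (\<integral>\<^sup>+ s\<in>{u..v}. ennreal (f s) \<partial>lborel) = ennreal (integral {u..v} f)"
proof -
  have "integrable lborel (\<lambda>s. indicator {u..v} s * f s)"
  proof (rule Bochner_Integration.integrable_bound)
    show "integrable lborel (\<lambda>s. B * indicator {u..v} s :: real)"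
      by (intro integrable_mult_right) (simp add: emeasure_lborel_Icc_eq)
    show "AE s in lborel. norm (indicator {u..v} s * f s) \<le> norm (B * indicator {u..v} s)"
      using B by (intro AE_I2) (auto simp: indicator_def intro: order_trans[OF _ abs_ge_self])
  qed (use m in simp)
  then have si: "set_integrable lborel {u..v} f" by (simp add: set_integrable_def)
  show "f integrable_on {u..v}" by (rule set_borel_integral_eq_integral(1)[OF si])
  assume nn: "\<And>s. s \<in> {u..v} \<Longrightarrow> 0 \<le> f s"
  have "(\<integral>\<^sup>+ s\<in>{u..v}. ennreal (f s) \<partial>lborel) = (\<integral>\<^sup>+ s. ennreal (indicator {u..v} s * f s) \<partial>lborel)"
    by (intro nn_integral_cong) (simp add: indicator_def)
  also have "\<dots> = ennreal (\<integral>s. indicator {u..v} s * f s \<partial>lborel)"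
    using si nn by (intro nn_integral_eq_integral) (auto simp: set_integrable_def indicator_def)
  also have "(\<integral>s. indicator {u..v} s * f s \<partial>lborel) = integral {u..v} f"
    using set_borel_integral_eq_integral(2)[OF si] by (simp add: set_lebesgue_integral_def)
  finally show "(\<integral>\<^sup>+ s\<in>{u..v}. ennreal (f s) \<partial>lborel) = ennreal (integral {u..v} f)" .
qed

subsection \<open>Convergence in probability and sums of independent increments\<close>

lemma square_sum_le_double: "(x + y)\<^sup>2 \<le> 2 * x\<^sup>2 + 2 * (y::real)\<^sup>2"
  using zero_le_power2[of "x - y"] by (simp add: power2_sum power2_diff)

text \<open>\<open>trunc_mean M X\<close> tends to 0 along a sequence iff \<open>X\<close> tends to 0 in probability.\<close>

definition trunc_mean :: "'a measure \<Rightarrow> ('a \<Rightarrow> real) \<Rightarrow> real" where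
  "trunc_mean M X = (\<integral>\<omega>. min 1 \<bar>X \<omega>\<bar> \<partial>M)"

context prob_space
begin

lemma trunc_integrable [intro]:
  assumes [measurable]: "X \<in> borel_measurable M"
  shows "integrable M (\<lambda>\<omega>. min 1 \<bar>X \<omega>\<bar> :: real)"
  by (rule integrable_const_bound[of _ 1]) auto

lemma trunc_mean_nonneg: "0 \<le> trunc_mean M X"
  unfolding trunc_mean_def by (rule integral_nonneg_AE) auto

lemma trunc_mean_mono:
  assumes "X \<in> borel_measurable M" "Y \<in> borel_measurable M" "AE \<omega> in M. \<bar>X \<omega>\<bar> \<le> \<bar>Y \<omega>\<bar>"
  shows "trunc_mean M X \<le> trunc_mean M Y"
  unfolding trunc_mean_def
  by (rule integral_mono_AE) (use assms in \<open>auto elim!: eventually_mono\<close>)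

lemma trunc_mean_add:
  assumes [measurable]: "X \<in> borel_measurable M" "Y \<in> borel_measurable M"
  shows "trunc_mean M (\<lambda>\<omega>. X \<omega> + Y \<omega>) \<le> trunc_mean M X + trunc_mean M Y"
proof -
  have "trunc_mean M (\<lambda>\<omega>. X \<omega> + Y \<omega>) \<le> (\<integral>\<omega>. min 1 \<bar>X \<omega>\<bar> + min 1 \<bar>Y \<omega>\<bar> \<partial>M)"
    unfolding trunc_mean_def by (intro integral_mono Bochner_Integration.integrable_add trunc_integrable) auto
  also have "\<dots> = trunc_mean M X + trunc_mean M Y"
    unfolding trunc_mean_def by (intro Bochner_Integration.integral_add trunc_integrable) auto
  finally show ?thesis .
qed

lemma trunc_mean_AE_tendsto:
  assumes [measurable]: "\<And>n. X n \<in> borel_measurable M" "Y \<in> borel_measurable M"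
    and "AE \<omega> in M. (\<lambda>n. X n \<omega>) \<longlonglongrightarrow> Y \<omega>"
  shows "(\<lambda>n. trunc_mean M (X n)) \<longlonglongrightarrow> trunc_mean M Y"
  unfolding trunc_mean_def
proof (rule integral_dominated_convergence[where w="\<lambda>_. 1"])
  show "AE \<omega> in M. (\<lambda>n. min 1 \<bar>X n \<omega>\<bar>) \<longlonglongrightarrow> min 1 \<bar>Y \<omega>\<bar>"
    using assms(3) by eventually_elim (intro tendsto_intros)
qed auto

lemma trunc_mean_AE_tendsto_0:
  assumes "\<And>n. X n \<in> borel_measurable M" "AE \<omega> in M. (\<lambda>n. X n \<omega>) \<longlonglongrightarrow> 0"
  shows "(\<lambda>n. trunc_mean M (X n)) \<longlonglongrightarrow> 0"
  using trunc_mean_AE_tendsto[of X "\<lambda>_. 0", OF assms(1) _ assms(2)] by (simp add: trunc_mean_def)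

lemma trunc_mean_eq_0_AE:
  assumes "X \<in> borel_measurable M" "trunc_mean M X = 0"
  shows "AE \<omega> in M. X \<omega> = 0"
proof -
  have "AE \<omega> in M. min 1 \<bar>X \<omega>\<bar> = 0"
    using assms integral_nonneg_eq_0_iff_AE[of M "\<lambda>\<omega>. min 1 \<bar>X \<omega>\<bar>"] trunc_integrable[of X]
    by (simp add: trunc_mean_def)
  then show ?thesis by eventually_elim (auto simp: min_def split: if_splits)
qed

lemma trunc_mean_le_prob:
  assumes [measurable]: "X \<in> borel_measurable M" and "\<epsilon> \<ge> 0"
  shows "trunc_mean M X \<le> \<epsilon> + prob {\<omega>\<in>space M. \<bar>X \<omega>\<bar> > \<epsilon>}"
proof -
  define S where "S = {\<omega>\<in>space M. \<bar>X \<omega>\<bar> > \<epsilon>}"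
  have S [measurable]: "S \<in> sets M" unfolding S_def by measurable
  have int: "integrable M (indicator S :: 'a \<Rightarrow> real)" by (simp add: less_top[symmetric])
  have "trunc_mean M X \<le> (\<integral>\<omega>. \<epsilon> + indicator S \<omega> \<partial>M)"
    unfolding trunc_mean_def
  proof (intro integral_mono trunc_integrable Bochner_Integration.integrable_add int)
    fix \<omega> assume "\<omega> \<in> space M"
    then show "min 1 \<bar>X \<omega>\<bar> \<le> \<epsilon> + indicator S \<omega>"
      using assms by (auto simp: S_def indicator_def)
  qed auto
  also have "\<dots> = \<epsilon> + prob S"
    by (subst Bochner_Integration.integral_add) (use int in \<open>auto simp: prob_space\<close>)
  finally show ?thesis by (simp add: S_def)
qed

lemma trunc_mean_tendsto_0I:
  assumes X [measurable]: "\<And>n. X n \<in> borel_measurable M"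
    and p: "\<And>\<epsilon>. \<epsilon> > 0 \<Longrightarrow> (\<lambda>n. prob {\<omega>\<in>space M. \<bar>X n \<omega>\<bar> > \<epsilon>}) \<longlonglongrightarrow> 0"
  shows "(\<lambda>n. trunc_mean M (X n)) \<longlonglongrightarrow> 0"
proof (rule tendstoI)
  fix \<epsilon> :: real assume "\<epsilon> > 0"
  then have "\<forall>\<^sub>F n in sequentially. prob {\<omega>\<in>space M. \<bar>X n \<omega>\<bar> > \<epsilon> / 2} < \<epsilon> / 2"
    by (intro order_tendstoD(2)[OF p]) auto
  then show "\<forall>\<^sub>F n in sequentially. dist (trunc_mean M (X n)) 0 < \<epsilon>"
  proof eventually_elim
    case (elim n)
    then show ?case
      using trunc_mean_le_prob[OF X, of "\<epsilon> / 2" n] trunc_mean_nonneg[of "X n"] \<open>\<epsilon> > 0\<close>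
      by (simp add: dist_real_def)
  qed
qed

lemma trunc_mean_AE_subseq:
  assumes X [measurable]: "\<And>n. X n \<in> borel_measurable M" and t: "(\<lambda>n. trunc_mean M (X n)) \<longlonglongrightarrow> 0"
  shows "\<exists>r. strict_mono (r::nat\<Rightarrow>nat) \<and> (AE \<omega> in M. (\<lambda>n. X (r n) \<omega>) \<longlonglongrightarrow> 0)"
proof -
  have "\<exists>r. strict_mono (r::nat\<Rightarrow>nat) \<and> (AE \<omega> in M. (\<lambda>n. min 1 \<bar>X (r n) \<omega>\<bar>) \<longlonglongrightarrow> 0)"
    by (rule tendsto_L1_AE_subseq) (use t in \<open>auto simp: trunc_mean_def\<close>)
  then obtain r where r: "strict_mono r" "AE \<omega> in M. (\<lambda>n. min 1 \<bar>X (r n) \<omega>\<bar>) \<longlonglongrightarrow> 0" by blast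
  from r(2) have "AE \<omega> in M. (\<lambda>n. X (r n) \<omega>) \<longlonglongrightarrow> 0"
  proof eventually_elim
    case (elim \<omega>)
    \<comment> \<open>Below 1 the truncation is inactive, so convergence of the truncated values is
      convergence of the values themselves.\<close>
    have "\<forall>\<^sub>F n in sequentially. min 1 \<bar>X (r n) \<omega>\<bar> < 1" using order_tendstoD(2)[OF elim] by simp
    then have "\<forall>\<^sub>F n in sequentially. min 1 \<bar>X (r n) \<omega>\<bar> = \<bar>X (r n) \<omega>\<bar>" by eventually_elim auto
    then have "(\<lambda>n. \<bar>X (r n) \<omega>\<bar>) \<longlonglongrightarrow> 0" by (rule Lim_transform_eventually[OF elim])
    then show ?case by (simp add: tendsto_rabs_zero_iff)
  qed
  with r(1) show ?thesis by blast
qed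

text \<open>Adding finitely many vanishing quantities before a subsequence is extracted makes one
  subsequence serve all of them.\<close>

lemma trunc_mean_sum_tendsto_0:
  assumes [measurable]: "\<And>i n. i \<in> I \<Longrightarrow> X i n \<in> borel_measurable M" and "finite I"
    and t: "\<And>i. i \<in> I \<Longrightarrow> (\<lambda>n. trunc_mean M (X i n)) \<longlonglongrightarrow> 0"
  shows "(\<lambda>n. trunc_mean M (\<lambda>\<omega>. \<Sum>i\<in>I. \<bar>X i n \<omega>\<bar>)) \<longlonglongrightarrow> 0"
  using assms(2) assms(1) t
proof (induction I rule: finite_induct)
  case empty
  then show ?case by (simp add: trunc_mean_def)
next
  case (insert i I)
  note [measurable] = insert.prems(1)
  show ?case
  proof (rule tendsto_sandwich[OF _ _ tendsto_const])
    show "(\<lambda>n. trunc_mean M (X i n) + trunc_mean M (\<lambda>\<omega>. \<Sum>i\<in>I. \<bar>X i n \<omega>\<bar>)) \<longlonglongrightarrow> 0"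
      using tendsto_add[OF insert.prems(2)[of i] insert.IH] insert.prems by simp
    show "\<forall>\<^sub>F n in sequentially. 0 \<le> trunc_mean M (\<lambda>\<omega>. \<Sum>i\<in>insert i I. \<bar>X i n \<omega>\<bar>)"
      by (simp add: trunc_mean_nonneg)
    show "\<forall>\<^sub>F n in sequentially. trunc_mean M (\<lambda>\<omega>. \<Sum>i\<in>insert i I. \<bar>X i n \<omega>\<bar>)
       \<le> trunc_mean M (X i n) + trunc_mean M (\<lambda>\<omega>. \<Sum>i\<in>I. \<bar>X i n \<omega>\<bar>)"
    proof (rule always_eventually, rule allI)
      fix n
      have "trunc_mean M (\<lambda>\<omega>. \<Sum>i\<in>insert i I. \<bar>X i n \<omega>\<bar>) = trunc_mean M (\<lambda>\<omega>. \<bar>X i n \<omega>\<bar> + (\<Sum>i\<in>I. \<bar>X i n \<omega>\<bar>))"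
        using insert by simp
      also have "\<dots> \<le> trunc_mean M (\<lambda>\<omega>. \<bar>X i n \<omega>\<bar>) + trunc_mean M (\<lambda>\<omega>. \<Sum>i\<in>I. \<bar>X i n \<omega>\<bar>)"
        by (intro trunc_mean_add) auto
      finally show "trunc_mean M (\<lambda>\<omega>. \<Sum>i\<in>insert i I. \<bar>X i n \<omega>\<bar>)
        \<le> trunc_mean M (X i n) + trunc_mean M (\<lambda>\<omega>. \<Sum>i\<in>I. \<bar>X i n \<omega>\<bar>)" by (simp add: trunc_mean_def)
    qed
  qed
qed

lemma trunc_mean_le_1: "X \<in> borel_measurable M \<Longrightarrow> trunc_mean M X \<le> 1"
  using integral_mono[OF trunc_integrable[of X] integrable_const[of 1]] by (simp add: trunc_mean_def prob_space)

lemma trunc_mean_double: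
  assumes [measurable]: "X \<in> borel_measurable M"
  shows "trunc_mean M (\<lambda>\<omega>. 2 * X \<omega>) \<le> 2 * trunc_mean M X"
  using trunc_mean_add[of X X] by simp

lemma trunc_mean_square_triangle:
  assumes [measurable]: "\<And>k. X k \<in> borel_measurable M" "\<And>k. Y k \<in> borel_measurable M" "Z \<in> borel_measurable M"
    and 1: "(\<lambda>k::nat. trunc_mean M (\<lambda>\<omega>. (X k \<omega> - Y k \<omega>)\<^sup>2)) \<longlonglongrightarrow> 0"
    and 2: "(\<lambda>k. trunc_mean M (\<lambda>\<omega>. (Y k \<omega> - Z \<omega>)\<^sup>2)) \<longlonglongrightarrow> 0"
  shows "(\<lambda>k. trunc_mean M (\<lambda>\<omega>. (X k \<omega> - Z \<omega>)\<^sup>2)) \<longlonglongrightarrow> 0"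
proof (rule tendsto_sandwich[OF _ always_eventually tendsto_const])
  show "(\<lambda>k. 2 * trunc_mean M (\<lambda>\<omega>. (X k \<omega> - Y k \<omega>)\<^sup>2) + 2 * trunc_mean M (\<lambda>\<omega>. (Y k \<omega> - Z \<omega>)\<^sup>2)) \<longlonglongrightarrow> 0"
    using tendsto_add[OF tendsto_mult[OF tendsto_const[of 2] 1] tendsto_mult[OF tendsto_const[of 2] 2]] by simp
  show "\<forall>k. trunc_mean M (\<lambda>\<omega>. (X k \<omega> - Z \<omega>)\<^sup>2) \<le>
    2 * trunc_mean M (\<lambda>\<omega>. (X k \<omega> - Y k \<omega>)\<^sup>2) + 2 * trunc_mean M (\<lambda>\<omega>. (Y k \<omega> - Z \<omega>)\<^sup>2)"
  proof
    fix k
    have "trunc_mean M (\<lambda>\<omega>. (X k \<omega> - Z \<omega>)\<^sup>2) \<le> trunc_mean M (\<lambda>\<omega>. 2 * (X k \<omega> - Y k \<omega>)\<^sup>2 + 2 * (Y k \<omega> - Z \<omega>)\<^sup>2)"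
    proof (intro trunc_mean_mono AE_I2)
      fix \<omega> show "\<bar>(X k \<omega> - Z \<omega>)\<^sup>2\<bar> \<le> \<bar>2 * (X k \<omega> - Y k \<omega>)\<^sup>2 + 2 * (Y k \<omega> - Z \<omega>)\<^sup>2\<bar>"
        using square_sum_le_double[of "X k \<omega> - Y k \<omega>" "Y k \<omega> - Z \<omega>"] by simp
    qed measurable
    also have "\<dots> \<le> trunc_mean M (\<lambda>\<omega>. 2 * (X k \<omega> - Y k \<omega>)\<^sup>2) + trunc_mean M (\<lambda>\<omega>. 2 * (Y k \<omega> - Z \<omega>)\<^sup>2)"
      by (rule trunc_mean_add) measurable
    also have "\<dots> \<le> 2 * trunc_mean M (\<lambda>\<omega>. (X k \<omega> - Y k \<omega>)\<^sup>2) + 2 * trunc_mean M (\<lambda>\<omega>. (Y k \<omega> - Z \<omega>)\<^sup>2)"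
      by (intro add_mono trunc_mean_double) measurable
    finally show "trunc_mean M (\<lambda>\<omega>. (X k \<omega> - Z \<omega>)\<^sup>2) \<le> \<dots>" .
  qed
qed (simp add: trunc_mean_nonneg)

lemma integrable_mult_of_squares:
  fixes X Y :: "'a \<Rightarrow> real"
  assumes [measurable]: "X \<in> borel_measurable M" "Y \<in> borel_measurable M"
    and "integrable M (\<lambda>\<omega>. (X \<omega>)\<^sup>2)" "integrable M (\<lambda>\<omega>. (Y \<omega>)\<^sup>2)"
  shows "integrable M (\<lambda>\<omega>. X \<omega> * Y \<omega>)"
    and "expectation (\<lambda>\<omega>. \<bar>X \<omega> * Y \<omega>\<bar>) \<le> expectation (\<lambda>\<omega>. (X \<omega>)\<^sup>2) + expectation (\<lambda>\<omega>. (Y \<omega>)\<^sup>2)"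
proof -
  have le: "\<bar>x * y\<bar> \<le> x\<^sup>2 + y\<^sup>2" for x y :: real
  proof -
    have "2 * (\<bar>x\<bar> * \<bar>y\<bar>) \<le> x\<^sup>2 + y\<^sup>2" using sum_squares_bound[of "\<bar>x\<bar>" "\<bar>y\<bar>"] by simp
    then show ?thesis using sum_power2_ge_zero[of x y] unfolding abs_mult by linarith
  qed
  show int: "integrable M (\<lambda>\<omega>. X \<omega> * Y \<omega>)"
    by (rule Bochner_Integration.integrable_bound[OF Bochner_Integration.integrable_add[OF assms(3,4)]]) (use le in auto)
  have "expectation (\<lambda>\<omega>. \<bar>X \<omega> * Y \<omega>\<bar>) \<le> expectation (\<lambda>\<omega>. (X \<omega>)\<^sup>2 + (Y \<omega>)\<^sup>2)"
    by (intro integral_mono Bochner_Integration.integrable_add assms integrable_abs int le)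
  then show "expectation (\<lambda>\<omega>. \<bar>X \<omega> * Y \<omega>\<bar>) \<le> expectation (\<lambda>\<omega>. (X \<omega>)\<^sup>2) + expectation (\<lambda>\<omega>. (Y \<omega>)\<^sup>2)"
    using assms(3,4) by simp
qed

end

section \<open>Martingale transforms\<close>

text \<open>The choice \<delta> = sqrt \<rho> balances the two terms and is admissible as \<rho>
  \<le> 1; the factor 3 is 1 + 2. For \<rho> = 0 that choice is not positive, and \<delta> is sent
  to 0 instead.\<close>

lemma le_sqrt_of_le_quotient:
  fixes q \<rho> :: real
  assumes "0 \<le> \<rho>" "\<rho> \<le> 1" and le: "\<And>\<delta>. 0 < \<delta> \<Longrightarrow> \<delta> \<le> 1 \<Longrightarrow> q \<le> \<rho> / \<delta> + 2 * \<delta>"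
  shows "q \<le> 3 * sqrt \<rho>"
proof (cases "\<rho> = 0")
  case True
  have "q \<le> 0"
  proof (rule field_le_epsilon)
    fix e :: real assume "e > 0"
    then have "q \<le> 2 * min 1 (e / 2)" using le[of "min 1 (e / 2)"] True by simp
    then show "q \<le> 0 + e" by simp
  qed
  then show ?thesis using True by simp
next
  case False
  then have "q \<le> \<rho> / sqrt \<rho> + 2 * sqrt \<rho>" using assms by (intro le) auto
  also have "\<rho> / sqrt \<rho> = sqrt \<rho>" using assms(1) by (simp add: real_div_sqrt)
  finally show ?thesis by simp
qed

text \<open>Martingale differences of the simplest kind, with independent future and deterministic
  variances \<open>v\<close>. Independence is required from each real variable known at stage j,
  which is the form that product formulas for expectations consume. Both the increments of Brownian
  motion on a grid and their centred squares are instances, so one inequality serves stochastic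
  integrals and quadratic variation.\<close>

locale increment_sequence = prob_space M for M :: "'a measure" +
  fixes G :: "nat \<Rightarrow> 'a measure" and \<xi> :: "nat \<Rightarrow> 'a \<Rightarrow> real" and v :: "nat \<Rightarrow> real"
  assumes subalg: "\<And>j. subalgebra M (G j)"
    and G_mono: "\<And>i j. i \<le> j \<Longrightarrow> subalgebra (G j) (G i)"
    and \<xi>_meas: "\<And>j. \<xi> j \<in> borel_measurable (G (Suc j))"
    and \<xi>_indep: "\<And>j Z. Z \<in> borel_measurable (G j) \<Longrightarrow> indep_var borel Z borel (\<xi> j)"
    and \<xi>_sq: "\<And>j. integrable M (\<lambda>\<omega>. (\<xi> j \<omega>)\<^sup>2)" "\<And>j. expectation (\<lambda>\<omega>. (\<xi> j \<omega>)\<^sup>2) = v j"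
    and \<xi>_mean: "\<And>j. expectation (\<xi> j) = 0"
    and v_pos: "\<And>j. v j > 0"
begin

lemma G_measurable: "Z \<in> borel_measurable (G i) \<Longrightarrow> i \<le> j \<Longrightarrow> (Z :: _ \<Rightarrow> real) \<in> borel_measurable (G j)"
  using measurable_from_subalg[OF G_mono] by blast

lemma M_measurable: "Z \<in> borel_measurable (G i) \<Longrightarrow> (Z :: _ \<Rightarrow> real) \<in> borel_measurable M"
  using measurable_from_subalg[OF subalg] by blast

lemma \<xi>_integrable: "integrable M (\<xi> j)"
  by (rule square_integrable_imp_integrable[OF M_measurable[OF \<xi>_meas] \<xi>_sq(1)])

lemma bounded_transform_sq:
  assumes g: "g \<in> borel_measurable (G j)" and c: "\<And>\<omega>. \<bar>g \<omega>\<bar> \<le> c"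
  shows "integrable M (\<lambda>\<omega>. (g \<omega> * \<xi> j \<omega>)\<^sup>2)"
    "expectation (\<lambda>\<omega>. (g \<omega> * \<xi> j \<omega>)\<^sup>2) = expectation (\<lambda>\<omega>. (g \<omega>)\<^sup>2 * v j)"
proof -
  note [measurable] = M_measurable[OF g] M_measurable[OF \<xi>_meas]
  have ind: "indep_var borel (\<lambda>\<omega>. (g \<omega>)\<^sup>2) borel (\<lambda>\<omega>. (\<xi> j \<omega>)\<^sup>2)"
    using indep_var_compose[OF \<xi>_indep[OF g], of "\<lambda>x. x\<^sup>2" borel "\<lambda>x. x\<^sup>2" borel] by (simp add: o_def)
  have c0: "0 \<le> c" using c[of undefined] by linarith
  have int: "integrable M (\<lambda>\<omega>. (g \<omega>)\<^sup>2)"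
    by (rule integrable_const_bound[of _ "c\<^sup>2"])
      (use c c0 in \<open>auto simp: abs_le_square_iff[symmetric]\<close>)
  show "integrable M (\<lambda>\<omega>. (g \<omega> * \<xi> j \<omega>)\<^sup>2)"
    using indep_var_integrable[OF ind int \<xi>_sq(1)] by (simp add: power_mult_distrib)
  show "expectation (\<lambda>\<omega>. (g \<omega> * \<xi> j \<omega>)\<^sup>2) = expectation (\<lambda>\<omega>. (g \<omega>)\<^sup>2 * v j)"
    using indep_var_lebesgue_integral[OF ind int \<xi>_sq(1)] \<xi>_sq(2) by (simp add: power_mult_distrib)
qed

text \<open>The earlier term and the later coefficient \<open>g j\<close> are all known at stage j,
  hence their product is independent of \<xi> j, whose mean is 0.\<close>

lemma bounded_transform_orthogonal:
  assumes g: "\<And>j. g j \<in> borel_measurable (G j)" and c: "\<And>j \<omega>. \<bar>g j \<omega>\<bar> \<le> c j" and "i < j"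
  shows "expectation (\<lambda>\<omega>. (g i \<omega> * \<xi> i \<omega>) * (g j \<omega> * \<xi> j \<omega>)) = 0"
proof -
  note [measurable] = M_measurable[OF g] M_measurable[OF \<xi>_meas]
  have Z: "(\<lambda>\<omega>. g i \<omega> * \<xi> i \<omega> * g j \<omega>) \<in> borel_measurable (G j)"
    using \<open>i < j\<close>
    by (intro borel_measurable_times G_measurable[OF g] G_measurable[OF \<xi>_meas]) auto
  have "integrable M (\<lambda>\<omega>. (g i \<omega> * \<xi> i \<omega>) * g j \<omega>)"
  proof (rule integrable_mult_of_squares(1))
    show "integrable M (\<lambda>\<omega>. (g i \<omega> * \<xi> i \<omega>)\<^sup>2)" by (rule bounded_transform_sq(1)[OF g c])
    have "0 \<le> c j" using c[of j undefined] by linarith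
    then show "integrable M (\<lambda>\<omega>. (g j \<omega>)\<^sup>2)"
      by (intro integrable_const_bound[of _ "(c j)\<^sup>2"])
        (use c[of j] in \<open>auto simp: abs_le_square_iff[symmetric]\<close>)
  qed auto
  from indep_var_lebesgue_integral[OF \<xi>_indep[OF Z] this \<xi>_integrable]
  show ?thesis by (simp add: \<xi>_mean mult_ac)
qed

text \<open>A discrete Ito isometry: off-diagonal products vanish by orthogonality. Sums over any
  finite index set are allowed because it is also applied to blocks.\<close>

lemma bounded_transform_sum_sq:
  assumes g: "\<And>j. g j \<in> borel_measurable (G j)" and c: "\<And>j \<omega>. \<bar>g j \<omega>\<bar> \<le> c j" and "finite A"
  shows "integrable M (\<lambda>\<omega>. (\<Sum>j\<in>A. g j \<omega> * \<xi> j \<omega>)\<^sup>2)"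
    "expectation (\<lambda>\<omega>. (\<Sum>j\<in>A. g j \<omega> * \<xi> j \<omega>)\<^sup>2) = expectation (\<lambda>\<omega>. \<Sum>j\<in>A. (g j \<omega>)\<^sup>2 * v j)"
proof -
  note [measurable] = M_measurable[OF g] M_measurable[OF \<xi>_meas]
  have int: "integrable M (\<lambda>\<omega>. (g i \<omega> * \<xi> i \<omega>) * (g j \<omega> * \<xi> j \<omega>))" for i j
    by (rule integrable_mult_of_squares(1)) (auto intro: bounded_transform_sq(1)[OF g c])
  have intg: "integrable M (\<lambda>\<omega>. (g j \<omega>)\<^sup>2 * v j)" for j
  proof -
    have "0 \<le> c j" using c[of j undefined] by linarith
    then show ?thesis
      by (intro integrable_mult_left integrable_const_bound[of _ "(c j)\<^sup>2"])
        (use c[of j] in \<open>auto simp: abs_le_square_iff[symmetric]\<close>)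
  qed
  show "integrable M (\<lambda>\<omega>. (\<Sum>j\<in>A. g j \<omega> * \<xi> j \<omega>)\<^sup>2)"
    unfolding power2_eq_square sum_product by (intro Bochner_Integration.integrable_sum int)
  have off: "expectation (\<lambda>\<omega>. (g i \<omega> * \<xi> i \<omega>) * (g j \<omega> * \<xi> j \<omega>)) = 0" if "i \<noteq> j" for i j
  proof (cases "i < j")
    case True then show ?thesis by (rule bounded_transform_orthogonal[OF g c])
  next
    case False
    then have "expectation (\<lambda>\<omega>. (g j \<omega> * \<xi> j \<omega>) * (g i \<omega> * \<xi> i \<omega>)) = 0"
      using that by (intro bounded_transform_orthogonal[OF g c]) auto
    then show ?thesis by (simp add: mult.commute)
  qed
  have "expectation (\<lambda>\<omega>. (\<Sum>j\<in>A. g j \<omega> * \<xi> j \<omega>)\<^sup>2) =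
    (\<Sum>i\<in>A. \<Sum>j\<in>A. expectation (\<lambda>\<omega>. (g i \<omega> * \<xi> i \<omega>) * (g j \<omega> * \<xi> j \<omega>)))"
    unfolding power2_eq_square sum_product
    by (subst Bochner_Integration.integral_sum, intro Bochner_Integration.integrable_sum int)
      (intro sum.cong refl Bochner_Integration.integral_sum int)
  also have "\<dots> = (\<Sum>i\<in>A. \<Sum>j\<in>A. if i = j then expectation (\<lambda>\<omega>. (g j \<omega>)\<^sup>2 * v j) else 0)"
    using off bounded_transform_sq(2)[OF g c]
    by (intro sum.cong refl) (auto simp: power2_eq_square[symmetric])
  also have "\<dots> = (\<Sum>j\<in>A. expectation (\<lambda>\<omega>. (g j \<omega>)\<^sup>2 * v j))" using \<open>finite A\<close> by simp
  also have "\<dots> = expectation (\<lambda>\<omega>. \<Sum>j\<in>A. (g j \<omega>)\<^sup>2 * v j)"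
    by (rule Bochner_Integration.integral_sum[symmetric]) (rule intg)
  finally show "expectation (\<lambda>\<omega>. (\<Sum>j\<in>A. g j \<omega> * \<xi> j \<omega>)\<^sup>2) = \<dots>" .
qed

text \<open>The transform is stopped as soon as its accumulated variance exceeds \<open>\<delta>\<close>, which makes it
  bounded; on the event that this does not happen nothing is changed.\<close>

lemma transform_trunc_mean_le_aux:
  fixes B :: "nat \<Rightarrow> nat set" and N n :: nat
  assumes g: "\<And>j. g j \<in> borel_measurable (G j)"
    and B: "disjoint_family_on B {..<N}" "(\<Union>i<N. B i) \<subseteq> {..<n}"
    and \<delta>: "0 < \<delta>" "\<delta> \<le> 1"
  shows "trunc_mean M (\<lambda>\<omega>. (\<Sum>j<n. g j \<omega> * \<xi> j \<omega>)\<^sup>2 + (\<Sum>i<N. (\<Sum>j\<in>B i. g j \<omega> * \<xi> j \<omega>)\<^sup>2))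
    \<le> trunc_mean M (\<lambda>\<omega>. \<Sum>j<n. (g j \<omega>)\<^sup>2 * v j) / \<delta> + 2 * \<delta>"
proof -
  note [measurable] = M_measurable[OF g] M_measurable[OF \<xi>_meas]
  define R where "R m \<omega> = (\<Sum>j<m. (g j \<omega>)\<^sup>2 * v j)" for m \<omega>
  \<comment> \<open>\<open>R (Suc j)\<close> contains the variance of the j-th term but not \<xi> j,
    so it is known at stage j: the stopped coefficient stays predictable, and the term that would
    carry the sum past the level is itself dropped.\<close>
  define h where "h j \<omega> = (if R (Suc j) \<omega> \<le> \<delta> then g j \<omega> else 0)" for j \<omega>
  define Q where "Q f \<omega> = (\<Sum>j<n. f j \<omega> * \<xi> j \<omega>)\<^sup>2 + (\<Sum>i<N. (\<Sum>j\<in>B i. f j \<omega> * \<xi> j \<omega>)\<^sup>2)" for f \<omega>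
  have R_mono: "R i \<omega> \<le> R j \<omega>" if "i \<le> j" for i j \<omega>
    unfolding R_def using that v_pos by (intro sum_mono2) (auto simp: less_imp_le)
  have [measurable]: "R m \<in> borel_measurable M" for m unfolding R_def by measurable
  have RG: "R (Suc j) \<in> borel_measurable (G j)" for j
    unfolding R_def using G_measurable[OF g] by (intro borel_measurable_sum borel_measurable_times borel_measurable_power) auto
  have h: "h j \<in> borel_measurable (G j)" for j
    unfolding h_def using RG[of j] g[of j] by measurable
  note [measurable] = M_measurable[OF h]
  have hc: "\<bar>h j \<omega>\<bar> \<le> sqrt (\<delta> / v j)" for j \<omega>
  proof (cases "R (Suc j) \<omega> \<le> \<delta>")
    case True
    have "(g j \<omega>)\<^sup>2 * v j \<le> R (Suc j) \<omega>"
      unfolding R_def using v_pos by (intro member_le_sum) (auto simp: less_imp_le)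
    with True have "(g j \<omega>)\<^sup>2 \<le> \<delta> / v j" using v_pos[of j] by (simp add: pos_le_divide_eq)
    then have "\<bar>g j \<omega>\<bar> \<le> sqrt (\<delta> / v j)" by (intro real_le_rsqrt) simp
    then show ?thesis using True by (simp add: h_def)
  qed (use \<delta> v_pos[of j] in \<open>simp add: h_def\<close>)
  have hsum: "(\<Sum>j<m. (h j \<omega>)\<^sup>2 * v j) \<le> \<delta>" for m \<omega>
  proof (induction m)
    case (Suc m)
    show ?case
    proof (cases "R (Suc m) \<omega> \<le> \<delta>")
      case True
      have "(\<Sum>j<Suc m. (h j \<omega>)\<^sup>2 * v j) \<le> R (Suc m) \<omega>"
        unfolding R_def by (rule sum_mono) (use v_pos in \<open>auto simp: h_def less_imp_le\<close>)
      with True show ?thesis by linarith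
    qed (use Suc in \<open>simp add: h_def\<close>)
  qed (use \<delta> in simp)
  have hint: "integrable M (\<lambda>\<omega>. \<Sum>j\<in>A. (h j \<omega>)\<^sup>2 * v j)" if "A \<subseteq> {..<n}" for A
  proof (rule integrable_const_bound[of _ \<delta>])
    have "(\<Sum>j\<in>A. (h j \<omega>)\<^sup>2 * v j) \<le> \<delta>" for \<omega>
    proof -
      have "(\<Sum>j\<in>A. (h j \<omega>)\<^sup>2 * v j) \<le> (\<Sum>j<n. (h j \<omega>)\<^sup>2 * v j)"
        using that v_pos by (intro sum_mono2) (auto simp: less_imp_le)
      then show ?thesis using hsum order_trans by blast
    qed
    moreover have "0 \<le> (\<Sum>j\<in>A. (h j \<omega>)\<^sup>2 * v j)" for \<omega>
      using v_pos by (auto intro!: sum_nonneg simp: less_imp_le)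
    ultimately show "AE \<omega> in M. norm (\<Sum>j\<in>A. (h j \<omega>)\<^sup>2 * v j) \<le> \<delta>" by simp
  qed measurable
  have hA: "expectation (\<lambda>\<omega>. \<Sum>j<n. (h j \<omega>)\<^sup>2 * v j) \<le> \<delta>"
  proof -
    have "expectation (\<lambda>\<omega>. \<Sum>j<n. (h j \<omega>)\<^sup>2 * v j) \<le> expectation (\<lambda>_. \<delta>)"
    proof (rule integral_mono)
      show "integrable M (\<lambda>\<omega>. \<Sum>j<n. (h j \<omega>)\<^sup>2 * v j)" by (rule hint) simp
    qed (use hsum in auto)
    then show ?thesis by (simp add: prob_space)
  qed
  have finB: "finite (B i)" if "i < N" for i using B(2) that by (auto intro: finite_subset)
  have Qint: "integrable M (Q h)"
    unfolding Q_def by (intro Bochner_Integration.integrable_add Bochner_Integration.integrable_sum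
        bounded_transform_sum_sq(1)[OF h hc]) (use finB in auto)
  \<comment> \<open>The isometry on each block, together with disjointness of the blocks, bounds the
    mean of all block squares by the same accumulated variance. This is the second \<delta> in 2 *
    \<delta>.\<close>
  have "expectation (\<lambda>\<omega>. \<Sum>i<N. (\<Sum>j\<in>B i. h j \<omega> * \<xi> j \<omega>)\<^sup>2) =
      (\<Sum>i<N. expectation (\<lambda>\<omega>. \<Sum>j\<in>B i. (h j \<omega>)\<^sup>2 * v j))"
    using finB by (subst Bochner_Integration.integral_sum)
      (auto intro!: sum.cong bounded_transform_sum_sq[OF h hc])
  also have "\<dots> = expectation (\<lambda>\<omega>. \<Sum>i<N. \<Sum>j\<in>B i. (h j \<omega>)\<^sup>2 * v j)"
    by (rule Bochner_Integration.integral_sum[symmetric]) (use B(2) hint in blast)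
  also have "\<dots> = expectation (\<lambda>\<omega>. \<Sum>j\<in>(\<Union>i<N. B i). (h j \<omega>)\<^sup>2 * v j)"
    using B(1) finB by (subst sum.UNION_disjoint_family) auto
  also have "\<dots> \<le> expectation (\<lambda>\<omega>. \<Sum>j<n. (h j \<omega>)\<^sup>2 * v j)"
    using B(2) v_pos by (intro integral_mono hint sum_mono2) (auto simp: less_imp_le)
  also have "\<dots> \<le> \<delta>" by (rule hA)
  finally have "expectation (\<lambda>\<omega>. \<Sum>i<N. (\<Sum>j\<in>B i. h j \<omega> * \<xi> j \<omega>)\<^sup>2) \<le> \<delta>" .
  moreover have "expectation (Q h) = expectation (\<lambda>\<omega>. (\<Sum>j<n. h j \<omega> * \<xi> j \<omega>)\<^sup>2)
     + expectation (\<lambda>\<omega>. \<Sum>i<N. (\<Sum>j\<in>B i. h j \<omega> * \<xi> j \<omega>)\<^sup>2)"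
    unfolding Q_def by (intro Bochner_Integration.integral_add Bochner_Integration.integrable_sum
        bounded_transform_sum_sq(1)[OF h hc]) (use finB in auto)
  moreover have "expectation (\<lambda>\<omega>. (\<Sum>j<n. h j \<omega> * \<xi> j \<omega>)\<^sup>2) \<le> \<delta>"
    using bounded_transform_sum_sq(2)[OF h hc, of "{..<n}"] hA by simp
  ultimately have EQ: "expectation (Q h) \<le> 2 * \<delta>" by linarith
  have Q0: "0 \<le> Q f \<omega>" for f \<omega> by (simp add: Q_def sum_nonneg)
  have [measurable]: "Q g \<in> borel_measurable M" "Q h \<in> borel_measurable M"
    unfolding Q_def by measurable
  have "trunc_mean M (Q g) \<le> (\<integral>\<omega>. min 1 \<bar>R n \<omega>\<bar> / \<delta> + Q h \<omega> \<partial>M)"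
    unfolding trunc_mean_def
  proof (rule integral_mono)
    fix \<omega> assume "\<omega> \<in> space M"
    show "min 1 \<bar>Q g \<omega>\<bar> \<le> min 1 \<bar>R n \<omega>\<bar> / \<delta> + Q h \<omega>"
    \<comment> \<open>Either no coefficient was stopped, and \<open>Q g\<close> equals
      \<open>Q h\<close>; or the first summand alone is at least 1, since \<delta> \<le> 1, and
      dominates the truncated left side.\<close>
    proof (cases "R n \<omega> \<le> \<delta>")
      case True
      have "h j \<omega> = g j \<omega>" if "j < n" for j
        using R_mono[of "Suc j" n \<omega>] that True by (simp add: h_def)
      then have "Q g \<omega> = Q h \<omega>"
        using B(2) unfolding Q_def by (intro arg_cong2[where f="(+)"] arg_cong[where f="\<lambda>x. x\<^sup>2"] sum.cong refl) auto
      moreover have "0 \<le> min 1 \<bar>R n \<omega>\<bar> / \<delta>" using \<delta> by simp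
      ultimately show ?thesis using Q0[of h \<omega>] by linarith
    next
      case False
      then have "1 \<le> min 1 \<bar>R n \<omega>\<bar> / \<delta>" using \<delta> by (simp add: pos_le_divide_eq)
      then show ?thesis using Q0[of h \<omega>] by linarith
    qed
  qed (auto intro!: Bochner_Integration.integrable_add Qint Bochner_Integration.integrable_divide)
  also have "\<dots> = trunc_mean M (R n) / \<delta> + expectation (Q h)"
    unfolding trunc_mean_def
    by (subst Bochner_Integration.integral_add) (auto intro!: Qint Bochner_Integration.integrable_divide)
  finally show ?thesis using EQ unfolding Q_def R_def by linarith
qed

text \<open>The blocks let one estimate control the total error and also the sum of squared errors
  over coarser cells; the expansion of the logarithm needs both. The free level \<delta> is
  optimised away.\<close>

lemma transform_trunc_mean_le:
  fixes B :: "nat \<Rightarrow> nat set" and N n :: nat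
  assumes g: "\<And>j. g j \<in> borel_measurable (G j)"
    and B: "disjoint_family_on B {..<N}" "(\<Union>i<N. B i) \<subseteq> {..<n}"
  shows "trunc_mean M (\<lambda>\<omega>. (\<Sum>j<n. g j \<omega> * \<xi> j \<omega>)\<^sup>2 + (\<Sum>i<N. (\<Sum>j\<in>B i. g j \<omega> * \<xi> j \<omega>)\<^sup>2))
    \<le> 3 * sqrt (trunc_mean M (\<lambda>\<omega>. \<Sum>j<n. (g j \<omega>)\<^sup>2 * v j))"
proof (rule le_sqrt_of_le_quotient[OF trunc_mean_nonneg trunc_mean_le_1])
  note [measurable] = M_measurable[OF g]
  show "(\<lambda>\<omega>. \<Sum>j<n. (g j \<omega>)\<^sup>2 * v j) \<in> borel_measurable M" by measurable
qed (rule transform_trunc_mean_le_aux[OF g B])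

end

subsection \<open>Brownian motion and the Ito integral\<close>

text \<open>A single coordinate of the planar process, relative to the common filtration. Stating
  the theory for one coordinate makes it available to \<open>WS\<close> and W\<mu> alike.\<close>

locale brownian = prob_space M for M :: "'a measure" +
  fixes F :: "real \<Rightarrow> 'a measure" and W :: "real \<Rightarrow> 'a \<Rightarrow> real"
  assumes subalg: "\<And>t. subalgebra M (F t)"
    and F_mono: "\<And>s t. s \<le> t \<Longrightarrow> subalgebra (F t) (F s)"
    and adapted: "\<And>t. 0 \<le> t \<Longrightarrow> W t \<in> borel_measurable (F t)"
    and W_continuous: "\<And>\<omega>. \<omega> \<in> space M \<Longrightarrow> continuous_on {0..} (\<lambda>t. W t \<omega>)"
    and W_start: "AE \<omega> in M. W 0 \<omega> = 0"
    and W_normal: "\<And>s t. 0 \<le> s \<Longrightarrow> s < t \<Longrightarrow>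
      distributed M lborel (\<lambda>\<omega>. W t \<omega> - W s \<omega>) (normal_density 0 (sqrt (t - s)))"
    and W_indep: "\<And>s t Z. 0 \<le> s \<Longrightarrow> s < t \<Longrightarrow> Z \<in> borel_measurable (F s) \<Longrightarrow>
      indep_var borel Z borel (\<lambda>\<omega>. W t \<omega> - W s \<omega>)"
begin

lemma F_measurable: "Z \<in> borel_measurable (F s) \<Longrightarrow> s \<le> t \<Longrightarrow> (Z :: _ \<Rightarrow> real) \<in> borel_measurable (F t)"
  using measurable_from_subalg[OF F_mono] by blast

lemma M_measurable: "Z \<in> borel_measurable (F s) \<Longrightarrow> (Z :: _ \<Rightarrow> real) \<in> borel_measurable M"
  using measurable_from_subalg[OF subalg] by blast

lemma W_measurable: "0 \<le> t \<Longrightarrow> W t \<in> borel_measurable M"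
  using M_measurable[OF adapted] .

lemma increment_moments:
  assumes "0 \<le> s" "s < t"
  shows "integrable M (\<lambda>\<omega>. (W t \<omega> - W s \<omega>)^k)"
    and "expectation (\<lambda>\<omega>. W t \<omega> - W s \<omega>) = 0"
    and "expectation (\<lambda>\<omega>. (W t \<omega> - W s \<omega>)\<^sup>2) = t - s"
    and "expectation (\<lambda>\<omega>. (W t \<omega> - W s \<omega>)^4) = 3 * (t - s)\<^sup>2"
proof -
  note D = W_normal[OF assms]
  have \<sigma>: "sqrt (t - s) > 0" "(sqrt (t - s))\<^sup>2 = t - s" using assms by auto
  have nn: "\<And>x. 0 \<le> normal_density 0 (sqrt (t - s)) x" by simp
  show "integrable M (\<lambda>\<omega>. (W t \<omega> - W s \<omega>)^k)"
    using distributed_integrable[OF D, of "\<lambda>x. x ^ k"] integrable_normal_moment[OF \<sigma>(1), of 0 k] by simp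
  show "expectation (\<lambda>\<omega>. W t \<omega> - W s \<omega>) = 0"
    using distributed_integral[OF D, of "\<lambda>x. x"] integral_normal_moment_odd[OF \<sigma>(1), of 0 0] by simp
  show "expectation (\<lambda>\<omega>. (W t \<omega> - W s \<omega>)\<^sup>2) = t - s"
    using distributed_integral[OF D, of "\<lambda>x. x\<^sup>2"] integral_normal_moment_even[OF \<sigma>(1), of 0 1] \<sigma>(2)
    by (simp add: fact_numeral)
  have "(\<integral>x. normal_density 0 (sqrt (t - s)) x * x ^ 4 \<partial>lborel) = 3 * (t - s)\<^sup>2"
    using integral_normal_moment_even[OF \<sigma>(1), of 0 2] \<sigma>(2)
    by (simp add: fact_numeral power_divide)
  then show "expectation (\<lambda>\<omega>. (W t \<omega> - W s \<omega>)^4) = 3 * (t - s)\<^sup>2"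
    using distributed_integral[OF D, of "\<lambda>x. x ^ 4"] by simp
qed

lemma grid_increments:
  assumes "0 \<le> u" "u < v" "l > 0"
  shows "increment_sequence M (\<lambda>j. F (grid u v l j)) (\<lambda>j \<omega>. W (grid u v l (Suc j)) \<omega> - W (grid u v l j) \<omega>)
    (\<lambda>j. (v - u) / real l)"
proof -
  have g: "0 \<le> grid u v l j" "grid u v l j < grid u v l (Suc j)"
    "grid u v l (Suc j) - grid u v l j = (v - u) / real l" for j
    using grid_ge[of u v l j] assms by (auto simp: grid_Suc)
  note m = increment_moments[OF g(1,2)]
  show ?thesis
  proof unfold_locales
    fix j
    have "0 \<le> grid u v l (Suc j)" using g(1,2)[of j] by linarith
    then show "(\<lambda>\<omega>. W (grid u v l (Suc j)) \<omega> - W (grid u v l j) \<omega>) \<in> borel_measurable (F (grid u v l (Suc j)))"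
      using g(1,2)[of j] by (intro borel_measurable_diff adapted F_measurable[OF adapted[of "grid u v l j"]]) auto
    show "subalgebra (F (grid u v l j)) (F (grid u v l i))" if "i \<le> j" for i
      using that assms by (intro F_mono grid_mono) auto
  qed (use g m assms subalg in \<open>auto intro: W_indep\<close>)
qed

text \<open>The squares of independent increments, once centred, are again independent of the past,
  so quadratic variation falls under the same inequality as stochastic integrals.\<close>

lemma square_grid_increments:
  assumes "0 \<le> u" "u < v" "l > 0"
  shows "increment_sequence M (\<lambda>j. F (grid u v l j))
    (\<lambda>j \<omega>. (W (grid u v l (Suc j)) \<omega> - W (grid u v l j) \<omega>)\<^sup>2 - (v - u) / real l) (\<lambda>j. 2 * ((v - u) / real l)\<^sup>2)"
proof -
  interpret I: increment_sequence M "\<lambda>j. F (grid u v l j)" "\<lambda>j \<omega>. W (grid u v l (Suc j)) \<omega> - W (grid u v l j) \<omega>"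
    "\<lambda>j. (v - u) / real l" by (rule grid_increments[OF assms])
  define D where "D = (v - u) / real l"
  have D: "D > 0" using assms by (simp add: D_def)
  have g: "0 \<le> grid u v l j" "grid u v l j < grid u v l (Suc j)"
    "grid u v l (Suc j) - grid u v l j = D" for j
    using grid_ge[of u v l j] assms by (auto simp: grid_Suc D_def)
  note m = increment_moments[OF g(1,2), unfolded g(3)]
  have sq: "((W (grid u v l (Suc j)) \<omega> - W (grid u v l j) \<omega>)\<^sup>2 - D)\<^sup>2 =
     (W (grid u v l (Suc j)) \<omega> - W (grid u v l j) \<omega>)^4 - 2 * D * (W (grid u v l (Suc j)) \<omega> - W (grid u v l j) \<omega>)\<^sup>2 + D\<^sup>2" for j \<omega>
  proof -
    have "(x\<^sup>2 - D)\<^sup>2 = x ^ 4 - 2 * D * x\<^sup>2 + D\<^sup>2" for x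
      by (simp add: power2_diff flip: power_mult)
    then show ?thesis .
  qed
  show ?thesis unfolding D_def[symmetric]
  proof unfold_locales
    fix j and Z :: "'a \<Rightarrow> real" assume "Z \<in> borel_measurable (F (grid u v l j))"
    from indep_var_compose[OF I.\<xi>_indep[OF this], of "\<lambda>x. x" borel "\<lambda>x. x\<^sup>2 - D" borel]
    show "indep_var borel Z borel (\<lambda>\<omega>. (W (grid u v l (Suc j)) \<omega> - W (grid u v l j) \<omega>)\<^sup>2 - D)"
      by (simp add: o_def)
  next
    fix j
    show "(\<lambda>\<omega>. (W (grid u v l (Suc j)) \<omega> - W (grid u v l j) \<omega>)\<^sup>2 - D) \<in> borel_measurable (F (grid u v l (Suc j)))"
      by (intro borel_measurable_diff borel_measurable_power I.\<xi>_meas) auto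
    show "integrable M (\<lambda>\<omega>. ((W (grid u v l (Suc j)) \<omega> - W (grid u v l j) \<omega>)\<^sup>2 - D)\<^sup>2)"
      unfolding sq by (intro Bochner_Integration.integrable_add Bochner_Integration.integrable_diff
          Bochner_Integration.integrable_mult_right m) auto
    \<comment> \<open>The Gaussian fourth moment gives 3 * D^2 - 2 * D * D + D^2.\<close>
    show "expectation (\<lambda>\<omega>. ((W (grid u v l (Suc j)) \<omega> - W (grid u v l j) \<omega>)\<^sup>2 - D)\<^sup>2) = 2 * D\<^sup>2"
      unfolding sq using m(1)[of j 4] m(1)[of j 2] m(3,4)[of j]
      by (simp add: prob_space) (simp add: power2_eq_square)
    show "expectation (\<lambda>\<omega>. (W (grid u v l (Suc j)) \<omega> - W (grid u v l j) \<omega>)\<^sup>2 - D) = 0"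
      using m(1)[of j 2] m(3)[of j] by (simp add: prob_space)
  qed (use I.G_mono subalg D in auto)
qed

section \<open>Elementary integrands and their integrals\<close>

text \<open>The integral \<open>J\<close> of \<open>h\<close> is characterised by pathwise limits of
  left sums instead of a formula. In this form differences of simple integrands are covered without
  a common refinement of their partitions, and the estimates see nothing but sums over uniform
  grids.\<close>

definition elementary :: "(real \<Rightarrow> 'a \<Rightarrow> real) \<Rightarrow> (real \<Rightarrow> 'a \<Rightarrow> real) \<Rightarrow> bool" where
  "elementary h J \<longleftrightarrow>
     (\<forall>t\<ge>0. h t \<in> borel_measurable (F t)) \<and> (\<forall>t\<ge>0. J t \<in> borel_measurable M) \<and>
     (\<forall>\<omega>. (\<lambda>s. h s \<omega>) \<in> borel_measurable borel \<and> left_locally_constant (\<lambda>s. h s \<omega>) \<and> J 0 \<omega> = 0) \<and>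
     (\<forall>\<omega>\<in>space M. \<exists>B. \<forall>s. \<bar>h s \<omega>\<bar> \<le> B) \<and>
     (\<forall>\<omega>\<in>space M. \<forall>u v. 0 \<le> u \<and> u < v \<longrightarrow>
       (\<lambda>l. \<Sum>j<l. h (grid u v l j) \<omega> * (W (grid u v l (Suc j)) \<omega> - W (grid u v l j) \<omega>)) \<longlonglongrightarrow> J v \<omega> - J u \<omega>)"

lemma elementaryD:
  assumes "elementary h J"
  shows "0 \<le> t \<Longrightarrow> h t \<in> borel_measurable (F t)" "0 \<le> t \<Longrightarrow> J t \<in> borel_measurable M"
    "(\<lambda>s. h s \<omega>) \<in> borel_measurable borel" "left_locally_constant (\<lambda>s. h s \<omega>)" "J 0 \<omega> = 0"
    "\<omega> \<in> space M \<Longrightarrow> \<exists>B. \<forall>s. \<bar>h s \<omega>\<bar> \<le> B"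
    "\<omega> \<in> space M \<Longrightarrow> 0 \<le> u \<Longrightarrow> u < v \<Longrightarrow>
       (\<lambda>l. \<Sum>j<l. h (grid u v l j) \<omega> * (W (grid u v l (Suc j)) \<omega> - W (grid u v l j) \<omega>)) \<longlonglongrightarrow> J v \<omega> - J u \<omega>"
  using assms unfolding elementary_def by blast+

lemma elementary_diff:
  assumes "elementary h J" "elementary h' J'"
  shows "elementary (\<lambda>s \<omega>. h s \<omega> - h' s \<omega>) (\<lambda>s \<omega>. J s \<omega> - J' s \<omega>)"
  unfolding elementary_def
proof (intro conjI allI ballI impI)
  fix \<omega> assume \<omega>: "\<omega> \<in> space M"
  obtain B B' where "\<And>s. \<bar>h s \<omega>\<bar> \<le> B" "\<And>s. \<bar>h' s \<omega>\<bar> \<le> B'"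
    using elementaryD(6)[OF assms(1) \<omega>] elementaryD(6)[OF assms(2) \<omega>] by blast
  then have "\<bar>h s \<omega> - h' s \<omega>\<bar> \<le> B + B'" for s
    by (meson abs_triangle_ineq4 add_mono order_trans)
  then show "\<exists>B. \<forall>s. \<bar>h s \<omega> - h' s \<omega>\<bar> \<le> B" by blast
next
  fix \<omega> u v assume *: "\<omega> \<in> space M" "0 \<le> u \<and> u < (v::real)"
  let ?S = "\<lambda>h l. \<Sum>j<l. h (grid u v l j) \<omega> * (W (grid u v l (Suc j)) \<omega> - W (grid u v l j) \<omega>)"
  have "?S h \<longlonglongrightarrow> J v \<omega> - J u \<omega>" "?S h' \<longlonglongrightarrow> J' v \<omega> - J' u \<omega>"
    using * by (auto intro: elementaryD(7)[OF assms(1)] elementaryD(7)[OF assms(2)])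
  from tendsto_diff[OF this] have "(\<lambda>l. ?S h l - ?S h' l) \<longlonglongrightarrow> (J v \<omega> - J u \<omega>) - (J' v \<omega> - J' u \<omega>)" .
  also have "(\<lambda>l. ?S h l - ?S h' l) = ?S (\<lambda>s \<omega>. h s \<omega> - h' s \<omega>)"
    by (simp add: sum_subtractf[symmetric] left_diff_distrib)
  finally show "?S (\<lambda>s \<omega>. h s \<omega> - h' s \<omega>) \<longlonglongrightarrow> J v \<omega> - J' v \<omega> - (J u \<omega> - J' u \<omega>)" by (simp add: algebra_simps)
qed (auto intro!: borel_measurable_diff left_locally_constant_diff
    simp: elementaryD(1-5)[OF assms(1)] elementaryD(1-5)[OF assms(2)])

lemma elementary_simple:
  assumes "simple_integrand M F n p \<xi>"
  shows "elementary (simple_process n p \<xi>) (simple_integral W n p \<xi>)"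
proof -
  from assms have p: "0 \<le> p 0" "\<And>i. i < n \<Longrightarrow> p i \<le> p (Suc i)"
    and \<xi>: "\<And>i. i < n \<Longrightarrow> \<xi> i \<in> borel_measurable (F (p i))"
      "\<And>i. i < n \<Longrightarrow> \<exists>B. \<forall>\<omega>\<in>space M. \<bar>\<xi> i \<omega>\<bar> \<le> B"
    by (auto simp: simple_integrand_def)
  have p0: "0 \<le> p i" if "i \<le> n" for i using that
  proof (induction i)
    case (Suc i) then show ?case using p(2)[of i] by simp
  qed (use p in simp)
  have h: "simple_process n p \<xi> t \<in> borel_measurable (F t)" if t: "0 \<le> t" for t
  proof -
    have "(\<lambda>\<omega>. \<xi> i \<omega> * indicator {p i<..p (Suc i)} t) \<in> borel_measurable (F t)" if i: "i < n" for i
    proof (cases "p i < t")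
      case True
      then have "\<xi> i \<in> borel_measurable (F t)" using F_measurable[OF \<xi>(1)[OF i]] by simp
      then show ?thesis by (intro borel_measurable_times) auto
    next
      \<comment> \<open>The weight \<xi> i need not be known at time t here, but its indicator is
        still 0.\<close>
      case False
      then have "(indicator {p i<..p (Suc i)} t :: real) = 0" by simp
      then show ?thesis by simp
    qed
    then have "(\<lambda>\<omega>. \<Sum>i<n. \<xi> i \<omega> * indicator {p i<..p (Suc i)} t) \<in> borel_measurable (F t)"
      by (intro borel_measurable_sum) simp
    then show ?thesis by (simp add: simple_process_def[abs_def])
  qed
  have J: "simple_integral W n p \<xi> t \<in> borel_measurable M" if t: "0 \<le> t" for t
  proof -
    have "(\<lambda>\<omega>. \<xi> i \<omega> * (W (min t (p (Suc i))) \<omega> - W (min t (p i)) \<omega>)) \<in> borel_measurable M" if i: "i < n" for i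
      using p0[of i] p0[of "Suc i"] i t
      by (intro borel_measurable_times borel_measurable_diff W_measurable M_measurable[OF \<xi>(1)]) auto
    then have "(\<lambda>\<omega>. \<Sum>i<n. \<xi> i \<omega> * (W (min t (p (Suc i))) \<omega> - W (min t (p i)) \<omega>)) \<in> borel_measurable M"
      by (intro borel_measurable_sum) simp
    then show ?thesis by (simp add: simple_integral_def[abs_def])
  qed
  have "(\<lambda>s. simple_process n p \<xi> s \<omega>) \<in> borel_measurable borel" for \<omega>
    unfolding simple_process_def by measurable
  moreover have "left_locally_constant (\<lambda>s. simple_process n p \<xi> s \<omega>)" for \<omega>
    unfolding simple_process_def by (rule left_locally_constant_step_sum[of n p]) (rule p(2))
  moreover have "simple_integral W n p \<xi> 0 \<omega> = 0" for \<omega>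
    unfolding simple_integral_def using p0 by (intro sum.neutral) (simp add: min_def)
  moreover have "\<exists>B. \<forall>s. \<bar>simple_process n p \<xi> s \<omega>\<bar> \<le> B" for \<omega>
  proof -
    have "\<bar>simple_process n p \<xi> s \<omega>\<bar> \<le> (\<Sum>i<n. \<bar>\<xi> i \<omega>\<bar>)" for s
      unfolding simple_process_def
      by (rule order_trans[OF sum_abs sum_mono]) (simp add: indicator_def)
    then show ?thesis by blast
  qed
  moreover have "(\<lambda>l. \<Sum>j<l. simple_process n p \<xi> (grid u v l j) \<omega> * (W (grid u v l (Suc j)) \<omega> - W (grid u v l j) \<omega>))
      \<longlonglongrightarrow> simple_integral W n p \<xi> v \<omega> - simple_integral W n p \<xi> u \<omega>"
    if "\<omega> \<in> space M" "0 \<le> u" "u < v" for \<omega> u v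
    by (rule simple_integral_increment_tendsto[where W=W and n=n and p=p]) (use W_continuous that p in auto)
  ultimately show ?thesis unfolding elementary_def using h J by simp
qed

lemma grid_refine:
  assumes "N > 0" "l > 0"
  shows "grid 0 T (N * l) (i * l + j) = grid (grid 0 T N i) (grid 0 T N (Suc i)) l j"
  using assms by (simp add: grid_def field_simps)

text \<open>Obtained from the inequality for sums of increments on a fine grid that refines the coarse one,
  in the limit of vanishing mesh of the fine grid.\<close>

lemma elementary_trunc_mean_le:
  assumes el: "elementary h J" and T: "T > 0" and N: "N > 0"
    and Z: "\<And>i. Z i \<in> borel_measurable (F (grid 0 T N i))"
    and b: "\<And>i. b i \<in> borel_measurable (F (grid 0 T N i))"
    and e_def: "\<And>i \<omega>. e i \<omega> = Z i \<omega> * (J (grid 0 T N (Suc i)) \<omega> - J (grid 0 T N i) \<omega>)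
      - b i \<omega> * (W (grid 0 T N (Suc i)) \<omega> - W (grid 0 T N i) \<omega>)"
    and R_def: "\<And>\<omega>. R \<omega> = (\<Sum>i<N. integral {grid 0 T N i..grid 0 T N (Suc i)} (\<lambda>s. (Z i \<omega> * h s \<omega> - b i \<omega>)\<^sup>2))"
  shows "R \<in> borel_measurable M"
    and "trunc_mean M (\<lambda>\<omega>. (\<Sum>i<N. e i \<omega>)\<^sup>2 + (\<Sum>i<N. (e i \<omega>)\<^sup>2)) \<le> 3 * sqrt (trunc_mean M R)"
proof -
  define t where "t i = grid 0 T N i" for i
  define q where "q l j = grid 0 T (N * l) j" for l j
  \<comment> \<open>On the fine grid the coarse cell of index j is j div l. The coarse data
    \<open>Z\<close> and \<open>b\<close> are frozen at the left end of that cell, hence already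
    known at the fine time q l j.\<close>
  define g where "g l j \<omega> = Z (j div l) \<omega> * h (q l j) \<omega> - b (j div l) \<omega>" for l j \<omega>
  define \<xi> where "\<xi> l j \<omega> = W (q l (Suc j)) \<omega> - W (q l j) \<omega>" for l j \<omega>
  define D where "D l = (T - 0) / real (N * l)" for l
  define blk where "blk l i = {i * l..<i * l + l}" for l i :: nat
  have t0: "0 \<le> t i" "t i < t (Suc i)" "t (Suc i) - t i = T / real N" for i
    using T N grid_ge[of 0 T N i] by (auto simp: t_def grid_Suc)
  have q0: "0 \<le> q l j" for l j using T by (auto simp: q_def intro: grid_ge)
  have q_eq: "q l (i * l + j) = grid (t i) (t (Suc i)) l j" if "l > 0" for l i j
    using grid_refine[OF N that] by (simp add: q_def t_def)
  have t_le_q: "t (j div l) \<le> q l j" if "l > 0" for l j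
  proof -
    have "q l j = grid (t (j div l)) (t (Suc (j div l))) l (j mod l)"
      using q_eq[OF that, of "j div l" "j mod l"] by simp
    then show ?thesis using grid_ge[of "t (j div l)"] t0(2)[of "j div l"] by simp
  qed
  have gm: "g l j \<in> borel_measurable (F (q l j))" if "l > 0" for l j
    unfolding g_def using F_measurable[OF Z[folded t_def] t_le_q[OF that]]
      F_measurable[OF b[folded t_def] t_le_q[OF that]] elementaryD(1)[OF el q0]
    by (intro borel_measurable_diff borel_measurable_times) auto
  have in_blk: "j div l = i" if "j \<in> blk l i" "l > 0" for i j l
    using that by (auto simp: blk_def intro!: div_nat_eqI simp: mult.commute)
  have blk_shift: "(\<Sum>j\<in>blk l i. f j) = (\<Sum>j<l. f (i * l + j))" for f :: "nat \<Rightarrow> real" and l i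
    using sum.shift_bounds_nat_ivl[of f 0 "i * l" l] by (simp add: blk_def lessThan_atLeast0 add.commute)
  have all_blk: "(\<Sum>j<N * l. f j) = (\<Sum>i<N. \<Sum>j\<in>blk l i. f j)" for f :: "nat \<Rightarrow> real" and l
    unfolding blk_def by (rule sum.nat_group[symmetric])
  define E where "E l i \<omega> = (\<Sum>j\<in>blk l i. g l j \<omega> * \<xi> l j \<omega>)" for l i \<omega>
  define V where "V l \<omega> = (\<Sum>j<N * l. (g l j \<omega>)\<^sup>2 * D l)" for l \<omega>
  have main: "trunc_mean M (\<lambda>\<omega>. (\<Sum>i<N. E l i \<omega>)\<^sup>2 + (\<Sum>i<N. (E l i \<omega>)\<^sup>2)) \<le> 3 * sqrt (trunc_mean M (V l))"
    if l: "l > 0" for l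
  proof -
    interpret I: increment_sequence M "\<lambda>j. F (q l j)" "\<xi> l" "\<lambda>j. D l"
      unfolding q_def \<xi>_def D_def by (rule grid_increments) (use T N l in auto)
    have "(\<Union>i<N. blk l i) \<subseteq> {..<N * l}"
    proof (rule UN_least, rule subsetI)
      fix i j assume i: "i \<in> {..<N}" and j: "j \<in> blk l i"
      have "j < Suc i * l" using j by (simp add: blk_def)
      also have "\<dots> \<le> N * l" using i by (intro mult_le_mono1) auto
      finally show "j \<in> {..<N * l}" by simp
    qed
    moreover have "disjoint_family_on (blk l) {..<N}"
      using in_blk[OF _ l] by (auto simp: disjoint_family_on_def)
    ultimately have "trunc_mean M (\<lambda>\<omega>. (\<Sum>j<N * l. g l j \<omega> * \<xi> l j \<omega>)\<^sup>2 + (\<Sum>i<N. (\<Sum>j\<in>blk l i. g l j \<omega> * \<xi> l j \<omega>)\<^sup>2))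
      \<le> 3 * sqrt (trunc_mean M (\<lambda>\<omega>. \<Sum>j<N * l. (g l j \<omega>)\<^sup>2 * D l))"
      by (intro I.transform_trunc_mean_le[OF gm[OF l]])
    then show ?thesis unfolding E_def V_def all_blk .
  qed
  have lim_E: "(\<lambda>l. E l i \<omega>) \<longlonglongrightarrow> e i \<omega>" if \<omega>: "\<omega> \<in> space M" for i \<omega>
  proof -
    have "(\<lambda>l. Z i \<omega> * (\<Sum>j<l. h (grid (t i) (t (Suc i)) l j) \<omega> *
        (W (grid (t i) (t (Suc i)) l (Suc j)) \<omega> - W (grid (t i) (t (Suc i)) l j) \<omega>))
        - b i \<omega> * (W (t (Suc i)) \<omega> - W (t i) \<omega>)) \<longlonglongrightarrow> e i \<omega>"
      unfolding e_def t_def[symmetric] by (intro tendsto_intros elementaryD(7)[OF el \<omega> t0(1,2)])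
    moreover have "\<forall>\<^sub>F l in sequentially. Z i \<omega> * (\<Sum>j<l. h (grid (t i) (t (Suc i)) l j) \<omega> *
        (W (grid (t i) (t (Suc i)) l (Suc j)) \<omega> - W (grid (t i) (t (Suc i)) l j) \<omega>))
        - b i \<omega> * (W (t (Suc i)) \<omega> - W (t i) \<omega>) = E l i \<omega>"
      using eventually_gt_at_top[of 0]
    proof eventually_elim
      case (elim l)
      have "E l i \<omega> = (\<Sum>j<l. (Z i \<omega> * h (q l (i * l + j)) \<omega> - b i \<omega>) * \<xi> l (i * l + j) \<omega>)"
        unfolding E_def blk_shift g_def using elim by (intro sum.cong) auto
      also have "\<dots> = (\<Sum>j<l. Z i \<omega> * (h (grid (t i) (t (Suc i)) l j) \<omega> *
        (W (grid (t i) (t (Suc i)) l (Suc j)) \<omega> - W (grid (t i) (t (Suc i)) l j) \<omega>))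
        - b i \<omega> * (W (grid (t i) (t (Suc i)) l (Suc j)) \<omega> - W (grid (t i) (t (Suc i)) l j) \<omega>))"
        unfolding \<xi>_def q_eq[OF elim] add_Suc_right[symmetric] by (intro sum.cong) (auto simp: algebra_simps)
      also have "\<dots> = Z i \<omega> * (\<Sum>j<l. h (grid (t i) (t (Suc i)) l j) \<omega> *
        (W (grid (t i) (t (Suc i)) l (Suc j)) \<omega> - W (grid (t i) (t (Suc i)) l j) \<omega>))
        - b i \<omega> * (\<Sum>j<l. W (grid (t i) (t (Suc i)) l (Suc j)) \<omega> - W (grid (t i) (t (Suc i)) l j) \<omega>)"
        by (simp only: sum_distrib_left sum_subtractf[symmetric])
      also have "(\<Sum>j<l. W (grid (t i) (t (Suc i)) l (Suc j)) \<omega> - W (grid (t i) (t (Suc i)) l j) \<omega>)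
          = W (t (Suc i)) \<omega> - W (t i) \<omega>"
        using sum_grid_telescope[OF elim, of "\<lambda>s. W s \<omega>" "t i" "t (Suc i)"] .
      finally show ?case by simp
    qed
    ultimately show ?thesis by (rule Lim_transform_eventually)
  qed
  have lim_V: "(\<lambda>l. V l \<omega>) \<longlonglongrightarrow> R \<omega>" if \<omega>: "\<omega> \<in> space M" for \<omega>
  proof -
    obtain B where B: "\<And>s. \<bar>h s \<omega>\<bar> \<le> B" using elementaryD(6)[OF el \<omega>] by blast
    have "(\<lambda>l. \<Sum>i<N. \<Sum>j<l. (Z i \<omega> * h (grid (t i) (t (Suc i)) l j) \<omega> - b i \<omega>)\<^sup>2 * ((t (Suc i) - t i) / real l)) \<longlonglongrightarrow> R \<omega>"
      unfolding R_def t_def[symmetric]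
    proof (intro tendsto_sum)
      fix i
      have llc: "left_locally_constant (\<lambda>s. (Z i \<omega> * h s \<omega> - b i \<omega>)\<^sup>2)"
        unfolding left_locally_constant_def
      proof safe
        fix s :: real assume "s > 0"
        with elementaryD(4)[OF el, of \<omega>] have "\<forall>\<^sub>F r in at_left s. h r \<omega> = h s \<omega>"
          unfolding left_locally_constant_def by auto
        then show "\<forall>\<^sub>F r in at_left s. (Z i \<omega> * h r \<omega> - b i \<omega>)\<^sup>2 = (Z i \<omega> * h s \<omega> - b i \<omega>)\<^sup>2"
          by eventually_elim simp
      qed
      have bnd: "\<bar>(Z i \<omega> * h s \<omega> - b i \<omega>)\<^sup>2\<bar> \<le> (\<bar>Z i \<omega>\<bar> * B + \<bar>b i \<omega>\<bar>)\<^sup>2" for s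
      proof -
        have "\<bar>Z i \<omega> * h s \<omega> - b i \<omega>\<bar> \<le> \<bar>Z i \<omega> * h s \<omega>\<bar> + \<bar>b i \<omega>\<bar>" by (rule abs_triangle_ineq4)
        also have "\<bar>Z i \<omega> * h s \<omega>\<bar> \<le> \<bar>Z i \<omega>\<bar> * B" unfolding abs_mult by (intro mult_left_mono B) auto
        finally have "\<bar>Z i \<omega> * h s \<omega> - b i \<omega>\<bar>\<^sup>2 \<le> (\<bar>Z i \<omega>\<bar> * B + \<bar>b i \<omega>\<bar>)\<^sup>2"
          by (intro power_mono) auto
        then show ?thesis by simp
      qed
      show "(\<lambda>l. \<Sum>j<l. (Z i \<omega> * h (grid (t i) (t (Suc i)) l j) \<omega> - b i \<omega>)\<^sup>2 * ((t (Suc i) - t i) / real l))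
        \<longlonglongrightarrow> integral {t i..t (Suc i)} (\<lambda>s. (Z i \<omega> * h s \<omega> - b i \<omega>)\<^sup>2)"
        by (rule left_locally_constant_sum_tendsto(2)[where f="\<lambda>s. (Z i \<omega> * h s \<omega> - b i \<omega>)\<^sup>2" and u="t i" and v="t (Suc i)", OF llc t0(1,2) bnd])
    qed
    moreover have "\<forall>\<^sub>F l in sequentially. (\<Sum>i<N. \<Sum>j<l. (Z i \<omega> * h (grid (t i) (t (Suc i)) l j) \<omega> - b i \<omega>)\<^sup>2 * ((t (Suc i) - t i) / real l)) = V l \<omega>"
      using eventually_gt_at_top[of 0]
    proof eventually_elim
      case (elim l)
      have "(t (Suc i) - t i) / real l = D l" for i using t0(3)[of i] by (simp add: D_def)
      then show ?case
        unfolding V_def all_blk blk_shift g_def using elim q_eq[OF elim] by (intro sum.cong) auto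
    qed
    ultimately show ?thesis by (rule Lim_transform_eventually)
  qed
  have [measurable]: "g (Suc l) j \<in> borel_measurable M" for l j using M_measurable[OF gm] by simp
  have [measurable]: "\<xi> l j \<in> borel_measurable M" for l j
    unfolding \<xi>_def using q0 by (intro borel_measurable_diff W_measurable)
  have V_meas [measurable]: "V (Suc l) \<in> borel_measurable M" for l unfolding V_def by measurable
  have E_meas [measurable]: "E (Suc l) i \<in> borel_measurable M" for l i unfolding E_def by measurable
  \<comment> \<open>Measurability of the time integrals is obtained along the way: they are
    pointwise limits of sums over fine grids.\<close>
  show R_meas [measurable]: "R \<in> borel_measurable M"
    by (rule borel_measurable_LIMSEQ_real[OF LIMSEQ_Suc[OF lim_V] V_meas])
  have e_meas [measurable]: "e i \<in> borel_measurable M" for i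
    by (rule borel_measurable_LIMSEQ_real[OF LIMSEQ_Suc[OF lim_E] E_meas])
  have "(\<lambda>l. trunc_mean M (\<lambda>\<omega>. (\<Sum>i<N. E (Suc l) i \<omega>)\<^sup>2 + (\<Sum>i<N. (E (Suc l) i \<omega>)\<^sup>2)))
    \<longlonglongrightarrow> trunc_mean M (\<lambda>\<omega>. (\<Sum>i<N. e i \<omega>)\<^sup>2 + (\<Sum>i<N. (e i \<omega>)\<^sup>2))"
    by (intro trunc_mean_AE_tendsto AE_I2 tendsto_intros LIMSEQ_Suc[OF lim_E]) auto
  moreover have "(\<lambda>l. 3 * sqrt (trunc_mean M (V (Suc l)))) \<longlonglongrightarrow> 3 * sqrt (trunc_mean M R)"
    by (intro tendsto_intros trunc_mean_AE_tendsto AE_I2 LIMSEQ_Suc[OF lim_V]) auto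
  ultimately show "trunc_mean M (\<lambda>\<omega>. (\<Sum>i<N. e i \<omega>)\<^sup>2 + (\<Sum>i<N. (e i \<omega>)\<^sup>2)) \<le> 3 * sqrt (trunc_mean M R)"
    by (rule LIMSEQ_le) (use main in auto)
qed

section \<open>Almost sure approximation of Ito integrals\<close>

lemma ident_measurable_F: "(\<lambda>\<omega>. \<omega>) \<in> measurable M (F t)"
  using subalg[of t] by (intro measurableI) (auto simp: subalgebra_def dest: sets.sets_into_space)

text \<open>Progressive measurability speaks of the time interval {0..t} only. Clamping the time
  argument leaves \<open>H\<close> unchanged there and makes it jointly measurable on the whole
  line, as integration against \<open>lborel\<close> demands.\<close>

lemma progressive_clamp_measurable:
  assumes "progressive F H" "0 \<le> t"
  shows "(\<lambda>(s, \<omega>). H (max 0 (min t s)) \<omega>) \<in> borel_measurable (borel \<Otimes>\<^sub>M M)"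
proof -
  have H: "(\<lambda>(s, \<omega>). H s \<omega>) \<in> borel_measurable (restrict_space borel {0..t} \<Otimes>\<^sub>M F t)"
    using assms by (auto simp: progressive_def)
  have "(\<lambda>x. max 0 (min t (fst x))) \<in> measurable (borel \<Otimes>\<^sub>M M) (restrict_space borel {0..t})"
    using assms(2) by (intro measurable_restrict_space2) auto
  moreover have "snd \<in> measurable (borel \<Otimes>\<^sub>M M) (F t)"
    by (rule measurable_compose[OF measurable_snd ident_measurable_F])
  ultimately have "(\<lambda>x. (max 0 (min t (fst x)), snd x)) \<in> measurable (borel \<Otimes>\<^sub>M M) (restrict_space borel {0..t} \<Otimes>\<^sub>M F t)"
    by (rule measurable_Pair)
  from measurable_compose[OF this H] show ?thesis by (simp add: case_prod_beta)
qed

text \<open>Errors of the integrands and of the integrals both vanish in probability; adding them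
  before passing to a subsequence makes both vanish almost surely, and later arguments can fix a
  path.\<close>

lemma has_ito_integral_AE_seq:
  assumes ito: "has_ito_integral M F W H t Y" and t: "0 \<le> t"
  obtains h J where "\<And>k::nat. elementary (h k) (J k)"
    "AE \<omega> in M. (\<lambda>k. \<integral>\<^sup>+ s\<in>{0..t}. ennreal ((h k s \<omega> - H s \<omega>)\<^sup>2) \<partial>lborel) \<longlonglongrightarrow> 0"
    "AE \<omega> in M. (\<lambda>k. J k t \<omega>) \<longlonglongrightarrow> Y \<omega>"
proof -
  from ito obtain n p \<xi> where Hp: "progressive F H" and Y [measurable]: "Y \<in> borel_measurable M"
    and s: "\<And>k. simple_integrand M F (n k) (p k) (\<xi> k)"
    and lim1: "\<And>\<epsilon>. \<epsilon> > 0 \<Longrightarrow> (\<lambda>k. prob {\<omega>\<in>space M.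
            (\<integral>\<^sup>+ s\<in>{0..t}. ennreal ((simple_process (n k) (p k) (\<xi> k) s \<omega> - H s \<omega>)\<^sup>2) \<partial>lborel) > ennreal \<epsilon>}) \<longlonglongrightarrow> 0"
    and lim2: "\<And>\<epsilon>. \<epsilon> > 0 \<Longrightarrow> (\<lambda>k. prob {\<omega>\<in>space M. \<bar>simple_integral W (n k) (p k) (\<xi> k) t \<omega> - Y \<omega>\<bar> > \<epsilon>}) \<longlonglongrightarrow> 0"
    unfolding has_ito_integral_def by blast
  define h where "h k = simple_process (n k) (p k) (\<xi> k)" for k
  define J where "J k = simple_integral W (n k) (p k) (\<xi> k)" for k
  have el: "elementary (h k) (J k)" for k unfolding h_def J_def by (rule elementary_simple[OF s])
  define D where "D k \<omega> = (\<integral>\<^sup>+ s\<in>{0..t}. ennreal ((h k s \<omega> - H s \<omega>)\<^sup>2) \<partial>lborel)" for k \<omega>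
  have [measurable]: "D k \<in> borel_measurable M" for k
  proof -
    note [measurable] = progressive_clamp_measurable[OF Hp t]
    have [measurable]: "\<xi> k i \<in> borel_measurable M" if "i < n k" for i
      using s[of k] that M_measurable unfolding simple_integrand_def by blast
    have "(\<lambda>(s, \<omega>). h k s \<omega>) \<in> borel_measurable (borel \<Otimes>\<^sub>M M)"
    proof -
      have "(\<lambda>x. \<xi> k i (snd x) * indicator {p k i<..p k (Suc i)} (fst x)) \<in> borel_measurable (borel \<Otimes>\<^sub>M M)" if "i < n k" for i
      proof -
        have "(\<lambda>x. \<xi> k i (snd x)) \<in> borel_measurable (borel \<Otimes>\<^sub>M M)"
          using that by measurable
        moreover have "(\<lambda>x. indicator {p k i<..p k (Suc i)} (fst x) :: real) \<in> borel_measurable (borel \<Otimes>\<^sub>M M)"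
          by measurable
        ultimately show ?thesis by (rule borel_measurable_times)
      qed
      then have "(\<lambda>x. \<Sum>i<n k. \<xi> k i (snd x) * indicator {p k i<..p k (Suc i)} (fst x)) \<in> borel_measurable (borel \<Otimes>\<^sub>M M)"
        by (intro borel_measurable_sum) simp
      then show ?thesis by (simp add: h_def simple_process_def case_prod_beta)
    qed
    note [measurable] = this
    have eq: "D k \<omega> = (\<integral>\<^sup>+ s. ennreal ((h k s \<omega> - H (max 0 (min t s)) \<omega>)\<^sup>2) * indicator {0..t} s \<partial>lborel)" for \<omega>
      unfolding D_def by (intro nn_integral_cong) (auto simp: indicator_def)
    have "(\<lambda>(\<omega>, s). ennreal ((h k s \<omega> - H (max 0 (min t s)) \<omega>)\<^sup>2) * indicator {0..t} s) \<in> borel_measurable (M \<Otimes>\<^sub>M lborel)"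
      by measurable
    then show ?thesis unfolding eq[abs_def] by (rule lborel.borel_measurable_nn_integral)
  qed
  have [measurable]: "J k t \<in> borel_measurable M" for k by (rule elementaryD(2)[OF el t])
  \<comment> \<open>The error \<open>D\<close> is extended real and may be infinite for a given
    path; capped at 1 it becomes a real random variable with the same null sequences.\<close>
  define X where "X k \<omega> = enn2real (min 1 (D k \<omega>))" for k \<omega>
  have X: "ennreal (X k \<omega>) = min 1 (D k \<omega>)" for k \<omega>
    unfolding X_def by (intro ennreal_enn2real) (auto simp: min_less_iff_disj)
  have [measurable]: "X k \<in> borel_measurable M" for k unfolding X_def by measurable
  have "(\<lambda>k. trunc_mean M (X k)) \<longlonglongrightarrow> 0"
  proof (rule trunc_mean_tendsto_0I)
    fix \<epsilon> :: real assume \<epsilon>: "\<epsilon> > 0"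
    show "(\<lambda>k. prob {\<omega>\<in>space M. \<bar>X k \<omega>\<bar> > \<epsilon>}) \<longlonglongrightarrow> 0"
    proof (rule tendsto_sandwich[OF _ _ tendsto_const lim1[OF \<epsilon>]])
      show "\<forall>\<^sub>F k in sequentially. prob {\<omega>\<in>space M. \<bar>X k \<omega>\<bar> > \<epsilon>} \<le> prob {\<omega>\<in>space M.
            (\<integral>\<^sup>+ s\<in>{0..t}. ennreal ((simple_process (n k) (p k) (\<xi> k) s \<omega> - H s \<omega>)\<^sup>2) \<partial>lborel) > ennreal \<epsilon>}"
        unfolding h_def[symmetric] D_def[symmetric]
      proof (intro always_eventually allI finite_measure_mono subsetI)
        fix k \<omega> assume "\<omega> \<in> {\<omega>\<in>space M. \<bar>X k \<omega>\<bar> > \<epsilon>}"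
        moreover have "0 \<le> X k \<omega>" by (simp add: X_def)
        ultimately have "\<omega> \<in> space M" "\<epsilon> < X k \<omega>" by auto
        then have "ennreal \<epsilon> < ennreal (X k \<omega>)" using \<epsilon> by (simp add: ennreal_lessI)
        also have "\<dots> \<le> D k \<omega>" by (simp add: X)
        finally show "\<omega> \<in> {\<omega>\<in>space M. D k \<omega> > ennreal \<epsilon>}" using \<open>\<omega> \<in> space M\<close> by simp
      qed measurable
    qed simp
  qed measurable
  moreover have "(\<lambda>k. trunc_mean M (\<lambda>\<omega>. J k t \<omega> - Y \<omega>)) \<longlonglongrightarrow> 0"
    using lim2 by (intro trunc_mean_tendsto_0I) (auto simp: J_def[symmetric])
  ultimately have lim: "(\<lambda>k. trunc_mean M (if i then X k else (\<lambda>\<omega>. J k t \<omega> - Y \<omega>))) \<longlonglongrightarrow> 0" for i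
    by (cases i) auto
  have "(\<lambda>k. trunc_mean M (\<lambda>\<omega>. \<Sum>i\<in>UNIV. \<bar>(if i then X k else (\<lambda>\<omega>. J k t \<omega> - Y \<omega>)) \<omega>\<bar>)) \<longlonglongrightarrow> 0"
    by (rule trunc_mean_sum_tendsto_0[where X="\<lambda>i k. if i then X k else (\<lambda>\<omega>. J k t \<omega> - Y \<omega>)" and I="UNIV :: bool set", OF _ _ lim])
      auto
  then have "(\<lambda>k. trunc_mean M (\<lambda>\<omega>. \<bar>X k \<omega>\<bar> + \<bar>J k t \<omega> - Y \<omega>\<bar>)) \<longlonglongrightarrow> 0"
    by (simp add: UNIV_bool add.commute)
  from trunc_mean_AE_subseq[OF _ this] obtain r :: "nat \<Rightarrow> nat" where
    r: "AE \<omega> in M. (\<lambda>k. \<bar>X (r k) \<omega>\<bar> + \<bar>J (r k) t \<omega> - Y \<omega>\<bar>) \<longlonglongrightarrow> 0" by auto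
  show ?thesis
  proof (rule that[of "\<lambda>k. h (r k)" "\<lambda>k. J (r k)"])
    show "elementary (h (r k)) (J (r k))" for k by (rule el)
    show "AE \<omega> in M. (\<lambda>k. J (r k) t \<omega>) \<longlonglongrightarrow> Y \<omega>"
      using r
    proof eventually_elim
      case (elim \<omega>)
      have "(\<lambda>k. J (r k) t \<omega> - Y \<omega>) \<longlonglongrightarrow> 0"
        by (rule Lim_null_comparison[OF _ elim]) simp
      then show ?case by (simp add: LIM_zero_iff)
    qed
    show "AE \<omega> in M. (\<lambda>k. \<integral>\<^sup>+ s\<in>{0..t}. ennreal ((h (r k) s \<omega> - H s \<omega>)\<^sup>2) \<partial>lborel) \<longlonglongrightarrow> 0"
      unfolding D_def[symmetric] using r
    proof eventually_elim
      case (elim \<omega>)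
      have X0: "(\<lambda>k. X (r k) \<omega>) \<longlonglongrightarrow> 0"
        by (rule Lim_null_comparison[OF _ elim]) simp
      then have "(\<lambda>k. ennreal (X (r k) \<omega>)) \<longlonglongrightarrow> ennreal 0" by (rule tendsto_ennrealI)
      moreover have "\<forall>\<^sub>F k in sequentially. ennreal (X (r k) \<omega>) = D (r k) \<omega>"
        using order_tendstoD(2)[OF X0, of 1]
      proof (rule eventually_mono)
        fix k assume "X (r k) \<omega> < 1"
        then have "ennreal (X (r k) \<omega>) < 1" by (simp add: ennreal_less_one_iff)
        then show "ennreal (X (r k) \<omega>) = D (r k) \<omega>" unfolding X by (auto simp: min_def split: if_splits)
      qed simp
      ultimately show ?case by (simp add: Lim_transform_eventually)
    qed
  qed
qed

text \<open>The definition of the integral picks its simple integrands for each end time separately,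
  so nothing links the integrals at two times directly. But two sequences of integrands that
  approach the same process on {0..s} have mutual distance tending to 0 there, and then so do their
  integrals at s. Hence one sequence chosen for [0, t] computes the integrals at all earlier times.
  With equal end times this is uniqueness of the integral.\<close>

lemma ito_subtime:
  assumes el: "\<And>k::nat. elementary (h k) (J k)"
    and D: "AE \<omega> in M. (\<lambda>k. \<integral>\<^sup>+ r\<in>{0..t}. ennreal ((h k r \<omega> - H r \<omega>)\<^sup>2) \<partial>lborel) \<longlonglongrightarrow> 0"
    and ito: "has_ito_integral M F W H' s Y" and s: "0 < s" "s \<le> t"
    and eq: "AE \<omega> in M. \<forall>r\<in>{0..s}. H r \<omega> = H' r \<omega>"
  shows "(\<lambda>k. trunc_mean M (\<lambda>\<omega>. (J k s \<omega> - Y \<omega>)\<^sup>2)) \<longlonglongrightarrow> 0"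
proof -
  obtain h' J' where el': "\<And>k::nat. elementary (h' k) (J' k)"
    and D': "AE \<omega> in M. (\<lambda>k. \<integral>\<^sup>+ r\<in>{0..s}. ennreal ((h' k r \<omega> - H' r \<omega>)\<^sup>2) \<partial>lborel) \<longlonglongrightarrow> 0"
    and J': "AE \<omega> in M. (\<lambda>k. J' k s \<omega>) \<longlonglongrightarrow> Y \<omega>"
    by (rule has_ito_integral_AE_seq[OF ito less_imp_le[OF s(1)]]) (rule that; assumption)
  have [measurable]: "J k s \<in> borel_measurable M" "J' k s \<in> borel_measurable M" for k
    using elementaryD(2)[OF el] elementaryD(2)[OF el'] s by auto
  have [measurable]: "Y \<in> borel_measurable M" using ito by (simp add: has_ito_integral_def)
  have Hp: "progressive F H'" using ito by (simp add: has_ito_integral_def)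
  define R where "R k \<omega> = integral {0..s} (\<lambda>r. (h k r \<omega> - h' k r \<omega>)\<^sup>2)" for k \<omega>
  have le: "R k \<in> borel_measurable M \<and> trunc_mean M (\<lambda>\<omega>. (J k s \<omega> - J' k s \<omega>)\<^sup>2) \<le> 3 * sqrt (trunc_mean M (R k))" for k
  proof -
    have g: "grid 0 s (Suc 0) (Suc 0) = s" using grid_end[of 1 0 s] by simp
    \<comment> \<open>One coarse cell, weight 1 and nothing subtracted: the inequality becomes a
      bound for the integral of h - h' over [0, s] by the truncated mean of its squared
      norm.\<close>
    note * = elementary_trunc_mean_le[OF elementary_diff[OF el[of k] el'[of k]] s(1), of 1 "\<lambda>_ _. 1" "\<lambda>_ _. 0"
      "\<lambda>i \<omega>. (J k (grid 0 s 1 (Suc i)) \<omega> - J' k (grid 0 s 1 (Suc i)) \<omega>) - (J k (grid 0 s 1 i) \<omega> - J' k (grid 0 s 1 i) \<omega>)" "R k"]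
    have R: "R k \<in> borel_measurable M" by (rule *(1)) (auto simp: R_def g)
    have "trunc_mean M (\<lambda>\<omega>. (J k s \<omega> - J' k s \<omega>)\<^sup>2) \<le> trunc_mean M (\<lambda>\<omega>. (J k s \<omega> - J' k s \<omega>)\<^sup>2 + (J k s \<omega> - J' k s \<omega>)\<^sup>2)"
      by (intro trunc_mean_mono AE_I2) auto
    also have "\<dots> \<le> 3 * sqrt (trunc_mean M (R k))"
      using *(2) by (simp add: R_def g elementaryD(5)[OF el] elementaryD(5)[OF el'])
    finally show ?thesis using R by simp
  qed
  have Rlim: "AE \<omega> in M. (\<lambda>k. R k \<omega>) \<longlonglongrightarrow> 0"
    using D D' eq AE_space
  proof eventually_elim
    case (elim \<omega>)
    note [measurable] = elementaryD(3)[OF el, of _ \<omega>] elementaryD(3)[OF el', of _ \<omega>]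
    have [measurable]: "(\<lambda>r. H' (max 0 (min s r)) \<omega>) \<in> borel_measurable borel"
      using measurable_compose[OF measurable_Pair2'[OF elim(4)] progressive_clamp_measurable[OF Hp less_imp_le[OF s(1)]]]
      by simp
    have bound: "ennreal (R k \<omega>) \<le> 2 * (\<integral>\<^sup>+ r\<in>{0..t}. ennreal ((h k r \<omega> - H r \<omega>)\<^sup>2) \<partial>lborel)
        + 2 * (\<integral>\<^sup>+ r\<in>{0..s}. ennreal ((h' k r \<omega> - H' r \<omega>)\<^sup>2) \<partial>lborel)" for k
    proof -
      obtain B where B: "\<And>r. \<bar>h k r \<omega> - h' k r \<omega>\<bar> \<le> B"
        using elementaryD(6)[OF elementary_diff[OF el[of k] el'[of k]] elim(4)] by blast
      have "ennreal (R k \<omega>) = (\<integral>\<^sup>+ r\<in>{0..s}. ennreal ((h k r \<omega> - h' k r \<omega>)\<^sup>2) \<partial>lborel)"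
        unfolding R_def
      proof (rule bounded_borel_integral(2)[symmetric, where B="B\<^sup>2"])
        fix r show "\<bar>(h k r \<omega> - h' k r \<omega>)\<^sup>2\<bar> \<le> B\<^sup>2"
          using power_mono[OF B[of r], of 2] by simp
      qed auto
      also have "\<dots> \<le> (\<integral>\<^sup>+ r. 2 * (ennreal ((h k r \<omega> - H' (max 0 (min s r)) \<omega>)\<^sup>2) * indicator {0..s} r)
          + 2 * (ennreal ((h' k r \<omega> - H' (max 0 (min s r)) \<omega>)\<^sup>2) * indicator {0..s} r) \<partial>lborel)"
      proof (rule nn_integral_mono)
        fix r
        have "(h k r \<omega> - h' k r \<omega>)\<^sup>2 \<le> 2 * (h k r \<omega> - H' (max 0 (min s r)) \<omega>)\<^sup>2 + 2 * (h' k r \<omega> - H' (max 0 (min s r)) \<omega>)\<^sup>2"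
          using square_sum_le_double[of "h k r \<omega> - H' (max 0 (min s r)) \<omega>" "H' (max 0 (min s r)) \<omega> - h' k r \<omega>"]
          by (simp add: power2_commute)
        then have "ennreal ((h k r \<omega> - h' k r \<omega>)\<^sup>2) \<le>
          ennreal (2 * (h k r \<omega> - H' (max 0 (min s r)) \<omega>)\<^sup>2 + 2 * (h' k r \<omega> - H' (max 0 (min s r)) \<omega>)\<^sup>2)"
          by (rule ennreal_leI)
        also have "\<dots> = 2 * ennreal ((h k r \<omega> - H' (max 0 (min s r)) \<omega>)\<^sup>2) + 2 * ennreal ((h' k r \<omega> - H' (max 0 (min s r)) \<omega>)\<^sup>2)"
          by (simp add: ennreal_plus ennreal_mult)
        finally show "ennreal ((h k r \<omega> - h' k r \<omega>)\<^sup>2) * indicator {0..s} r \<le>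
          2 * (ennreal ((h k r \<omega> - H' (max 0 (min s r)) \<omega>)\<^sup>2) * indicator {0..s} r)
          + 2 * (ennreal ((h' k r \<omega> - H' (max 0 (min s r)) \<omega>)\<^sup>2) * indicator {0..s} r)"
          by (auto simp: indicator_def)
      qed
      also have "\<dots> = 2 * (\<integral>\<^sup>+ r\<in>{0..s}. ennreal ((h k r \<omega> - H' (max 0 (min s r)) \<omega>)\<^sup>2) \<partial>lborel)
          + 2 * (\<integral>\<^sup>+ r\<in>{0..s}. ennreal ((h' k r \<omega> - H' (max 0 (min s r)) \<omega>)\<^sup>2) \<partial>lborel)"
        by (simp add: nn_integral_add nn_integral_cmult)
      also have "(\<integral>\<^sup>+ r\<in>{0..s}. ennreal ((h k r \<omega> - H' (max 0 (min s r)) \<omega>)\<^sup>2) \<partial>lborel)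
          \<le> (\<integral>\<^sup>+ r\<in>{0..t}. ennreal ((h k r \<omega> - H r \<omega>)\<^sup>2) \<partial>lborel)"
        using elim(3) s by (intro nn_integral_mono) (auto simp: indicator_def)
      also have "(\<integral>\<^sup>+ r\<in>{0..s}. ennreal ((h' k r \<omega> - H' (max 0 (min s r)) \<omega>)\<^sup>2) \<partial>lborel)
          = (\<integral>\<^sup>+ r\<in>{0..s}. ennreal ((h' k r \<omega> - H' r \<omega>)\<^sup>2) \<partial>lborel)"
        by (intro nn_integral_cong) (auto simp: indicator_def)
      finally show ?thesis by (simp add: add_mono mult_mono)
    qed
    have "(\<lambda>k. 2 * (\<integral>\<^sup>+ r\<in>{0..t}. ennreal ((h k r \<omega> - H r \<omega>)\<^sup>2) \<partial>lborel)
        + 2 * (\<integral>\<^sup>+ r\<in>{0..s}. ennreal ((h' k r \<omega> - H' r \<omega>)\<^sup>2) \<partial>lborel)) \<longlonglongrightarrow> 2 * 0 + 2 * 0"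
      by (intro tendsto_add ennreal_tendsto_cmult elim(1,2)) auto
    then have up: "(\<lambda>k. 2 * (\<integral>\<^sup>+ r\<in>{0..t}. ennreal ((h k r \<omega> - H r \<omega>)\<^sup>2) \<partial>lborel)
        + 2 * (\<integral>\<^sup>+ r\<in>{0..s}. ennreal ((h' k r \<omega> - H' r \<omega>)\<^sup>2) \<partial>lborel)) \<longlonglongrightarrow> 0" by simp
    have "(\<lambda>k. ennreal (R k \<omega>)) \<longlonglongrightarrow> 0"
      by (rule tendsto_sandwich[OF always_eventually always_eventually tendsto_const up]) (use bound in simp_all)
    moreover have "0 \<le> R k \<omega>" for k unfolding R_def
      by (cases "(\<lambda>r. (h k r \<omega> - h' k r \<omega>)\<^sup>2) integrable_on {0..s}")
        (auto intro: Henstock_Kurzweil_Integration.integral_nonneg simp: not_integrable_integral)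
    ultimately show ?case by (simp add: ennreal_tendsto_0_iff)
  qed
  show ?thesis
  proof (rule trunc_mean_square_triangle[where Y="\<lambda>k. J' k s"])
    have "(\<lambda>k. 3 * sqrt (trunc_mean M (R k))) \<longlonglongrightarrow> 3 * sqrt 0"
      using le by (intro tendsto_intros trunc_mean_AE_tendsto_0 Rlim) auto
    then have up: "(\<lambda>k. 3 * sqrt (trunc_mean M (R k))) \<longlonglongrightarrow> 0" by simp
    show "(\<lambda>k. trunc_mean M (\<lambda>\<omega>. (J k s \<omega> - J' k s \<omega>)\<^sup>2)) \<longlonglongrightarrow> 0"
      by (rule tendsto_sandwich[OF always_eventually always_eventually tendsto_const up])
        (use le trunc_mean_nonneg in auto)
    show "(\<lambda>k. trunc_mean M (\<lambda>\<omega>. (J' k s \<omega> - Y \<omega>)\<^sup>2)) \<longlonglongrightarrow> 0"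
    proof (rule trunc_mean_AE_tendsto_0)
      show "AE \<omega> in M. (\<lambda>k. (J' k s \<omega> - Y \<omega>)\<^sup>2) \<longlonglongrightarrow> 0"
        using J'
      proof eventually_elim
        case (elim \<omega>)
        then have "(\<lambda>k. (J' k s \<omega> - Y \<omega>)\<^sup>2) \<longlonglongrightarrow> (Y \<omega> - Y \<omega>)\<^sup>2" by (intro tendsto_intros)
        then show ?case by simp
      qed
    qed measurable
  qed measurable
qed

end

section \<open>Discretisation errors of Ito integrals\<close>

lemma tendsto_0_of_square: "(\<lambda>k. (x k)\<^sup>2) \<longlonglongrightarrow> 0 \<Longrightarrow> (x :: nat \<Rightarrow> real) \<longlonglongrightarrow> 0"
  using tendsto_real_sqrt[of "\<lambda>k. (x k)\<^sup>2" 0] by (simp add: tendsto_rabs_zero_iff)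

text \<open>Separates the error of approximating \<open>q\<close> by \<open>h\<close>, which
  vanishes on a fixed grid, from the error of freezing \<open>q\<close>, which vanishes only as the
  grid is refined.\<close>

lemma integral_square_perturbation_le:
  fixes h q :: "real \<Rightarrow> real"
  assumes uv: "0 \<le> u" "u \<le> v" "v \<le> T"
    and h: "h \<in> borel_measurable borel" "\<And>s. \<bar>h s\<bar> \<le> B" and q: "continuous_on {0..T} q"
  shows "integral {u..v} (\<lambda>s. (z * h s - c)\<^sup>2) \<le>
    2 * z\<^sup>2 * integral {0..T} (\<lambda>s. (h s - q s)\<^sup>2) + 2 * integral {u..v} (\<lambda>s. (z * q s - c)\<^sup>2)"
proof -
  obtain C where C: "\<And>s. s \<in> {0..T} \<Longrightarrow> \<bar>q s\<bar> \<le> C" using continuous_on_Icc_bounded[OF q] by blast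
  have "(\<lambda>s. indicator {0..T} s * q s) \<in> borel_measurable borel"
    using borel_measurable_continuous_on_indicator[OF _ q] by simp
  moreover have "(\<lambda>s. indicator {0..T} s * (h s - q s)\<^sup>2) = (\<lambda>s. indicator {0..T} s * (h s - indicator {0..T} s * q s)\<^sup>2)"
    by (auto simp: indicator_def)
  ultimately have m: "(\<lambda>s. indicator {0..T} s * (h s - q s)\<^sup>2) \<in> borel_measurable borel"
    using h(1) by simp
  have int: "(\<lambda>s. (h s - q s)\<^sup>2) integrable_on {0..T}"
  proof (rule bounded_borel_integral(1)[OF m, where B="(B + C)\<^sup>2"])
    fix s assume "s \<in> {0..T}"
    then have "\<bar>h s - q s\<bar> \<le> B + C" using h(2)[of s] C[of s] by linarith
    from power_mono[OF this, of 2] show "\<bar>(h s - q s)\<^sup>2\<bar> \<le> (B + C)\<^sup>2" by simp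
  qed
  have sub: "{u..v} \<subseteq> {0..T}" using uv by auto
  have int2: "(\<lambda>s. (h s - q s)\<^sup>2) integrable_on {u..v}"
    by (rule integrable_subinterval_real[OF int sub])
  have cq: "(\<lambda>s. (z * q s - c)\<^sup>2) integrable_on {u..v}"
    by (intro integrable_continuous_real continuous_intros continuous_on_subset[OF q sub])
  have ch: "(\<lambda>s. (z * h s - c)\<^sup>2) integrable_on {u..v}"
  proof (rule bounded_borel_integral(1)[where B="(\<bar>z\<bar> * B + \<bar>c\<bar>)\<^sup>2"])
    show "(\<lambda>s. indicator {u..v} s * (z * h s - c)\<^sup>2) \<in> borel_measurable borel" using h(1) by simp
    fix s
    have "\<bar>z * h s - c\<bar> \<le> \<bar>z * h s\<bar> + \<bar>c\<bar>" by (rule abs_triangle_ineq4)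
    also have "\<bar>z * h s\<bar> \<le> \<bar>z\<bar> * B" unfolding abs_mult by (intro mult_left_mono h) auto
    finally have "\<bar>z * h s - c\<bar> \<le> \<bar>z\<bar> * B + \<bar>c\<bar>" by simp
    from power_mono[OF this, of 2] show "\<bar>(z * h s - c)\<^sup>2\<bar> \<le> (\<bar>z\<bar> * B + \<bar>c\<bar>)\<^sup>2" by simp
  qed
  have "integral {u..v} (\<lambda>s. (z * h s - c)\<^sup>2) \<le> integral {u..v} (\<lambda>s. 2 * z\<^sup>2 * (h s - q s)\<^sup>2 + 2 * (z * q s - c)\<^sup>2)"
  proof (rule integral_le[OF ch])
    show "(\<lambda>s. 2 * z\<^sup>2 * (h s - q s)\<^sup>2 + 2 * (z * q s - c)\<^sup>2) integrable_on {u..v}"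
      by (intro integrable_add integrable_on_mult_right int2 cq)
    fix s
    have "(z * h s - c)\<^sup>2 = (z * (h s - q s) + (z * q s - c))\<^sup>2" by (simp add: algebra_simps)
    also have "\<dots> \<le> 2 * (z * (h s - q s))\<^sup>2 + 2 * (z * q s - c)\<^sup>2" by (rule square_sum_le_double)
    finally show "(z * h s - c)\<^sup>2 \<le> 2 * z\<^sup>2 * (h s - q s)\<^sup>2 + 2 * (z * q s - c)\<^sup>2"
      by (simp add: power_mult_distrib)
  qed
  also have "\<dots> = 2 * z\<^sup>2 * integral {u..v} (\<lambda>s. (h s - q s)\<^sup>2) + 2 * integral {u..v} (\<lambda>s. (z * q s - c)\<^sup>2)"
    by (subst Henstock_Kurzweil_Integration.integral_add)
      (auto intro!: integrable_on_mult_right int2 cq)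
  also have "integral {u..v} (\<lambda>s. (h s - q s)\<^sup>2) \<le> integral {0..T} (\<lambda>s. (h s - q s)\<^sup>2)"
    by (rule integral_subset_le[OF sub int2 int]) simp
  finally show ?thesis by (simp add: mult_left_mono)
qed

text \<open>Expanding the square gives three left sums, with limits equal to 1, -2 and 1 times the
  integral of b^2; they cancel.\<close>

lemma left_freezing_error_tendsto_0:
  fixes p b :: "real \<Rightarrow> real"
  assumes T: "T > 0" and p: "continuous_on {0..T} p" "\<And>t. t \<in> {0..T} \<Longrightarrow> p t \<noteq> 0" and b: "continuous_on {0..T} b"
  shows "(\<lambda>N. \<Sum>i<N. integral {grid 0 T N i..grid 0 T N (Suc i)}
    (\<lambda>s. (1 / p (grid 0 T N i) * (p s * b s) - b (grid 0 T N i))\<^sup>2)) \<longlonglongrightarrow> 0"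
proof -
  define q where "q s = p s * b s" for s
  have q: "continuous_on {0..T} q" unfolding q_def by (intro continuous_intros p b)
  define t where "t N i = grid 0 T N i" for N i
  have split: "(\<Sum>i<N. integral {t N i..t N (Suc i)} (\<lambda>s. (1 / p (t N i) * q s - b (t N i))\<^sup>2)) =
    (\<Sum>i<N. (1 / p (t N i))\<^sup>2 * integral {t N i..t N (Suc i)} (\<lambda>s. (q s)\<^sup>2))
    + (\<Sum>i<N. (- 2 * b (t N i) / p (t N i)) * integral {t N i..t N (Suc i)} q)
    + (\<Sum>i<N. (b (t N i))\<^sup>2 * integral {t N i..t N (Suc i)} (\<lambda>_. 1))" for N
    unfolding sum.distrib[symmetric]
  proof (rule sum.cong[OF refl])
    fix i assume "i \<in> {..<N}"
    then have sub: "{t N i..t N (Suc i)} \<subseteq> {0..T}"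
      using grid_ge[of 0 T N i] grid_le[of 0 T "Suc i" N] T by (auto simp: t_def)
    note cq = continuous_on_subset[OF q sub]
    have "(\<lambda>s. (1 / p (t N i) * q s - b (t N i))\<^sup>2) =
      (\<lambda>s. ((1 / p (t N i))\<^sup>2 * (q s)\<^sup>2 + (- 2 * b (t N i) / p (t N i)) * q s) + (b (t N i))\<^sup>2 * 1)"
      by (rule ext) (simp add: power2_diff power_divide)
    moreover have "integral {t N i..t N (Suc i)} (\<lambda>s. ((1 / p (t N i))\<^sup>2 * (q s)\<^sup>2 + (- 2 * b (t N i) / p (t N i)) * q s) + (b (t N i))\<^sup>2 * 1)
      = (integral {t N i..t N (Suc i)} (\<lambda>s. (1 / p (t N i))\<^sup>2 * (q s)\<^sup>2) + integral {t N i..t N (Suc i)} (\<lambda>s. (- 2 * b (t N i) / p (t N i)) * q s))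
        + integral {t N i..t N (Suc i)} (\<lambda>s. (b (t N i))\<^sup>2 * 1)"
    proof -
      have i1: "(\<lambda>s. (1 / p (t N i))\<^sup>2 * (q s)\<^sup>2) integrable_on {t N i..t N (Suc i)}"
        by (intro integrable_continuous_real continuous_intros cq)
      have i2: "(\<lambda>s. (- 2 * b (t N i) / p (t N i)) * q s) integrable_on {t N i..t N (Suc i)}"
        by (intro integrable_continuous_real continuous_on_mult continuous_on_const cq)
      have i3: "(\<lambda>s. (b (t N i))\<^sup>2 * 1) integrable_on {t N i..t N (Suc i)}" by (rule integrable_const_ivl)
      show ?thesis
        by (simp only: Henstock_Kurzweil_Integration.integral_add[OF integrable_add[OF i1 i2] i3]
            Henstock_Kurzweil_Integration.integral_add[OF i1 i2])
    qed
    ultimately show "integral {t N i..t N (Suc i)} (\<lambda>s. (1 / p (t N i) * q s - b (t N i))\<^sup>2) =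
      (1 / p (t N i))\<^sup>2 * integral {t N i..t N (Suc i)} (\<lambda>s. (q s)\<^sup>2)
      + (- 2 * b (t N i) / p (t N i)) * integral {t N i..t N (Suc i)} q
      + (b (t N i))\<^sup>2 * integral {t N i..t N (Suc i)} (\<lambda>_. 1)"
      by (simp only: Henstock_Kurzweil_Integration.integral_mult_right)
  qed
  have "(\<lambda>N. (\<Sum>i<N. (1 / p (t N i))\<^sup>2 * integral {t N i..t N (Suc i)} (\<lambda>s. (q s)\<^sup>2))
    + (\<Sum>i<N. (- 2 * b (t N i) / p (t N i)) * integral {t N i..t N (Suc i)} q)
    + (\<Sum>i<N. (b (t N i))\<^sup>2 * integral {t N i..t N (Suc i)} (\<lambda>_. 1))) \<longlonglongrightarrow>
    integral {0..T} (\<lambda>s. (1 / p s)\<^sup>2 * (q s)\<^sup>2) + integral {0..T} (\<lambda>s. (- 2 * b s / p s) * q s)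
    + integral {0..T} (\<lambda>s. (b s)\<^sup>2 * 1)"
    unfolding t_def using p(2)
    by (intro tendsto_add left_sum_tendsto_continuous[OF T, where \<phi>="\<lambda>s. (1 / p s)\<^sup>2" and f="\<lambda>s. (q s)\<^sup>2"]
        left_sum_tendsto_continuous[OF T, where \<phi>="\<lambda>s. - 2 * b s / p s" and f=q]
        left_sum_tendsto_continuous[OF T, where \<phi>="\<lambda>s. (b s)\<^sup>2" and f="\<lambda>_. 1"] continuous_intros q p b) auto
  also have "integral {0..T} (\<lambda>s. (1 / p s)\<^sup>2 * (q s)\<^sup>2) = integral {0..T} (\<lambda>s. (b s)\<^sup>2)"
    using p(2) by (intro integral_cong) (simp add: q_def power_mult_distrib power_divide)
  also have "integral {0..T} (\<lambda>s. (- 2 * b s / p s) * q s) = integral {0..T} (\<lambda>s. (- 2) * (b s)\<^sup>2)"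
    using p(2) by (intro integral_cong) (simp add: q_def power2_eq_square)
  finally have "(\<lambda>N. \<Sum>i<N. integral {t N i..t N (Suc i)} (\<lambda>s. (1 / p (t N i) * q s - b (t N i))\<^sup>2)) \<longlonglongrightarrow> 0"
    unfolding split by (simp add: Henstock_Kurzweil_Integration.integral_mult_right)
  then show ?thesis by (simp add: t_def q_def)
qed

lemma (in prob_space) integral_measurable:
  fixes f :: "real \<Rightarrow> 'a \<Rightarrow> real"
  assumes "u < v" and f: "\<And>s. s \<in> {u..v} \<Longrightarrow> f s \<in> borel_measurable M"
    and c: "\<And>\<omega>. \<omega> \<in> space M \<Longrightarrow> continuous_on {u..v} (\<lambda>s. f s \<omega>)"
  shows "(\<lambda>\<omega>. integral {u..v} (\<lambda>s. f s \<omega>)) \<in> borel_measurable M"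
proof (rule borel_measurable_LIMSEQ_real)
  fix \<omega> assume "\<omega> \<in> space M"
  then show "(\<lambda>l. \<Sum>i<l. f (grid u v l i) \<omega> * ((v - u) / real l)) \<longlonglongrightarrow> integral {u..v} (\<lambda>s. f s \<omega>)"
    by (intro left_riemann_sum_continuous assms c)
next
  fix l
  have "(\<lambda>\<omega>. f (grid u v l i) \<omega> * ((v - u) / real l)) \<in> borel_measurable M" if "i < l" for i
    using assms(1) that by (intro borel_measurable_times f) (auto intro: grid_ge grid_le)
  then show "(\<lambda>\<omega>. \<Sum>i<l. f (grid u v l i) \<omega> * ((v - u) / real l)) \<in> borel_measurable M"
    by (intro borel_measurable_sum) simp
qed

context brownian
begin

text \<open>The grid is fixed while elementary integrands approach \<open>H\<close> on [0, T], with
  weights 1 / p and \<open>b\<close> in \<open>elementary_trunc_mean_le\<close>. Along a common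
  subsequence their integrals tend to \<open>Y\<close> at the finitely many grid points, and their
  accumulated variances are asymptotically at most 2 * R, the factor being the price of splitting a
  square. No moment of \<open>H\<close> enters.\<close>

lemma ito_increment_error_bound:
  fixes p b Y :: "real \<Rightarrow> 'a \<Rightarrow> real"
  assumes T: "T > 0" and N: "N > 0"
    and p: "\<And>t. 0 \<le> t \<Longrightarrow> p t \<in> borel_measurable (F t)" "\<And>\<omega>. \<omega> \<in> space M \<Longrightarrow> continuous_on {0..} (\<lambda>t. p t \<omega>)"
    and b: "\<And>t. 0 \<le> t \<Longrightarrow> b t \<in> borel_measurable (F t)" "\<And>\<omega>. \<omega> \<in> space M \<Longrightarrow> continuous_on {0..} (\<lambda>t. b t \<omega>)"
    and H: "AE \<omega> in M. \<forall>t\<in>{0..T}. H t \<omega> = p t \<omega> * b t \<omega>"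
    and ito: "\<And>t. 0 \<le> t \<Longrightarrow> has_ito_integral M F W H t (Y t)" and Y0: "\<And>\<omega>. \<omega> \<in> space M \<Longrightarrow> Y 0 \<omega> = 0"
    and e_def: "\<And>i \<omega>. e i \<omega> = (Y (grid 0 T N (Suc i)) \<omega> - Y (grid 0 T N i) \<omega>) / p (grid 0 T N i) \<omega>
        - b (grid 0 T N i) \<omega> * (W (grid 0 T N (Suc i)) \<omega> - W (grid 0 T N i) \<omega>)"
    and R_def: "\<And>\<omega>. R \<omega> = (\<Sum>i<N. integral {grid 0 T N i..grid 0 T N (Suc i)}
        (\<lambda>s. (1 / p (grid 0 T N i) \<omega> * (p s \<omega> * b s \<omega>) - b (grid 0 T N i) \<omega>)\<^sup>2))"
  shows "R \<in> borel_measurable M" and "e i \<in> borel_measurable M"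
    and "trunc_mean M (\<lambda>\<omega>. (\<Sum>i<N. e i \<omega>)\<^sup>2 + (\<Sum>i<N. (e i \<omega>)\<^sup>2)) \<le> 3 * sqrt (trunc_mean M (\<lambda>\<omega>. 2 * R \<omega>))"
proof -
  define t where "t i = grid 0 T N i" for i
  have t0: "0 \<le> t i" "t i < t (Suc i)" for i
    using T N grid_ge[of 0 T N i] by (auto simp: t_def grid_Suc)
  have tT: "t i \<le> T" if "i \<le> N" for i using that T by (auto simp: t_def intro: grid_le)
  have pM: "p s \<in> borel_measurable M" and bM: "b s \<in> borel_measurable M" if "0 \<le> s" for s
    using M_measurable p(1) b(1) that by blast+
  have YM: "Y s \<in> borel_measurable M" if "0 \<le> s" for s using ito[OF that] by (simp add: has_ito_integral_def)
  note [measurable] = pM[OF t0(1)] bM[OF t0(1)] YM[OF t0(1)] W_measurable[OF t0(1)]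
  show e_meas [measurable]: "e i \<in> borel_measurable M" for i
    unfolding e_def[abs_def] t_def[symmetric] by measurable
  show R_meas [measurable]: "R \<in> borel_measurable M"
    unfolding R_def[abs_def] t_def[symmetric]
  proof (rule borel_measurable_sum)
    fix i
    show "(\<lambda>\<omega>. integral {t i..t (Suc i)} (\<lambda>s. (1 / p (t i) \<omega> * (p s \<omega> * b s \<omega>) - b (t i) \<omega>)\<^sup>2)) \<in> borel_measurable M"
    proof (rule integral_measurable[OF t0(2)])
      fix s assume "s \<in> {t i..t (Suc i)}"
      then have "0 \<le> s" using t0(1)[of i] by simp
      note [measurable] = pM[OF this] bM[OF this]
      show "(\<lambda>\<omega>. (1 / p (t i) \<omega> * (p s \<omega> * b s \<omega>) - b (t i) \<omega>)\<^sup>2) \<in> borel_measurable M" by measurable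
    next
      fix \<omega> assume \<omega>: "\<omega> \<in> space M"
      show "continuous_on {t i..t (Suc i)} (\<lambda>s. (1 / p (t i) \<omega> * (p s \<omega> * b s \<omega>) - b (t i) \<omega>)\<^sup>2)"
        by (intro continuous_intros continuous_on_subset[OF p(2)[OF \<omega>]] continuous_on_subset[OF b(2)[OF \<omega>]])
          (use t0(1)[of i] in auto)
    qed
  qed
  obtain h J where el: "\<And>k::nat. elementary (h k) (J k)"
    and D: "AE \<omega> in M. (\<lambda>k. \<integral>\<^sup>+ r\<in>{0..T}. ennreal ((h k r \<omega> - H r \<omega>)\<^sup>2) \<partial>lborel) \<longlonglongrightarrow> 0"
    by (rule has_ito_integral_AE_seq[OF ito[OF less_imp_le[OF T]] less_imp_le[OF T]]) (rule that; assumption)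
  have JM [measurable]: "J k (t i) \<in> borel_measurable M" for k i by (rule elementaryD(2)[OF el t0(1)])
  have "(\<lambda>k. trunc_mean M (\<lambda>\<omega>. (J k (t i) \<omega> - Y (t i) \<omega>)\<^sup>2)) \<longlonglongrightarrow> 0" if i: "i \<le> N" for i
  \<comment> \<open>\<open>ito_subtime\<close> asks for a positive time; at time 0 both integrals
    vanish.\<close>
  proof (cases "t i = 0")
    case True
    have "trunc_mean M (\<lambda>\<omega>. (J k (t i) \<omega> - Y (t i) \<omega>)\<^sup>2) = 0" for k
      unfolding trunc_mean_def True using Y0 by (subst Bochner_Integration.integral_cong[OF refl, of _ _ "\<lambda>_. 0"])
        (auto simp: elementaryD(5)[OF el])
    then show ?thesis by simp
  next
    case False
    then show ?thesis using t0(1)[of i] tT[OF i]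
      by (intro ito_subtime[OF el D ito]) auto
  qed
  then have "(\<lambda>k. trunc_mean M (\<lambda>\<omega>. \<Sum>i\<in>{..N}. \<bar>(J k (t i) \<omega> - Y (t i) \<omega>)\<^sup>2\<bar>)) \<longlonglongrightarrow> 0"
    by (intro trunc_mean_sum_tendsto_0[where X="\<lambda>i k \<omega>. (J k (t i) \<omega> - Y (t i) \<omega>)\<^sup>2"]) auto
  from trunc_mean_AE_subseq[OF _ this] obtain r :: "nat \<Rightarrow> nat" where r: "strict_mono r"
    "AE \<omega> in M. (\<lambda>k. \<Sum>i\<in>{..N}. \<bar>(J (r k) (t i) \<omega> - Y (t i) \<omega>)\<^sup>2\<bar>) \<longlonglongrightarrow> 0" by auto
  have Jlim: "AE \<omega> in M. \<forall>i\<le>N. (\<lambda>k. J (r k) (t i) \<omega>) \<longlonglongrightarrow> Y (t i) \<omega>"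
    using r(2)
  proof eventually_elim
    case (elim \<omega>)
    show ?case
    proof safe
      fix i assume i: "i \<le> N"
      have "(\<lambda>k. (J (r k) (t i) \<omega> - Y (t i) \<omega>)\<^sup>2) \<longlonglongrightarrow> 0"
        by (rule Lim_null_comparison[OF always_eventually elim])
          (use i in \<open>auto intro!: member_le_sum[where f="\<lambda>i. (J (r _) (t i) \<omega> - Y (t i) \<omega>)\<^sup>2"]\<close>)
      then have "(\<lambda>k. J (r k) (t i) \<omega> - Y (t i) \<omega>) \<longlonglongrightarrow> 0" by (rule tendsto_0_of_square)
      then show "(\<lambda>k. J (r k) (t i) \<omega>) \<longlonglongrightarrow> Y (t i) \<omega>" by (simp add: LIM_zero_iff)
    qed
  qed
  define E where "E k i \<omega> = 1 / p (t i) \<omega> * (J (r k) (t (Suc i)) \<omega> - J (r k) (t i) \<omega>)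
      - b (t i) \<omega> * (W (t (Suc i)) \<omega> - W (t i) \<omega>)" for k i \<omega>
  define V where "V k \<omega> = (\<Sum>i<N. integral {t i..t (Suc i)} (\<lambda>s. (1 / p (t i) \<omega> * h (r k) s \<omega> - b (t i) \<omega>)\<^sup>2))" for k \<omega>
  have ZF: "(\<lambda>\<omega>. 1 / p (t i) \<omega>) \<in> borel_measurable (F (t i))" for i
    by (intro borel_measurable_divide p(1) t0 borel_measurable_const)
  note key = elementary_trunc_mean_le[OF el T N, where Z="\<lambda>i \<omega>. 1 / p (t i) \<omega>" and b="\<lambda>i. b (t i)", folded t_def, OF ZF b(1)[OF t0(1)]]
  have V [measurable]: "V k \<in> borel_measurable M" for k
    by (rule key(1)) (auto simp: V_def)
  have EV: "trunc_mean M (\<lambda>\<omega>. (\<Sum>i<N. E k i \<omega>)\<^sup>2 + (\<Sum>i<N. (E k i \<omega>)\<^sup>2)) \<le> 3 * sqrt (trunc_mean M (V k))" for k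
    by (rule key(2)) (auto simp: V_def E_def)
  have E [measurable]: "E k i \<in> borel_measurable M" for k i unfolding E_def by measurable
  \<comment> \<open>Only an upper bound for \<open>V\<close> in terms of 2 * R is available, not a
    limit, so the positive part of the excess is shown to vanish.\<close>
  define X where "X k \<omega> = max 0 (V k \<omega> - 2 * R \<omega>)" for k \<omega>
  have [measurable]: "X k \<in> borel_measurable M" for k unfolding X_def by measurable
  have Xlim: "AE \<omega> in M. (\<lambda>k. X k \<omega>) \<longlonglongrightarrow> 0"
    using D H AE_space
  proof eventually_elim
    case (elim \<omega>)
    define q where "q s = p s \<omega> * b s \<omega>" for s
    have q: "continuous_on {0..T} q" unfolding q_def
      by (intro continuous_intros continuous_on_subset[OF p(2)[OF elim(3)]] continuous_on_subset[OF b(2)[OF elim(3)]]) auto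
    define I where "I k = integral {0..T} (\<lambda>s. (h k s \<omega> - q s)\<^sup>2)" for k
    obtain C where C: "\<And>s. s \<in> {0..T} \<Longrightarrow> \<bar>q s\<bar> \<le> C" using continuous_on_Icc_bounded[OF q] by blast
    have qm: "(\<lambda>s. indicator {0..T} s * q s) \<in> borel_measurable borel"
      using borel_measurable_continuous_on_indicator[OF _ q] by simp
    have Ieq: "ennreal (I k) = (\<integral>\<^sup>+ s\<in>{0..T}. ennreal ((h k s \<omega> - H s \<omega>)\<^sup>2) \<partial>lborel)" for k
    proof -
      obtain B where B: "\<And>s. \<bar>h k s \<omega>\<bar> \<le> B" using elementaryD(6)[OF el elim(3)] by blast
      have "(\<lambda>s. indicator {0..T} s * (h k s \<omega> - q s)\<^sup>2) = (\<lambda>s. indicator {0..T} s * (h k s \<omega> - indicator {0..T} s * q s)\<^sup>2)"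
        by (auto simp: indicator_def)
      with qm elementaryD(3)[OF el, of k \<omega>] have m: "(\<lambda>s. indicator {0..T} s * (h k s \<omega> - q s)\<^sup>2) \<in> borel_measurable borel"
        by simp
      have "ennreal (I k) = (\<integral>\<^sup>+ s\<in>{0..T}. ennreal ((h k s \<omega> - q s)\<^sup>2) \<partial>lborel)"
        unfolding I_def
      proof (rule bounded_borel_integral(2)[OF m, where B="(B + C)\<^sup>2", symmetric])
        fix s assume "s \<in> {0..T}"
        then have "\<bar>h k s \<omega> - q s\<bar> \<le> B + C" using B[of s] C[of s] by linarith
        from power_mono[OF this, of 2] show "\<bar>(h k s \<omega> - q s)\<^sup>2\<bar> \<le> (B + C)\<^sup>2" by simp
      qed simp
      also have "\<dots> = (\<integral>\<^sup>+ s\<in>{0..T}. ennreal ((h k s \<omega> - H s \<omega>)\<^sup>2) \<partial>lborel)"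
        using elim(2) by (intro nn_integral_cong) (auto simp: indicator_def q_def)
      finally show ?thesis .
    qed
    have I0: "0 \<le> I k" for k unfolding I_def
      by (cases "(\<lambda>s. (h k s \<omega> - q s)\<^sup>2) integrable_on {0..T}")
        (auto intro: Henstock_Kurzweil_Integration.integral_nonneg simp: not_integrable_integral)
    have "I \<longlonglongrightarrow> 0" using elim(1) I0 unfolding Ieq[symmetric] by (simp add: ennreal_tendsto_0_iff)
    then have "(\<lambda>k. (\<Sum>i<N. 2 * (1 / p (t i) \<omega>)\<^sup>2) * I (r k)) \<longlonglongrightarrow> (\<Sum>i<N. 2 * (1 / p (t i) \<omega>)\<^sup>2) * 0"
      by (intro tendsto_mult tendsto_const strict_mono_compose_tendsto[OF r(1)])
    then have up: "(\<lambda>k. (\<Sum>i<N. 2 * (1 / p (t i) \<omega>)\<^sup>2) * I (r k)) \<longlonglongrightarrow> 0" by simp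
    have "V k \<omega> \<le> (\<Sum>i<N. 2 * (1 / p (t i) \<omega>)\<^sup>2) * I (r k) + 2 * R \<omega>" for k
    proof -
      obtain B where B: "\<And>s. \<bar>h (r k) s \<omega>\<bar> \<le> B" using elementaryD(6)[OF el elim(3)] by blast
      have "V k \<omega> \<le> (\<Sum>i<N. 2 * (1 / p (t i) \<omega>)\<^sup>2 * I (r k) + 2 * integral {t i..t (Suc i)} (\<lambda>s. (1 / p (t i) \<omega> * q s - b (t i) \<omega>)\<^sup>2))"
        unfolding V_def I_def
      proof (rule sum_mono)
        fix i assume "i \<in> {..<N}"
        then have "0 \<le> t i" "t i \<le> t (Suc i)" "t (Suc i) \<le> T" using t0[of i] tT[of "Suc i"] by auto
        then show "integral {t i..t (Suc i)} (\<lambda>s. (1 / p (t i) \<omega> * h (r k) s \<omega> - b (t i) \<omega>)\<^sup>2)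
          \<le> 2 * (1 / p (t i) \<omega>)\<^sup>2 * integral {0..T} (\<lambda>s. (h (r k) s \<omega> - q s)\<^sup>2)
            + 2 * integral {t i..t (Suc i)} (\<lambda>s. (1 / p (t i) \<omega> * q s - b (t i) \<omega>)\<^sup>2)"
          by (rule integral_square_perturbation_le[OF _ _ _ elementaryD(3)[OF el] B q])
      qed
      also have "\<dots> = (\<Sum>i<N. 2 * (1 / p (t i) \<omega>)\<^sup>2) * I (r k) + 2 * R \<omega>"
        by (simp only: sum.distrib sum_distrib_left sum_distrib_right R_def t_def[symmetric] q_def)
      finally show ?thesis .
    qed
    moreover have "0 \<le> (\<Sum>i<N. 2 * (1 / p (t i) \<omega>)\<^sup>2) * I (r k)" for k
      using I0 by (intro mult_nonneg_nonneg sum_nonneg) auto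
    ultimately have "norm (X k \<omega>) \<le> (\<Sum>i<N. 2 * (1 / p (t i) \<omega>)\<^sup>2) * I (r k)" for k
      unfolding X_def by (simp add: algebra_simps)
    then show ?case by (intro Lim_null_comparison[OF always_eventually up]) simp
  qed
  have V0: "0 \<le> V k \<omega>" for k \<omega> unfolding V_def
  proof (rule sum_nonneg)
    fix i show "0 \<le> integral {t i..t (Suc i)} (\<lambda>s. (1 / p (t i) \<omega> * h (r k) s \<omega> - b (t i) \<omega>)\<^sup>2)"
      by (cases "(\<lambda>s. (1 / p (t i) \<omega> * h (r k) s \<omega> - b (t i) \<omega>)\<^sup>2) integrable_on {t i..t (Suc i)}")
        (auto intro: Henstock_Kurzweil_Integration.integral_nonneg simp: not_integrable_integral)
  qed
  have VX: "trunc_mean M (V k) \<le> trunc_mean M (X k) + trunc_mean M (\<lambda>\<omega>. 2 * R \<omega>)" for k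
  proof -
    have "trunc_mean M (V k) \<le> trunc_mean M (\<lambda>\<omega>. X k \<omega> + 2 * R \<omega>)"
    proof (intro trunc_mean_mono AE_I2)
      fix \<omega> show "\<bar>V k \<omega>\<bar> \<le> \<bar>X k \<omega> + 2 * R \<omega>\<bar>" using V0[of k \<omega>] by (simp add: X_def)
    qed measurable
    also have "\<dots> \<le> trunc_mean M (X k) + trunc_mean M (\<lambda>\<omega>. 2 * R \<omega>)" by (rule trunc_mean_add) measurable
    finally show ?thesis .
  qed
  have up: "(\<lambda>k. 3 * sqrt (trunc_mean M (X k) + trunc_mean M (\<lambda>\<omega>. 2 * R \<omega>))) \<longlonglongrightarrow> 3 * sqrt (0 + trunc_mean M (\<lambda>\<omega>. 2 * R \<omega>))"
    by (intro tendsto_intros trunc_mean_AE_tendsto_0 Xlim) measurable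
  have lim: "(\<lambda>k. trunc_mean M (\<lambda>\<omega>. (\<Sum>i<N. E k i \<omega>)\<^sup>2 + (\<Sum>i<N. (E k i \<omega>)\<^sup>2)))
    \<longlonglongrightarrow> trunc_mean M (\<lambda>\<omega>. (\<Sum>i<N. e i \<omega>)\<^sup>2 + (\<Sum>i<N. (e i \<omega>)\<^sup>2))"
  proof (rule trunc_mean_AE_tendsto)
    show "AE \<omega> in M. (\<lambda>k. (\<Sum>i<N. E k i \<omega>)\<^sup>2 + (\<Sum>i<N. (E k i \<omega>)\<^sup>2)) \<longlonglongrightarrow> (\<Sum>i<N. e i \<omega>)\<^sup>2 + (\<Sum>i<N. (e i \<omega>)\<^sup>2)"
      using Jlim
    proof eventually_elim
      case (elim \<omega>)
      have "(\<lambda>k. E k i \<omega>) \<longlonglongrightarrow> 1 / p (t i) \<omega> * (Y (t (Suc i)) \<omega> - Y (t i) \<omega>) - b (t i) \<omega> * (W (t (Suc i)) \<omega> - W (t i) \<omega>)" if "i < N" for i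
        unfolding E_def using elim that by (intro tendsto_diff tendsto_mult tendsto_const) auto
      then have "(\<lambda>k. E k i \<omega>) \<longlonglongrightarrow> e i \<omega>" if "i < N" for i
        using that by (simp add: e_def t_def)
      then show ?case by (intro tendsto_add tendsto_power tendsto_sum) auto
    qed
  qed measurable
  have "trunc_mean M (\<lambda>\<omega>. (\<Sum>i<N. e i \<omega>)\<^sup>2 + (\<Sum>i<N. (e i \<omega>)\<^sup>2)) \<le> 3 * sqrt (0 + trunc_mean M (\<lambda>\<omega>. 2 * R \<omega>))"
  proof (rule LIMSEQ_le[OF lim up], intro exI allI impI)
    fix k
    show "trunc_mean M (\<lambda>\<omega>. (\<Sum>i<N. E k i \<omega>)\<^sup>2 + (\<Sum>i<N. (E k i \<omega>)\<^sup>2))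
      \<le> 3 * sqrt (trunc_mean M (X k) + trunc_mean M (\<lambda>\<omega>. 2 * R \<omega>))"
      by (rule order_trans[OF EV]) (simp add: VX)
  qed
  then show "trunc_mean M (\<lambda>\<omega>. (\<Sum>i<N. e i \<omega>)\<^sup>2 + (\<Sum>i<N. (e i \<omega>)\<^sup>2)) \<le> 3 * sqrt (trunc_mean M (\<lambda>\<omega>. 2 * R \<omega>))"
    by simp
qed

lemma ito_increment_errors_tendsto_0:
  fixes p b Y :: "real \<Rightarrow> 'a \<Rightarrow> real"
  assumes T: "T > 0"
    and p: "\<And>t. 0 \<le> t \<Longrightarrow> p t \<in> borel_measurable (F t)" "\<And>\<omega>. \<omega> \<in> space M \<Longrightarrow> continuous_on {0..} (\<lambda>t. p t \<omega>)"
    and b: "\<And>t. 0 \<le> t \<Longrightarrow> b t \<in> borel_measurable (F t)" "\<And>\<omega>. \<omega> \<in> space M \<Longrightarrow> continuous_on {0..} (\<lambda>t. b t \<omega>)"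
    and H: "AE \<omega> in M. \<forall>t\<in>{0..T}. p t \<omega> \<noteq> 0 \<and> H t \<omega> = p t \<omega> * b t \<omega>"
    and ito: "\<And>t. 0 \<le> t \<Longrightarrow> has_ito_integral M F W H t (Y t)" and Y0: "\<And>\<omega>. \<omega> \<in> space M \<Longrightarrow> Y 0 \<omega> = 0"
    and e_def: "\<And>N i \<omega>. e N i \<omega> = (Y (grid 0 T N (Suc i)) \<omega> - Y (grid 0 T N i) \<omega>) / p (grid 0 T N i) \<omega>
        - b (grid 0 T N i) \<omega> * (W (grid 0 T N (Suc i)) \<omega> - W (grid 0 T N i) \<omega>)"
  shows "e (Suc N) i \<in> borel_measurable M"
    and "(\<lambda>N. trunc_mean M (\<lambda>\<omega>. (\<Sum>i<Suc N. e (Suc N) i \<omega>)\<^sup>2 + (\<Sum>i<Suc N. (e (Suc N) i \<omega>)\<^sup>2))) \<longlonglongrightarrow> 0"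
proof -
  define R where "R N \<omega> = (\<Sum>i<N. integral {grid 0 T N i..grid 0 T N (Suc i)}
        (\<lambda>s. (1 / p (grid 0 T N i) \<omega> * (p s \<omega> * b s \<omega>) - b (grid 0 T N i) \<omega>)\<^sup>2))" for N \<omega>
  have H': "AE \<omega> in M. \<forall>t\<in>{0..T}. H t \<omega> = p t \<omega> * b t \<omega>" using H by eventually_elim auto
  note bound = ito_increment_error_bound[where R="R (Suc N)" and e="e (Suc N)" and N="Suc N" for N, OF T zero_less_Suc p b H' ito Y0]
  have R [measurable]: "R (Suc N) \<in> borel_measurable M" for N
    by (rule bound(1)) (auto simp: e_def R_def)
  show "e (Suc N) i \<in> borel_measurable M" by (rule bound(2)) (auto simp: e_def R_def)
  have le: "trunc_mean M (\<lambda>\<omega>. (\<Sum>i<Suc N. e (Suc N) i \<omega>)\<^sup>2 + (\<Sum>i<Suc N. (e (Suc N) i \<omega>)\<^sup>2))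
    \<le> 3 * sqrt (trunc_mean M (\<lambda>\<omega>. 2 * R (Suc N) \<omega>))" for N
    by (rule bound(3)) (auto simp: e_def R_def)
  have "AE \<omega> in M. (\<lambda>N. R N \<omega>) \<longlonglongrightarrow> 0"
    using H AE_space
  proof eventually_elim
    case (elim \<omega>)
    have "continuous_on {0..T} (\<lambda>t. p t \<omega>)" "continuous_on {0..T} (\<lambda>t. b t \<omega>)"
      by (rule continuous_on_subset[OF p(2)[OF elim(2)]] continuous_on_subset[OF b(2)[OF elim(2)]]; force)+
    then show ?case unfolding R_def using elim(1)
      by (intro left_freezing_error_tendsto_0[OF T, where p="\<lambda>t. p t \<omega>" and b="\<lambda>t. b t \<omega>"]) auto
  qed
  then have "AE \<omega> in M. (\<lambda>N. 2 * R (Suc N) \<omega>) \<longlonglongrightarrow> 0"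
  proof eventually_elim
    case (elim \<omega>)
    show ?case using tendsto_mult[OF tendsto_const[of 2] LIMSEQ_Suc[OF elim]] by simp
  qed
  then have "(\<lambda>N. 3 * sqrt (trunc_mean M (\<lambda>\<omega>. 2 * R (Suc N) \<omega>))) \<longlonglongrightarrow> 3 * sqrt 0"
    by (intro tendsto_intros trunc_mean_AE_tendsto_0) measurable
  then have up: "(\<lambda>N. 3 * sqrt (trunc_mean M (\<lambda>\<omega>. 2 * R (Suc N) \<omega>))) \<longlonglongrightarrow> 0" by simp
  show "(\<lambda>N. trunc_mean M (\<lambda>\<omega>. (\<Sum>i<Suc N. e (Suc N) i \<omega>)\<^sup>2 + (\<Sum>i<Suc N. (e (Suc N) i \<omega>)\<^sup>2))) \<longlonglongrightarrow> 0"
    by (rule tendsto_sandwich[OF always_eventually always_eventually tendsto_const up])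
      (use le trunc_mean_nonneg in auto)
qed

text \<open>The centred squares have variance 2 * (T / N)^2, so the accumulated variance is 2 * T /
  N times a Riemann sum of b^2 and vanishes path by path.\<close>

lemma weighted_quadratic_variation_tendsto_0:
  fixes b :: "real \<Rightarrow> 'a \<Rightarrow> real"
  assumes T: "T > 0"
    and b: "\<And>t. 0 \<le> t \<Longrightarrow> b t \<in> borel_measurable (F t)" "\<And>\<omega>. \<omega> \<in> space M \<Longrightarrow> continuous_on {0..} (\<lambda>t. b t \<omega>)"
  shows "(\<lambda>N. trunc_mean M (\<lambda>\<omega>. (\<Sum>i<Suc N. b (grid 0 T (Suc N) i) \<omega> *
    ((W (grid 0 T (Suc N) (Suc i)) \<omega> - W (grid 0 T (Suc N) i) \<omega>)\<^sup>2 - T / real (Suc N)))\<^sup>2)) \<longlonglongrightarrow> 0"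
proof -
  define R where "R N \<omega> = (\<Sum>i<N. (b (grid 0 T N i) \<omega>)\<^sup>2 * (2 * (T / real N)\<^sup>2))" for N \<omega>
  have g0: "0 \<le> grid 0 T N i" for N i using T by (auto intro: grid_ge)
  have [measurable]: "b (grid 0 T N i) \<in> borel_measurable M" for N i
    by (rule M_measurable[OF b(1)[OF g0]])
  have [measurable]: "R N \<in> borel_measurable M" for N unfolding R_def by measurable
  have le: "trunc_mean M (\<lambda>\<omega>. (\<Sum>i<Suc N. b (grid 0 T (Suc N) i) \<omega> *
    ((W (grid 0 T (Suc N) (Suc i)) \<omega> - W (grid 0 T (Suc N) i) \<omega>)\<^sup>2 - T / real (Suc N)))\<^sup>2)
     \<le> 3 * sqrt (trunc_mean M (R (Suc N)))" for N
  proof -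
    interpret I: increment_sequence M "\<lambda>j. F (grid 0 T (Suc N) j)"
      "\<lambda>j \<omega>. (W (grid 0 T (Suc N) (Suc j)) \<omega> - W (grid 0 T (Suc N) j) \<omega>)\<^sup>2 - (T - 0) / real (Suc N)"
      "\<lambda>j. 2 * ((T - 0) / real (Suc N))\<^sup>2"
      by (rule square_grid_increments) (use T in auto)
    show ?thesis
      \<comment> \<open>An empty family of blocks leaves just the square of the total sum.\<close>
      using I.transform_trunc_mean_le[where g="\<lambda>j. b (grid 0 T (Suc N) j)" and B="\<lambda>_. {}" and N=0 and n="Suc N", OF b(1)[OF g0]]
      by (simp only: R_def[abs_def] diff_zero) (simp add: disjoint_family_on_def del: sum.lessThan_Suc)
  qed
  have "AE \<omega> in M. (\<lambda>N. R (Suc N) \<omega>) \<longlonglongrightarrow> 0"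
  proof (rule AE_I2)
    fix \<omega> assume \<omega>: "\<omega> \<in> space M"
    have "continuous_on {0..T} (\<lambda>t. (b t \<omega>)\<^sup>2)"
      by (intro continuous_intros continuous_on_subset[OF b(2)[OF \<omega>]]) auto
    from tendsto_mult[OF lim_const_over_n[of "2 * T"] left_riemann_sum_continuous[OF T this]]
    have "(\<lambda>N. 2 * T / real N * (\<Sum>i<N. (b (grid 0 T N i) \<omega>)\<^sup>2 * ((T - 0) / real N))) \<longlonglongrightarrow> 0" by simp
    also have "(\<lambda>N. 2 * T / real N * (\<Sum>i<N. (b (grid 0 T N i) \<omega>)\<^sup>2 * ((T - 0) / real N))) = (\<lambda>N. R N \<omega>)"
      unfolding R_def by (simp add: sum_distrib_left power2_eq_square mult_ac)
    finally show "(\<lambda>N. R (Suc N) \<omega>) \<longlonglongrightarrow> 0" by (rule LIMSEQ_Suc)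
  qed
  then have "(\<lambda>N. 3 * sqrt (trunc_mean M (R (Suc N)))) \<longlonglongrightarrow> 3 * sqrt 0"
    by (intro tendsto_intros trunc_mean_AE_tendsto_0) measurable
  then have up: "(\<lambda>N. 3 * sqrt (trunc_mean M (R (Suc N)))) \<longlonglongrightarrow> 0" by simp
  show ?thesis
    by (rule tendsto_sandwich[OF always_eventually always_eventually tendsto_const up])
      (use le trunc_mean_nonneg in auto)
qed

text \<open>Both the Ito correction and the stochastic integral of \<open>z\<close> are expressed pathwise, so that no
  stochastic integral is left in the conclusion.\<close>

theorem log_ito_exponential:
  fixes p z \<alpha> A Y :: "real \<Rightarrow> 'a \<Rightarrow> real"
  assumes T: "T > 0" and \<kappa>: "\<kappa> \<noteq> 0"
    and p: "\<And>t. 0 \<le> t \<Longrightarrow> p t \<in> borel_measurable (F t)" "\<And>\<omega>. \<omega> \<in> space M \<Longrightarrow> continuous_on {0..} (\<lambda>t. p t \<omega>)"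
    and z: "\<And>t. 0 \<le> t \<Longrightarrow> z t \<in> borel_measurable (F t)" "\<And>\<omega>. \<omega> \<in> space M \<Longrightarrow> continuous_on {0..} (\<lambda>t. z t \<omega>)"
    and \<alpha>: "\<And>\<omega>. \<omega> \<in> space M \<Longrightarrow> continuous_on {0..} (\<lambda>t. \<alpha> t \<omega>)"
    and A: "\<And>\<omega>. \<omega> \<in> space M \<Longrightarrow> continuous_on {0..} (\<lambda>t. A t \<omega>)"
    and H: "AE \<omega> in M. \<forall>t\<in>{0..T}. p t \<omega> \<noteq> 0 \<and> H t \<omega> = p t \<omega> * (c * z t \<omega>)"
    and ito: "\<And>t. 0 \<le> t \<Longrightarrow> has_ito_integral M F W H t (Y t)" and Y0: "\<And>\<omega>. \<omega> \<in> space M \<Longrightarrow> Y 0 \<omega> = 0"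
    and Y: "AE \<omega> in M. \<forall>t\<in>{0..T}. Y t \<omega> = p t \<omega> - p 0 \<omega> - integral {0..t} (\<lambda>s. p s \<omega> * \<alpha> s \<omega>)"
    and zt: "AE \<omega> in M. \<forall>t\<in>{0..T}. z t \<omega> = integral {0..t} (\<lambda>s. A s \<omega>) + \<kappa> * W t \<omega>"
  shows "AE \<omega> in M. ln (p T \<omega> / p 0 \<omega>) =
    integral {0..T} (\<lambda>s. \<alpha> s \<omega>) - c\<^sup>2 / 2 * integral {0..T} (\<lambda>s. (z s \<omega>)\<^sup>2)
    + c * ((((z T \<omega>)\<^sup>2 - (z 0 \<omega>)\<^sup>2 - \<kappa>\<^sup>2 * T) / 2 - integral {0..T} (\<lambda>s. z s \<omega> * A s \<omega>)) / \<kappa>)"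
proof -
  define b where "b t \<omega> = c * z t \<omega>" for t \<omega>
  have b: "\<And>t. 0 \<le> t \<Longrightarrow> b t \<in> borel_measurable (F t)" "\<And>\<omega>. \<omega> \<in> space M \<Longrightarrow> continuous_on {0..} (\<lambda>t. b t \<omega>)"
    unfolding b_def using z by (auto intro!: continuous_intros borel_measurable_times)
  have b2: "\<And>t. 0 \<le> t \<Longrightarrow> (\<lambda>\<omega>. (b t \<omega>)\<^sup>2) \<in> borel_measurable (F t)"
    "\<And>\<omega>. \<omega> \<in> space M \<Longrightarrow> continuous_on {0..} (\<lambda>t. (b t \<omega>)\<^sup>2)"
    using b by (auto intro!: continuous_intros borel_measurable_power)
  define e where "e N i \<omega> = (Y (grid 0 T N (Suc i)) \<omega> - Y (grid 0 T N i) \<omega>) / p (grid 0 T N i) \<omega>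
        - b (grid 0 T N i) \<omega> * (W (grid 0 T N (Suc i)) \<omega> - W (grid 0 T N i) \<omega>)" for N i \<omega>
  \<comment> \<open>\<open>X0\<close> collects the freezing errors, \<open>X1\<close> the quadratic
    variation weighted by b^2 for the logarithm, \<open>X2\<close> the unweighted one for the square
    of \<open>z\<close>. Their sum yields one subsequence that suits both pathwise formulas.\<close>
  define X0 where "X0 N \<omega> = (\<Sum>i<N. e N i \<omega>)\<^sup>2 + (\<Sum>i<N. (e N i \<omega>)\<^sup>2)" for N \<omega>
  define D where "D N i \<omega> = (W (grid 0 T N (Suc i)) \<omega> - W (grid 0 T N i) \<omega>)\<^sup>2 - T / real N" for N i \<omega>
  define X1 where "X1 N \<omega> = (\<Sum>i<N. (b (grid 0 T N i) \<omega>)\<^sup>2 * D N i \<omega>)\<^sup>2" for N \<omega>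
  define X2 where "X2 N \<omega> = (\<Sum>i<N. 1 * D N i \<omega>)\<^sup>2" for N \<omega>
  have g0: "0 \<le> grid 0 T N i" for N i using T by (auto intro: grid_ge)
  note [measurable] = W_measurable[OF g0] M_measurable[OF b(1)[OF g0]]
  have H': "AE \<omega> in M. \<forall>t\<in>{0..T}. p t \<omega> \<noteq> 0 \<and> H t \<omega> = p t \<omega> * b t \<omega>" using H by (simp add: b_def)
  note err = ito_increment_errors_tendsto_0[OF T p b H' ito Y0 e_def]
  have [measurable]: "e (Suc N) i \<in> borel_measurable M" for N i by (rule err(1))
  have [measurable]: "D N i \<in> borel_measurable M" for N i unfolding D_def by measurable
  have [measurable]: "X0 (Suc N) \<in> borel_measurable M" "X1 N \<in> borel_measurable M" "X2 N \<in> borel_measurable M" for N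
    unfolding X0_def X1_def X2_def by measurable
  have "(\<lambda>N. trunc_mean M (X0 (Suc N))) \<longlonglongrightarrow> 0"
    unfolding X0_def using err(2) .
  moreover have "(\<lambda>N. trunc_mean M (X1 (Suc N))) \<longlonglongrightarrow> 0"
    unfolding X1_def D_def using weighted_quadratic_variation_tendsto_0[OF T b2] .
  moreover have "(\<lambda>N. trunc_mean M (X2 (Suc N))) \<longlonglongrightarrow> 0"
    unfolding X2_def D_def using weighted_quadratic_variation_tendsto_0[OF T, of "\<lambda>_ _. 1"] by simp
  ultimately have up: "(\<lambda>N. trunc_mean M (X0 (Suc N)) + trunc_mean M (X1 (Suc N)) + trunc_mean M (X2 (Suc N))) \<longlonglongrightarrow> 0 + 0 + 0"
    by (intro tendsto_add)
  have "(\<lambda>N. trunc_mean M (\<lambda>\<omega>. X0 (Suc N) \<omega> + X1 (Suc N) \<omega> + X2 (Suc N) \<omega>)) \<longlonglongrightarrow> 0"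
  proof (rule tendsto_sandwich[OF always_eventually always_eventually tendsto_const up[simplified]], safe)
    fix N
    have "trunc_mean M (\<lambda>\<omega>. X0 (Suc N) \<omega> + X1 (Suc N) \<omega> + X2 (Suc N) \<omega>)
      \<le> trunc_mean M (\<lambda>\<omega>. X0 (Suc N) \<omega> + X1 (Suc N) \<omega>) + trunc_mean M (X2 (Suc N))"
      by (rule trunc_mean_add) measurable
    also have "trunc_mean M (\<lambda>\<omega>. X0 (Suc N) \<omega> + X1 (Suc N) \<omega>) \<le> trunc_mean M (X0 (Suc N)) + trunc_mean M (X1 (Suc N))"
      by (rule trunc_mean_add) measurable
    finally show "trunc_mean M (\<lambda>\<omega>. X0 (Suc N) \<omega> + X1 (Suc N) \<omega> + X2 (Suc N) \<omega>)
      \<le> trunc_mean M (X0 (Suc N)) + trunc_mean M (X1 (Suc N)) + trunc_mean M (X2 (Suc N))" by simp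
  qed (rule trunc_mean_nonneg)
  from trunc_mean_AE_subseq[OF _ this] obtain r0 :: "nat \<Rightarrow> nat" where r0: "strict_mono r0"
    "AE \<omega> in M. (\<lambda>k. X0 (Suc (r0 k)) \<omega> + X1 (Suc (r0 k)) \<omega> + X2 (Suc (r0 k)) \<omega>) \<longlonglongrightarrow> 0" by auto
  define r where "r k = Suc (r0 k)" for k
  have r: "strict_mono r" using r0(1) by (simp add: r_def strict_mono_def)
  show ?thesis
    using r0(2)[folded r_def] H' Y zt AE_space
  proof eventually_elim
    case (elim \<omega>)
    have nn: "0 \<le> X0 N \<omega>" "0 \<le> X1 N \<omega>" "0 \<le> X2 N \<omega>" "0 \<le> (\<Sum>i<N. (e N i \<omega>)\<^sup>2)" for N
      by (auto simp: X0_def X1_def X2_def sum_nonneg)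
    have small: "f \<longlonglongrightarrow> 0"
      if "\<And>k. 0 \<le> f k" "\<And>k. f k \<le> X0 (r k) \<omega> + X1 (r k) \<omega> + X2 (r k) \<omega>" for f :: "nat \<Rightarrow> real"
      by (rule tendsto_sandwich[OF always_eventually always_eventually tendsto_const elim(1)]) (use that in auto)
    have e1: "(\<lambda>k. \<Sum>i<r k. e (r k) i \<omega>) \<longlonglongrightarrow> 0"
    proof (rule tendsto_0_of_square, rule small)
      fix k show "(\<Sum>i<r k. e (r k) i \<omega>)\<^sup>2 \<le> X0 (r k) \<omega> + X1 (r k) \<omega> + X2 (r k) \<omega>"
        using nn[of "r k"] unfolding X0_def by linarith
    qed simp
    have e2: "(\<lambda>k. \<Sum>i<r k. (e (r k) i \<omega>)\<^sup>2) \<longlonglongrightarrow> 0"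
    proof (rule small)
      fix k show "(\<Sum>i<r k. (e (r k) i \<omega>)\<^sup>2) \<le> X0 (r k) \<omega> + X1 (r k) \<omega> + X2 (r k) \<omega>"
        using nn[of "r k"] zero_le_power2[of "\<Sum>i<r k. e (r k) i \<omega>"] unfolding X0_def by linarith
    qed (rule nn)
    have q1: "(\<lambda>k. \<Sum>i<r k. (b (grid 0 T (r k) i) \<omega>)\<^sup>2 * D (r k) i \<omega>) \<longlonglongrightarrow> 0"
    proof (rule tendsto_0_of_square, rule small)
      fix k show "(\<Sum>i<r k. (b (grid 0 T (r k) i) \<omega>)\<^sup>2 * D (r k) i \<omega>)\<^sup>2 \<le> X0 (r k) \<omega> + X1 (r k) \<omega> + X2 (r k) \<omega>"
        using nn[of "r k"] unfolding X1_def by linarith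
    qed simp
    have q2: "(\<lambda>k. \<Sum>i<r k. D (r k) i \<omega>) \<longlonglongrightarrow> 0"
    proof (rule tendsto_0_of_square, rule small)
      fix k show "(\<Sum>i<r k. D (r k) i \<omega>)\<^sup>2 \<le> X0 (r k) \<omega> + X1 (r k) \<omega> + X2 (r k) \<omega>"
        using nn[of "r k"] unfolding X2_def by simp
    qed simp
    have cont: "continuous_on {0..T} (\<lambda>t. p t \<omega>)" "continuous_on {0..T} (\<lambda>t. \<alpha> t \<omega>)" "continuous_on {0..T} (\<lambda>t. b t \<omega>)"
      "continuous_on {0..T} (\<lambda>t. z t \<omega>)" "continuous_on {0..T} (\<lambda>t. A t \<omega>)"
      by (rule continuous_on_subset[OF p(2)[OF elim(5)]] continuous_on_subset[OF \<alpha>[OF elim(5)]]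
          continuous_on_subset[OF b(2)[OF elim(5)]] continuous_on_subset[OF z(2)[OF elim(5)]]
          continuous_on_subset[OF A[OF elim(5)]]; force)+
    define S where "S k = (\<Sum>i<r k. z (grid 0 T (r k) i) \<omega> * (W (grid 0 T (r k) (Suc i)) \<omega> - W (grid 0 T (r k) i) \<omega>))" for k
    have "(\<lambda>k. \<Sum>i<r k. b (grid 0 T (r k) i) \<omega> * (W (grid 0 T (r k) (Suc i)) \<omega> - W (grid 0 T (r k) i) \<omega>))
      \<longlonglongrightarrow> ln (p T \<omega> / p 0 \<omega>) - integral {0..T} (\<lambda>t. \<alpha> t \<omega>) + integral {0..T} (\<lambda>s. (b s \<omega>)\<^sup>2) / 2"
      by (rule log_increment_sum_tendsto[where p="\<lambda>t. p t \<omega>" and \<alpha>="\<lambda>t. \<alpha> t \<omega>" and b="\<lambda>t. b t \<omega>" and w="\<lambda>t. W t \<omega>"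
            and y="\<lambda>t. Y t \<omega>" and e="\<lambda>N i. e N i \<omega>", OF T r cont(1) _ cont(2,3) _ _ e1 e2 q1[unfolded D_def]])
        (use elim in \<open>auto simp: e_def\<close>)
    moreover have "(\<Sum>i<r k. b (grid 0 T (r k) i) \<omega> * (W (grid 0 T (r k) (Suc i)) \<omega> - W (grid 0 T (r k) i) \<omega>)) = c * S k" for k
      by (simp add: S_def b_def sum_distrib_left mult_ac)
    moreover have "(\<lambda>s. (b s \<omega>)\<^sup>2) = (\<lambda>s. c\<^sup>2 * (z s \<omega>)\<^sup>2)" by (simp add: b_def power_mult_distrib)
    ultimately have l1: "(\<lambda>k. c * S k) \<longlonglongrightarrow> ln (p T \<omega> / p 0 \<omega>) - integral {0..T} (\<lambda>t. \<alpha> t \<omega>) + c\<^sup>2 * integral {0..T} (\<lambda>s. (z s \<omega>)\<^sup>2) / 2"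
      by simp
    have "S \<longlonglongrightarrow> (((z T \<omega>)\<^sup>2 - (z 0 \<omega>)\<^sup>2 - \<kappa>\<^sup>2 * T) / 2 - integral {0..T} (\<lambda>s. z s \<omega> * A s \<omega>)) / \<kappa>"
      unfolding S_def
      by (rule square_increment_sum_tendsto[where z="\<lambda>t. z t \<omega>" and A="\<lambda>t. A t \<omega>" and w="\<lambda>t. W t \<omega>",
            OF T r \<kappa> cont(4,5) _ q2[unfolded D_def]]) (use elim in auto)
    then have "(\<lambda>k. c * S k) \<longlonglongrightarrow> c * ((((z T \<omega>)\<^sup>2 - (z 0 \<omega>)\<^sup>2 - \<kappa>\<^sup>2 * T) / 2 - integral {0..T} (\<lambda>s. z s \<omega> * A s \<omega>)) / \<kappa>)"
      by (intro tendsto_mult tendsto_const)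
    \<comment> \<open>The same sums have been evaluated twice, through the logarithm of
      \<open>p\<close> and through the square of \<open>z\<close>. Equating the limits removes the
      stochastic integral.\<close>
    from LIMSEQ_unique[OF l1 this] show ?case by simp
  qed
qed

end

subsection \<open>Second moments\<close>

lemma continuous_on_indefinite_integral_halfline:
  fixes g :: "real \<Rightarrow> real"
  assumes "\<And>t. 0 \<le> t \<Longrightarrow> g integrable_on {0..t}"
  shows "continuous_on {0..} (\<lambda>t. integral {0..t} g)"
  unfolding continuous_on_eq_continuous_within
proof
  fix t :: real assume t: "t \<in> {0..}"
  have "continuous_on {0..t + 1} (\<lambda>t. integral {0..t} g)"
    using t by (intro indefinite_integral_continuous_1 assms) auto
  then have "continuous (at t within {0..t + 1}) (\<lambda>t. integral {0..t} g)"
    using t by (auto simp: continuous_on_eq_continuous_within)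
  moreover have "at t within {0..} = at t within {0..t + 1}"
    by (rule at_within_nhd[of _ "{..<t + 1}"]) auto
  ultimately show "continuous (at t within {0..}) (\<lambda>t. integral {0..t} g)"
    by (simp add: continuous_within)
qed

lemma continuous_on_integral_upto:
  fixes f :: "real \<Rightarrow> real"
  assumes "continuous_on {0..} f"
  shows "continuous_on {0..} (\<lambda>t. integral {0..t} f)"
  by (intro continuous_on_indefinite_integral_halfline integrable_continuous_real continuous_on_subset[OF assms]) auto

text \<open>Cauchy-Schwarz, read off from nonnegativity of the integral of (f - m)^2 with m the mean
  of f.\<close>

lemma integral_square_le:
  fixes f :: "real \<Rightarrow> real"
  assumes t: "0 \<le> t" and f: "continuous_on {0..t} f"
  shows "(integral {0..t} f)\<^sup>2 \<le> t * integral {0..t} (\<lambda>s. (f s)\<^sup>2)"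
proof (cases "t = 0")
  case False
  then have t: "t > 0" using t by simp
  define m where "m = integral {0..t} f / t"
  have fi: "f integrable_on {0..t}" by (intro integrable_continuous_real f)
  have f2: "(\<lambda>s. (f s)\<^sup>2) integrable_on {0..t}" by (intro integrable_continuous_real continuous_intros f)
  have "0 \<le> integral {0..t} (\<lambda>s. (f s - m)\<^sup>2)"
    by (intro Henstock_Kurzweil_Integration.integral_nonneg integrable_continuous_real continuous_intros f) auto
  also have "(\<lambda>s. (f s - m)\<^sup>2) = (\<lambda>s. ((f s)\<^sup>2 - 2 * m * f s) + m\<^sup>2)"
    by (rule ext) (simp add: power2_diff)
  also have "integral {0..t} (\<lambda>s. ((f s)\<^sup>2 - 2 * m * f s) + m\<^sup>2) = (integral {0..t} (\<lambda>s. (f s)\<^sup>2) - 2 * m * integral {0..t} f) + m\<^sup>2 * t"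
  proof -
    have fm: "(\<lambda>s. 2 * m * f s) integrable_on {0..t}" by (rule integrable_on_mult_right[OF fi])
    have "integral {0..t} (\<lambda>s. ((f s)\<^sup>2 - 2 * m * f s) + m\<^sup>2) =
      (integral {0..t} (\<lambda>s. (f s)\<^sup>2) - integral {0..t} (\<lambda>s. 2 * m * f s)) + integral {0..t} (\<lambda>s. m\<^sup>2)"
      by (simp only: Henstock_Kurzweil_Integration.integral_add[OF integrable_diff[OF f2 fm] integrable_const_ivl]
          Henstock_Kurzweil_Integration.integral_diff[OF f2 fm])
    then show ?thesis using t by (simp add: Henstock_Kurzweil_Integration.integral_mult_right mult.commute)
  qed
  also have "integral {0..t} f = m * t" using t by (simp add: m_def)
  finally have "m\<^sup>2 * t \<le> integral {0..t} (\<lambda>s. (f s)\<^sup>2)" by (simp add: power2_eq_square algebra_simps)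
  then have "t * (m\<^sup>2 * t) \<le> t * integral {0..t} (\<lambda>s. (f s)\<^sup>2)" using t by (intro mult_left_mono) auto
  moreover have "(integral {0..t} f)\<^sup>2 = t * (m\<^sup>2 * t)" using t by (simp add: m_def power2_eq_square)
  ultimately show ?thesis by simp
qed simp

lemma product_rule_integral:
  fixes f g :: "real \<Rightarrow> real"
  assumes t: "0 \<le> t" and f: "continuous_on {0..t} f" and g: "continuous_on {0..t} g"
  shows "integral {0..t} f * integral {0..t} g = integral {0..t} (\<lambda>s. f s * integral {0..s} g + integral {0..s} f * g s)"
proof -
  have "((\<lambda>s. f s * integral {0..s} g + integral {0..s} f * g s) has_integral
     integral {0..t} f * integral {0..t} g - integral {0..0} f * integral {0..0} g) {0..t}"
  proof (rule fundamental_theorem_of_calculus[OF t])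
    fix s assume s: "s \<in> {0..t}"
    have "((\<lambda>u. integral {0..u} f) has_real_derivative f s) (at s within {0..t})"
      "((\<lambda>u. integral {0..u} g) has_real_derivative g s) (at s within {0..t})"
      using integral_has_real_derivative[OF f s] integral_has_real_derivative[OF g s] by auto
    from DERIV_mult[OF this]
    show "((\<lambda>u. integral {0..u} f * integral {0..u} g) has_vector_derivative f s * integral {0..s} g + integral {0..s} f * g s) (at s within {0..t})"
      by (simp add: has_real_derivative_iff_has_vector_derivative mult.commute add.commute)
  qed
  then show ?thesis by (simp add: integral_unique)
qed

text \<open>With integrating factor exp (\<kappa> * s), the integral of \<open>x\<close> is an
  average of \<open>R\<close> with weights at most 1, as \<kappa> \<ge> 0. The bound holds path by
  path and presupposes no moment of the solution, so it can be used to establish them.\<close>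

lemma linear_integral_equation_bound:
  fixes x R :: "real \<Rightarrow> real"
  assumes \<kappa>: "0 \<le> \<kappa>" and t: "0 \<le> t" and x: "continuous_on {0..} x" and R: "continuous_on {0..} R"
    and eq: "\<And>s. 0 \<le> s \<Longrightarrow> x s = - \<kappa> * integral {0..s} x + R s"
  shows "(x t)\<^sup>2 \<le> 2 * (R t)\<^sup>2 + 2 * \<kappa>\<^sup>2 * (t * integral {0..t} (\<lambda>s. (R s)\<^sup>2))"
proof -
  define I where "I s = integral {0..s} x" for s
  have x_eq: "x s = - \<kappa> * I s + R s" if "0 \<le> s" for s using eq[OF that] by (simp add: I_def)
  have xt: "continuous_on {0..t} x" and Rt: "continuous_on {0..t} R" using x R by (auto intro: continuous_on_subset)
  have "((\<lambda>s. exp (\<kappa> * s) * R s) has_integral exp (\<kappa> * t) * I t - exp (\<kappa> * 0) * I 0) {0..t}"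
  proof (rule fundamental_theorem_of_calculus[OF t])
    fix s assume s: "s \<in> {0..t}"
    have Rs: "R s = x s + \<kappa> * I s" using x_eq[of s] s by simp
    have "(I has_real_derivative x s) (at s within {0..t})"
      unfolding I_def[abs_def] using integral_has_real_derivative[OF xt s] .
    then have "((\<lambda>s. exp (\<kappa> * s) * I s) has_real_derivative exp (\<kappa> * s) * R s) (at s within {0..t})"
      unfolding Rs by (auto intro!: derivative_eq_intros simp: algebra_simps)
    then show "((\<lambda>s. exp (\<kappa> * s) * I s) has_vector_derivative exp (\<kappa> * s) * R s) (at s within {0..t})"
      by (simp add: has_real_derivative_iff_has_vector_derivative)
  qed
  then have hi: "((\<lambda>s. exp (\<kappa> * s) * R s) has_integral exp (\<kappa> * t) * I t) {0..t}" by (simp add: I_def)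
  have "norm (integral {0..t} (\<lambda>s. exp (\<kappa> * s) * R s)) \<le> integral {0..t} (\<lambda>s. exp (\<kappa> * t) * \<bar>R s\<bar>)"
  proof (rule integral_norm_bound_integral)
    show "(\<lambda>s. exp (\<kappa> * s) * R s) integrable_on {0..t}" using hi by (auto simp: has_integral_iff)
    show "(\<lambda>s. exp (\<kappa> * t) * \<bar>R s\<bar>) integrable_on {0..t}" by (intro integrable_continuous_real continuous_intros Rt)
    show "norm (exp (\<kappa> * s) * R s) \<le> exp (\<kappa> * t) * \<bar>R s\<bar>" if "s \<in> {0..t}" for s
      using that \<kappa> by (auto simp: abs_mult intro!: mult_right_mono mult_left_mono)
  qed
  then have "exp (\<kappa> * t) * \<bar>I t\<bar> \<le> exp (\<kappa> * t) * integral {0..t} (\<lambda>s. \<bar>R s\<bar>)"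
    using integral_unique[OF hi] by (simp add: abs_mult)
  then have "\<bar>I t\<bar> \<le> integral {0..t} (\<lambda>s. \<bar>R s\<bar>)" by simp
  then have "\<bar>I t\<bar>\<^sup>2 \<le> (integral {0..t} (\<lambda>s. \<bar>R s\<bar>))\<^sup>2" by (intro power_mono) auto
  also have "\<dots> \<le> t * integral {0..t} (\<lambda>s. \<bar>R s\<bar>\<^sup>2)"
    by (intro integral_square_le t continuous_intros Rt)
  finally have I2: "(I t)\<^sup>2 \<le> t * integral {0..t} (\<lambda>s. (R s)\<^sup>2)" by simp
  have "(x t)\<^sup>2 = (R t + (- \<kappa> * I t))\<^sup>2" using eq[OF t] by (simp add: I_def)
  also have "\<dots> \<le> 2 * (R t)\<^sup>2 + 2 * (- \<kappa> * I t)\<^sup>2" by (rule square_sum_le_double)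
  also have "2 * (- \<kappa> * I t)\<^sup>2 = 2 * \<kappa>\<^sup>2 * (I t)\<^sup>2" by (simp add: power_mult_distrib)
  also have "\<dots> \<le> 2 * \<kappa>\<^sup>2 * (t * integral {0..t} (\<lambda>s. (R s)\<^sup>2))" by (intro mult_left_mono I2) auto
  finally show ?thesis by simp
qed

text \<open>Only the ratio R t / t is known to converge, so the solution formula is not evaluated.
  l'Hopital is applied to exp (\<kappa> * t) times the integral of \<open>y\<close>, over t * exp
  (\<kappa> * t): the derivatives have quotient R t / (1 + \<kappa> * t). The second limit is then
  forced by the equation. An average obtained in this way can serve as forcing in the next
  equation.\<close>

lemma linear_integral_equation_average:
  fixes y R :: "real \<Rightarrow> real"
  assumes \<kappa>: "\<kappa> > 0" and y: "continuous_on {0..} y"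
    and eq: "\<And>t. 0 \<le> t \<Longrightarrow> y t = - \<kappa> * integral {0..t} y + R t"
    and R: "((\<lambda>t. R t / t) \<longlongrightarrow> \<rho>) at_top"
  shows "((\<lambda>t. integral {0..t} y / t) \<longlongrightarrow> \<rho> / \<kappa>) at_top" and "((\<lambda>t. y t / t) \<longlongrightarrow> 0) at_top"
proof -
  define I where "I t = integral {0..t} y" for t
  have I': "(I has_real_derivative y t) (at t)" if "t > 0" for t
  proof -
    have "(I has_real_derivative y t) (at t within {0..t + 1})"
      unfolding I_def[abs_def] using that y by (intro integral_has_real_derivative continuous_on_subset[OF y]) auto
    moreover have "at t within {0..t + 1} = at t" using that by (intro at_within_interior) auto
    ultimately show ?thesis by simp
  qed
  have "((\<lambda>t. (exp (\<kappa> * t) * I t) / (t * exp (\<kappa> * t))) \<longlongrightarrow> \<rho> / \<kappa>) at_top"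
  proof (rule lhospital_at_top_at_top)
    show "LIM t at_top. t * exp (\<kappa> * t) :> at_top" using \<kappa> by real_asymp
    show "\<forall>\<^sub>F t in at_top. exp (\<kappa> * t) * (1 + \<kappa> * t) \<noteq> 0"
      using eventually_gt_at_top[of 0]
    proof eventually_elim
      case (elim t)
      then have "1 + \<kappa> * t > 0" using \<kappa> by (simp add: add_pos_pos)
      then show ?case by simp
    qed
    show "\<forall>\<^sub>F t in at_top. ((\<lambda>t. exp (\<kappa> * t) * I t) has_real_derivative exp (\<kappa> * t) * R t) (at t)"
      using eventually_gt_at_top[of 0]
    proof eventually_elim
      case (elim t)
      then have Rt: "R t = y t + \<kappa> * I t" using eq[of t] by (simp add: I_def)
      show ?case using I'[OF elim] unfolding Rt
        by (auto intro!: derivative_eq_intros simp: algebra_simps)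
    qed
    show "\<forall>\<^sub>F t in at_top. ((\<lambda>t. t * exp (\<kappa> * t)) has_real_derivative exp (\<kappa> * t) * (1 + \<kappa> * t)) (at t)"
      by (rule always_eventually) (auto intro!: derivative_eq_intros simp: algebra_simps)
    have "((\<lambda>t. (R t / t) / (1 / t + \<kappa>)) \<longlongrightarrow> \<rho> / (0 + \<kappa>)) at_top"
      using \<kappa> by (intro tendsto_divide R tendsto_add tendsto_const) (real_asymp, simp)
    moreover have "\<forall>\<^sub>F t in at_top. (R t / t) / (1 / t + \<kappa>) = (exp (\<kappa> * t) * R t) / (exp (\<kappa> * t) * (1 + \<kappa> * t))"
      using eventually_gt_at_top[of 0]
    proof eventually_elim
      case (elim t)
      have "(R t / t) / (1 / t + \<kappa>) = R t / (1 + \<kappa> * t)" using elim \<kappa> by (simp add: field_simps)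
      then show ?case by (simp only: mult_divide_mult_cancel_left[OF exp_not_eq_zero])
    qed
    ultimately show "((\<lambda>t. (exp (\<kappa> * t) * R t) / (exp (\<kappa> * t) * (1 + \<kappa> * t))) \<longlongrightarrow> \<rho> / \<kappa>) at_top"
      by (simp add: Lim_transform_eventually)
  qed
  then show avg: "((\<lambda>t. integral {0..t} y / t) \<longlongrightarrow> \<rho> / \<kappa>) at_top" by (simp add: I_def mult.commute)
  have "((\<lambda>t. - \<kappa> * (integral {0..t} y / t) + R t / t) \<longlongrightarrow> - \<kappa> * (\<rho> / \<kappa>) + \<rho>) at_top"
    by (intro tendsto_intros avg R)
  moreover have "\<forall>\<^sub>F t in at_top. - \<kappa> * (integral {0..t} y / t) + R t / t = y t / t"
    using eventually_ge_at_top[of 0] by eventually_elim (use eq in \<open>simp add: diff_divide_distrib\<close>)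
  ultimately show "((\<lambda>t. y t / t) \<longlongrightarrow> 0) at_top" using \<kappa> by (simp add: Lim_transform_eventually)
qed

lemma floor_fraction_tendsto:
  fixes x :: real
  shows "(\<lambda>l. of_int \<lfloor>x * real (Suc l)\<rfloor> / real (Suc l)) \<longlonglongrightarrow> x"
proof (rule tendsto_sandwich)
  show "(\<lambda>l. x - 1 / real (Suc l)) \<longlonglongrightarrow> x"
    using tendsto_diff[OF tendsto_const[of "x"] LIMSEQ_Suc[OF lim_const_over_n[of 1]]] by simp
  show "\<forall>\<^sub>F l in sequentially. x - 1 / real (Suc l) \<le> of_int \<lfloor>x * real (Suc l)\<rfloor> / real (Suc l)"
  proof (intro always_eventually allI)
    fix l
    have "x * real (Suc l) - 1 \<le> of_int \<lfloor>x * real (Suc l)\<rfloor>" by linarith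
    then have "(x * real (Suc l) - 1) / real (Suc l) \<le> of_int \<lfloor>x * real (Suc l)\<rfloor> / real (Suc l)"
      by (intro divide_right_mono) auto
    then show "x - 1 / real (Suc l) \<le> of_int \<lfloor>x * real (Suc l)\<rfloor> / real (Suc l)"
      by (simp only: diff_divide_distrib nonzero_mult_div_cancel_right[OF of_nat_neq_0])
  qed
  show "\<forall>\<^sub>F l in sequentially. of_int \<lfloor>x * real (Suc l)\<rfloor> / real (Suc l) \<le> x"
    by (intro always_eventually allI) (simp add: pos_divide_le_eq)
qed simp

text \<open>Rounding time down to multiples of 1 / Suc l leaves countably many values, for which
  joint measurability is clear; path continuity passes to the limit. The clamp at 0 discards
  negative times.\<close>

lemma (in prob_space) continuous_process_measurable:
  fixes X :: "real \<Rightarrow> 'a \<Rightarrow> real"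
  assumes m: "\<And>t. 0 \<le> t \<Longrightarrow> X t \<in> borel_measurable M"
    and c: "\<And>\<omega>. \<omega> \<in> space M \<Longrightarrow> continuous_on {0..} (\<lambda>t. X t \<omega>)"
  shows "(\<lambda>x. X (max 0 (fst x)) (snd x)) \<in> borel_measurable (borel \<Otimes>\<^sub>M M)"
proof (rule borel_measurable_LIMSEQ_real)
  fix l :: nat
  have "(\<lambda>x. X (max 0 (of_int (i::int) / real (Suc l))) (snd x)) \<in> borel_measurable (borel \<Otimes>\<^sub>M M)" for i
    by (rule measurable_compose[OF measurable_snd m]) simp
  moreover have "(\<lambda>x. \<lfloor>fst x * real (Suc l)\<rfloor>) \<in> measurable (borel \<Otimes>\<^sub>M M) (count_space UNIV)"
    by measurable
  ultimately show "(\<lambda>x. X (max 0 (of_int \<lfloor>fst x * real (Suc l)\<rfloor> / real (Suc l))) (snd x)) \<in> borel_measurable (borel \<Otimes>\<^sub>M M)"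
    by (rule measurable_compose_countable)
next
  fix x :: "real \<times> 'a" assume "x \<in> space (borel \<Otimes>\<^sub>M M)"
  then have \<omega>: "snd x \<in> space M" by (auto simp: space_pair_measure)
  have lim: "(\<lambda>l. max 0 (of_int \<lfloor>fst x * real (Suc l)\<rfloor> / real (Suc l))) \<longlonglongrightarrow> max 0 (fst x)"
    by (intro tendsto_intros floor_fraction_tendsto)
  show "(\<lambda>l. X (max 0 (of_int \<lfloor>fst x * real (Suc l)\<rfloor> / real (Suc l))) (snd x)) \<longlonglongrightarrow> X (max 0 (fst x)) (snd x)"
    by (rule continuous_on_tendsto_compose[OF c[OF \<omega>] lim]) auto
qed

text \<open>Second moments are required to be bounded on each {0..T}, not just finite at each time,
  since Fubini integrates them over time.\<close>

definition L2_process :: "'a measure \<Rightarrow> (real \<Rightarrow> 'a \<Rightarrow> real) \<Rightarrow> bool" where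
  "L2_process M X \<longleftrightarrow>
     (\<forall>t\<ge>0. X t \<in> borel_measurable M) \<and> (\<forall>\<omega>\<in>space M. continuous_on {0..} (\<lambda>t. X t \<omega>)) \<and>
     (\<forall>T\<ge>0. \<exists>C. \<forall>t\<in>{0..T}. integrable M (\<lambda>\<omega>. (X t \<omega>)\<^sup>2) \<and> (\<integral>\<omega>. (X t \<omega>)\<^sup>2 \<partial>M) \<le> C)"

lemma L2_processD:
  assumes "L2_process M X"
  shows "0 \<le> t \<Longrightarrow> X t \<in> borel_measurable M"
    "\<omega> \<in> space M \<Longrightarrow> continuous_on {0..} (\<lambda>t. X t \<omega>)"
    "0 \<le> t \<Longrightarrow> integrable M (\<lambda>\<omega>. (X t \<omega>)\<^sup>2)"
    "0 \<le> T \<Longrightarrow> \<exists>C. \<forall>t\<in>{0..T}. (\<integral>\<omega>. (X t \<omega>)\<^sup>2 \<partial>M) \<le> C"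
  using assms unfolding L2_process_def by (blast, blast, force, meson)

lemma L2_process_continuous: "L2_process M X \<Longrightarrow> \<omega> \<in> space M \<Longrightarrow> continuous_on {0..t} (\<lambda>s. X s \<omega>)"
  by (rule continuous_on_subset[OF L2_processD(2)]) auto

context prob_space
begin

lemma L2_process_mult_integrable:
  "L2_process M X \<Longrightarrow> L2_process M Y \<Longrightarrow> 0 \<le> s \<Longrightarrow> 0 \<le> t \<Longrightarrow> integrable M (\<lambda>\<omega>. X s \<omega> * Y t \<omega>)"
  by (intro integrable_mult_of_squares L2_processD)

text \<open>The product is dominated by the sum of squares, whose mean is bounded on {0..t}; this
  makes it integrable in time and chance together.\<close>

lemma L2_process_fubini:
  assumes X: "L2_process M X" and Y: "L2_process M Y" and t: "0 \<le> t"
  shows "integrable M (\<lambda>\<omega>. integral {0..t} (\<lambda>s. X s \<omega> * Y s \<omega>))"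
    and "(\<lambda>s. expectation (\<lambda>\<omega>. X s \<omega> * Y s \<omega>)) integrable_on {0..t}"
    and "expectation (\<lambda>\<omega>. integral {0..t} (\<lambda>s. X s \<omega> * Y s \<omega>)) = integral {0..t} (\<lambda>s. expectation (\<lambda>\<omega>. X s \<omega> * Y s \<omega>))"
proof -
  interpret P: pair_sigma_finite lborel M ..
  define f where "f s \<omega> = indicator {0..t} s * (X (max 0 s) \<omega> * Y (max 0 s) \<omega>)" for s \<omega>
  note [measurable] = continuous_process_measurable[OF L2_processD(1,2)[OF X]] continuous_process_measurable[OF L2_processD(1,2)[OF Y]]
  have f_meas: "(\<lambda>(s, \<omega>). f s \<omega>) \<in> borel_measurable (lborel \<Otimes>\<^sub>M M)"
    unfolding f_def case_prod_beta by measurable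
  obtain C1 where C1: "\<And>s. s \<in> {0..t} \<Longrightarrow> expectation (\<lambda>\<omega>. (X s \<omega>)\<^sup>2) \<le> C1" using L2_processD(4)[OF X t] by blast
  obtain C2 where C2: "\<And>s. s \<in> {0..t} \<Longrightarrow> expectation (\<lambda>\<omega>. (Y s \<omega>)\<^sup>2) \<le> C2" using L2_processD(4)[OF Y t] by blast
  have int_s: "integrable M (f s)" for s
    unfolding f_def by (intro integrable_mult_right L2_process_mult_integrable X Y) auto
  have bnd: "(\<integral>\<omega>. norm (f s \<omega>) \<partial>M) \<le> (C1 + C2) * indicator {0..t} s" for s
  proof (cases "s \<in> {0..t}")
    case True
    then have "(\<integral>\<omega>. norm (f s \<omega>) \<partial>M) = expectation (\<lambda>\<omega>. \<bar>X s \<omega> * Y s \<omega>\<bar>)" by (simp add: f_def)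
    also have "\<dots> \<le> expectation (\<lambda>\<omega>. (X s \<omega>)\<^sup>2) + expectation (\<lambda>\<omega>. (Y s \<omega>)\<^sup>2)"
      using True by (intro integrable_mult_of_squares L2_processD(1,3)[OF X] L2_processD(1,3)[OF Y]) auto
    also have "\<dots> \<le> C1 + C2" using True by (intro add_mono C1 C2)
    finally show ?thesis using True by simp
  qed (simp add: f_def)
  have Cint: "integrable lborel (\<lambda>s. (C1 + C2) * indicator {0..t} s :: real)"
    by (intro integrable_mult_right) (simp add: emeasure_lborel_Icc_eq)
  have nmeas: "(\<lambda>s. \<integral>\<omega>. norm (f s \<omega>) \<partial>M) \<in> borel_measurable lborel"
    using f_meas by measurable
  have fint: "integrable (lborel \<Otimes>\<^sub>M M) (\<lambda>(s, \<omega>). f s \<omega>)"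
  proof (rule P.Fubini_integrable[OF f_meas])
    show "integrable lborel (\<lambda>s. \<integral>\<omega>. norm (case (s, \<omega>) of (s, \<omega>) \<Rightarrow> f s \<omega>) \<partial>M)"
    proof (rule Bochner_Integration.integrable_bound[OF Cint])
      show "(\<lambda>s. \<integral>\<omega>. norm (case (s, \<omega>) of (s, \<omega>) \<Rightarrow> f s \<omega>) \<partial>M) \<in> borel_measurable lborel" using nmeas by simp
      show "AE s in lborel. norm (\<integral>\<omega>. norm (case (s, \<omega>) of (s, \<omega>) \<Rightarrow> f s \<omega>) \<partial>M) \<le> norm ((C1 + C2) * indicator {0..t} s)"
      proof (rule AE_I2)
        fix s
        have "0 \<le> (\<integral>\<omega>. norm (f s \<omega>) \<partial>M)" by simp
        then show "norm (\<integral>\<omega>. norm (case (s, \<omega>) of (s, \<omega>) \<Rightarrow> f s \<omega>) \<partial>M) \<le> norm ((C1 + C2) * indicator {0..t} s)"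
          using order_trans[OF bnd abs_ge_self, of s] by simp
      qed
    qed
  qed (use int_s in simp)
  have path: "(\<integral>s. f s \<omega> \<partial>lborel) = integral {0..t} (\<lambda>s. X s \<omega> * Y s \<omega>)" if \<omega>: "\<omega> \<in> space M" for \<omega>
  proof -
    have "continuous_on {0..t} (\<lambda>s. X s \<omega> * Y s \<omega>)"
      by (intro continuous_intros L2_process_continuous[OF X \<omega>] L2_process_continuous[OF Y \<omega>])
    then have "set_integrable lborel {0..t} (\<lambda>s. X s \<omega> * Y s \<omega>)" by (intro borel_integrable_atLeastAtMost')
    from set_borel_integral_eq_integral(2)[OF this]
    have "integral {0..t} (\<lambda>s. X s \<omega> * Y s \<omega>) = (\<integral>s. indicator {0..t} s * (X s \<omega> * Y s \<omega>) \<partial>lborel)"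
      by (simp add: set_lebesgue_integral_def)
    also have "\<dots> = (\<integral>s. f s \<omega> \<partial>lborel)"
      unfolding f_def by (intro Bochner_Integration.integral_cong) (auto simp: indicator_def)
    finally show ?thesis by simp
  qed
  have sec: "(\<integral>\<omega>. f s \<omega> \<partial>M) = indicator {0..t} s *\<^sub>R expectation (\<lambda>\<omega>. X s \<omega> * Y s \<omega>)" for s
    by (cases "s \<in> {0..t}") (auto simp: f_def)
  have "integrable M (\<lambda>\<omega>. \<integral>s. f s \<omega> \<partial>lborel)" using P.integrable_snd[OF fint] by simp
  then show "integrable M (\<lambda>\<omega>. integral {0..t} (\<lambda>s. X s \<omega> * Y s \<omega>))"
    by (subst Bochner_Integration.integrable_cong[OF refl path[symmetric]]) auto
  have "integrable lborel (\<lambda>s. \<integral>\<omega>. f s \<omega> \<partial>M)" using P.integrable_fst'[OF fint] by simp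
  then have si: "set_integrable lborel {0..t} (\<lambda>s. expectation (\<lambda>\<omega>. X s \<omega> * Y s \<omega>))"
    by (simp add: set_integrable_def sec)
  show "(\<lambda>s. expectation (\<lambda>\<omega>. X s \<omega> * Y s \<omega>)) integrable_on {0..t}" by (rule set_borel_integral_eq_integral(1)[OF si])
  have "expectation (\<lambda>\<omega>. integral {0..t} (\<lambda>s. X s \<omega> * Y s \<omega>)) = (\<integral>\<omega>. (\<integral>s. f s \<omega> \<partial>lborel) \<partial>M)"
    by (rule Bochner_Integration.integral_cong) (simp_all add: path)
  also have "\<dots> = (\<integral>s. (\<integral>\<omega>. f s \<omega> \<partial>M) \<partial>lborel)" by (rule P.Fubini_integral[OF fint])
  also have "\<dots> = integral {0..t} (\<lambda>s. expectation (\<lambda>\<omega>. X s \<omega> * Y s \<omega>))"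
    using set_borel_integral_eq_integral(2)[OF si] by (simp add: set_lebesgue_integral_def sec)
  finally show "expectation (\<lambda>\<omega>. integral {0..t} (\<lambda>s. X s \<omega> * Y s \<omega>)) = integral {0..t} (\<lambda>s. expectation (\<lambda>\<omega>. X s \<omega> * Y s \<omega>))" .
qed

lemma L2_process_const: "X \<in> borel_measurable M \<Longrightarrow> integrable M (\<lambda>\<omega>. (X \<omega>)\<^sup>2) \<Longrightarrow> L2_process M (\<lambda>_. X)"
  unfolding L2_process_def by auto

lemma L2_process_dominated:
  assumes m: "\<And>t. 0 \<le> t \<Longrightarrow> X t \<in> borel_measurable M"
    and c: "\<And>\<omega>. \<omega> \<in> space M \<Longrightarrow> continuous_on {0..} (\<lambda>t. X t \<omega>)"
    and Z: "\<And>t. 0 \<le> t \<Longrightarrow> integrable M (Z t)" "\<And>T. 0 \<le> T \<Longrightarrow> \<exists>C. \<forall>t\<in>{0..T}. expectation (Z t) \<le> C"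
    and le: "\<And>t. 0 \<le> t \<Longrightarrow> AE \<omega> in M. (X t \<omega>)\<^sup>2 \<le> Z t \<omega>"
  shows "L2_process M X"
  unfolding L2_process_def
proof (intro conjI allI impI ballI)
  have int: "integrable M (\<lambda>\<omega>. (X t \<omega>)\<^sup>2)" if "0 \<le> t" for t
  proof (rule Bochner_Integration.integrable_bound[OF Z(1)[OF that]])
    show "(\<lambda>\<omega>. (X t \<omega>)\<^sup>2) \<in> borel_measurable M" using m[OF that] by measurable
    show "AE \<omega> in M. norm ((X t \<omega>)\<^sup>2) \<le> norm (Z t \<omega>)" using le[OF that] by eventually_elim simp
  qed
  fix T :: real assume "0 \<le> T"
  with Z(2) obtain C where C: "\<And>t. t \<in> {0..T} \<Longrightarrow> expectation (Z t) \<le> C" by blast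
  show "\<exists>C. \<forall>t\<in>{0..T}. integrable M (\<lambda>\<omega>. (X t \<omega>)\<^sup>2) \<and> expectation (\<lambda>\<omega>. (X t \<omega>)\<^sup>2) \<le> C"
  proof (intro exI ballI conjI)
    fix t assume t: "t \<in> {0..T}"
    then show "integrable M (\<lambda>\<omega>. (X t \<omega>)\<^sup>2)" by (intro int) auto
    have "expectation (\<lambda>\<omega>. (X t \<omega>)\<^sup>2) \<le> expectation (Z t)"
      using t by (intro integral_mono_AE int Z(1) le) auto
    also have "\<dots> \<le> C" by (rule C[OF t])
    finally show "expectation (\<lambda>\<omega>. (X t \<omega>)\<^sup>2) \<le> C" .
  qed
qed (use m c in auto)

lemma L2_process_add:
  assumes X: "L2_process M X" and Y: "L2_process M Y"
  shows "L2_process M (\<lambda>t \<omega>. X t \<omega> + Y t \<omega>)"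
proof (rule L2_process_dominated[where Z="\<lambda>t \<omega>. 2 * (X t \<omega>)\<^sup>2 + 2 * (Y t \<omega>)\<^sup>2"])
  fix T :: real assume T: "0 \<le> T"
  obtain C1 where C1: "\<And>s. s \<in> {0..T} \<Longrightarrow> expectation (\<lambda>\<omega>. (X s \<omega>)\<^sup>2) \<le> C1" using L2_processD(4)[OF X T] by blast
  obtain C2 where C2: "\<And>s. s \<in> {0..T} \<Longrightarrow> expectation (\<lambda>\<omega>. (Y s \<omega>)\<^sup>2) \<le> C2" using L2_processD(4)[OF Y T] by blast
  show "\<exists>C. \<forall>t\<in>{0..T}. expectation (\<lambda>\<omega>. 2 * (X t \<omega>)\<^sup>2 + 2 * (Y t \<omega>)\<^sup>2) \<le> C"
  proof (intro exI ballI)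
    fix t assume t: "t \<in> {0..T}"
    have "expectation (\<lambda>\<omega>. 2 * (X t \<omega>)\<^sup>2 + 2 * (Y t \<omega>)\<^sup>2) = 2 * expectation (\<lambda>\<omega>. (X t \<omega>)\<^sup>2) + 2 * expectation (\<lambda>\<omega>. (Y t \<omega>)\<^sup>2)"
      using L2_processD(3)[OF X] L2_processD(3)[OF Y] t by (subst Bochner_Integration.integral_add) auto
    also have "\<dots> \<le> 2 * C1 + 2 * C2" using C1[OF t] C2[OF t] by simp
    finally show "expectation (\<lambda>\<omega>. 2 * (X t \<omega>)\<^sup>2 + 2 * (Y t \<omega>)\<^sup>2) \<le> 2 * C1 + 2 * C2" .
  qed
qed (use L2_processD(1-3)[OF X] L2_processD(1-3)[OF Y] in
    \<open>auto intro!: borel_measurable_add continuous_on_add integrable_mult_right simp: square_sum_le_double\<close>)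

lemma L2_process_cmult:
  assumes X: "L2_process M X"
  shows "L2_process M (\<lambda>t \<omega>. c * X t \<omega>)"
proof (rule L2_process_dominated[where Z="\<lambda>t \<omega>. c\<^sup>2 * (X t \<omega>)\<^sup>2"])
  fix T :: real assume T: "0 \<le> T"
  obtain C1 where C1: "\<And>s. s \<in> {0..T} \<Longrightarrow> expectation (\<lambda>\<omega>. (X s \<omega>)\<^sup>2) \<le> C1" using L2_processD(4)[OF X T] by blast
  then show "\<exists>C. \<forall>t\<in>{0..T}. expectation (\<lambda>\<omega>. c\<^sup>2 * (X t \<omega>)\<^sup>2) \<le> C"
    by (intro exI[of _ "c\<^sup>2 * C1"] ballI) (simp add: mult_left_mono)
qed (use L2_processD(1-3)[OF X] in
    \<open>auto intro!: borel_measurable_times continuous_on_mult continuous_on_const simp: power_mult_distrib\<close>)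

lemma L2_process_square_integral:
  assumes X: "L2_process M X" and T: "0 \<le> T"
  shows "\<exists>C\<ge>0. \<forall>t\<in>{0..T}. expectation (\<lambda>\<omega>. integral {0..t} (\<lambda>s. (X s \<omega>)\<^sup>2)) \<le> C"
proof -
  obtain C where C: "\<And>s. s \<in> {0..T} \<Longrightarrow> expectation (\<lambda>\<omega>. (X s \<omega>)\<^sup>2) \<le> C" using L2_processD(4)[OF X T] by blast
  have "0 \<le> expectation (\<lambda>\<omega>. (X 0 \<omega>)\<^sup>2)" by simp
  then have C0: "0 \<le> C" using C[of 0] T by (meson atLeastAtMost_iff order_refl order_trans)
  have "expectation (\<lambda>\<omega>. integral {0..t} (\<lambda>s. (X s \<omega>)\<^sup>2)) \<le> T * C" if t: "t \<in> {0..T}" for t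
  proof -
    have t0: "0 \<le> t" using t by simp
    have "expectation (\<lambda>\<omega>. integral {0..t} (\<lambda>s. (X s \<omega>)\<^sup>2)) = integral {0..t} (\<lambda>s. expectation (\<lambda>\<omega>. (X s \<omega>)\<^sup>2))"
      using L2_process_fubini(3)[OF X X t0] by (simp add: power2_eq_square)
    also have "\<dots> \<le> integral {0..t} (\<lambda>s. C)"
      using L2_process_fubini(2)[OF X X t0] t by (intro integral_le C) (auto simp: power2_eq_square)
    also have "\<dots> = t * C" using t0 by simp
    also have "\<dots> \<le> T * C" using t C0 by (intro mult_right_mono) auto
    finally show ?thesis .
  qed
  then show ?thesis using C0 T by (intro exI[of _ "T * C"]) auto
qed

lemma L2_process_integral:
  assumes X: "L2_process M X"
  shows "L2_process M (\<lambda>t \<omega>. integral {0..t} (\<lambda>s. X s \<omega>))"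
proof (rule L2_process_dominated[where Z="\<lambda>t \<omega>. t * integral {0..t} (\<lambda>s. (X s \<omega>)\<^sup>2)"])
  fix t :: real assume t: "0 \<le> t"
  show "(\<lambda>\<omega>. integral {0..t} (\<lambda>s. X s \<omega>)) \<in> borel_measurable M"
  proof (cases "t = 0")
    case False
    then show ?thesis using t
      by (intro integral_measurable L2_processD(1)[OF X] L2_process_continuous[OF X]) auto
  qed simp
  show "integrable M (\<lambda>\<omega>. t * integral {0..t} (\<lambda>s. (X s \<omega>)\<^sup>2))"
    using L2_process_fubini(1)[OF X X t] by (simp add: power2_eq_square)
  show "AE \<omega> in M. (integral {0..t} (\<lambda>s. X s \<omega>))\<^sup>2 \<le> t * integral {0..t} (\<lambda>s. (X s \<omega>)\<^sup>2)"
    by (intro AE_I2 integral_square_le t L2_process_continuous[OF X])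
next
  fix T :: real assume T: "0 \<le> T"
  obtain C where C: "0 \<le> C" "\<And>t. t \<in> {0..T} \<Longrightarrow> expectation (\<lambda>\<omega>. integral {0..t} (\<lambda>s. (X s \<omega>)\<^sup>2)) \<le> C"
    using L2_process_square_integral[OF X T] by blast
  show "\<exists>C. \<forall>t\<in>{0..T}. expectation (\<lambda>\<omega>. t * integral {0..t} (\<lambda>s. (X s \<omega>)\<^sup>2)) \<le> C"
  proof (intro exI ballI)
    fix t assume t: "t \<in> {0..T}"
    have "expectation (\<lambda>\<omega>. t * integral {0..t} (\<lambda>s. (X s \<omega>)\<^sup>2)) = t * expectation (\<lambda>\<omega>. integral {0..t} (\<lambda>s. (X s \<omega>)\<^sup>2))"
      by simp
    also have "\<dots> \<le> t * C" using C(2)[OF t] t by (intro mult_left_mono) auto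
    also have "\<dots> \<le> T * C" using t C(1) by (intro mult_right_mono) auto
    finally show "expectation (\<lambda>\<omega>. t * integral {0..t} (\<lambda>s. (X s \<omega>)\<^sup>2)) \<le> T * C" .
  qed
qed (use continuous_on_integral_upto[OF L2_processD(2)[OF X]] in auto)

text \<open>The martingale property turns \<open>V t\<close> into \<open>V s\<close> under the time integral, so the cross terms
  recombine to \<open>X s\<close> and \<open>Y s\<close>.\<close>

lemma product_expectation:
  assumes A: "L2_process M A" and B: "L2_process M B" and U: "L2_process M U" and V: "L2_process M V"
    and X: "L2_process M X" "\<And>t. 0 \<le> t \<Longrightarrow> AE \<omega> in M. X t \<omega> = integral {0..t} (\<lambda>s. A s \<omega>) + U t \<omega>"
    and Y: "L2_process M Y" "\<And>t. 0 \<le> t \<Longrightarrow> AE \<omega> in M. Y t \<omega> = integral {0..t} (\<lambda>s. B s \<omega>) + V t \<omega>"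
    and UV: "\<And>t. 0 \<le> t \<Longrightarrow> expectation (\<lambda>\<omega>. U t \<omega> * V t \<omega>) = C * t"
    and AV: "\<And>s t. 0 \<le> s \<Longrightarrow> s \<le> t \<Longrightarrow> expectation (\<lambda>\<omega>. A s \<omega> * V t \<omega>) = expectation (\<lambda>\<omega>. A s \<omega> * V s \<omega>)"
    and BU: "\<And>s t. 0 \<le> s \<Longrightarrow> s \<le> t \<Longrightarrow> expectation (\<lambda>\<omega>. B s \<omega> * U t \<omega>) = expectation (\<lambda>\<omega>. B s \<omega> * U s \<omega>)"
    and t: "0 \<le> t"
  shows "expectation (\<lambda>\<omega>. X t \<omega> * Y t \<omega>) =
      integral {0..t} (\<lambda>s. expectation (\<lambda>\<omega>. A s \<omega> * Y s \<omega>) + expectation (\<lambda>\<omega>. B s \<omega> * X s \<omega>)) + C * t"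
proof -
  define I where "I t \<omega> = integral {0..t} (\<lambda>s. A s \<omega>)" for t \<omega>
  define J where "J t \<omega> = integral {0..t} (\<lambda>s. B s \<omega>)" for t \<omega>
  have I: "L2_process M I" unfolding I_def[abs_def] by (rule L2_process_integral[OF A])
  have J: "L2_process M J" unfolding J_def[abs_def] by (rule L2_process_integral[OF B])
  note mi = L2_process_mult_integrable
  note fub = L2_process_fubini
  have "expectation (\<lambda>\<omega>. X t \<omega> * Y t \<omega>) = expectation (\<lambda>\<omega>. (I t \<omega> + U t \<omega>) * (J t \<omega> + V t \<omega>))"
  proof (rule integral_cong_AE)
    show "AE \<omega> in M. X t \<omega> * Y t \<omega> = (I t \<omega> + U t \<omega>) * (J t \<omega> + V t \<omega>)"
      using X(2)[OF t] Y(2)[OF t] by eventually_elim (simp add: I_def J_def)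
  qed (intro borel_measurable_times borel_measurable_add L2_processD(1)[OF X(1) t] L2_processD(1)[OF Y(1) t]
      L2_processD(1)[OF I t] L2_processD(1)[OF J t] L2_processD(1)[OF U t] L2_processD(1)[OF V t])+
  also have "\<dots> = expectation (\<lambda>\<omega>. (I t \<omega> * J t \<omega> + I t \<omega> * V t \<omega>) + (J t \<omega> * U t \<omega> + U t \<omega> * V t \<omega>))"
    by (rule Bochner_Integration.integral_cong) (auto simp: algebra_simps)
  also have "\<dots> = (expectation (\<lambda>\<omega>. I t \<omega> * J t \<omega>) + expectation (\<lambda>\<omega>. I t \<omega> * V t \<omega>))
      + (expectation (\<lambda>\<omega>. J t \<omega> * U t \<omega>) + C * t)"
    using mi[OF I J t t] mi[OF I V t t] mi[OF J U t t] mi[OF U V t t] UV[OF t] by simp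
  also have "expectation (\<lambda>\<omega>. I t \<omega> * V t \<omega>) = integral {0..t} (\<lambda>s. expectation (\<lambda>\<omega>. A s \<omega> * V s \<omega>))"
  proof -
    have Vc: "L2_process M (\<lambda>_. V t)" by (rule L2_process_const[OF L2_processD(1,3)[OF V t]])
    have "expectation (\<lambda>\<omega>. I t \<omega> * V t \<omega>) = expectation (\<lambda>\<omega>. integral {0..t} (\<lambda>s. A s \<omega> * V t \<omega>))"
      unfolding I_def by simp
    also have "\<dots> = integral {0..t} (\<lambda>s. expectation (\<lambda>\<omega>. A s \<omega> * V t \<omega>))" by (rule fub(3)[OF A Vc t])
    also have "\<dots> = integral {0..t} (\<lambda>s. expectation (\<lambda>\<omega>. A s \<omega> * V s \<omega>))" by (intro integral_cong AV) auto
    finally show ?thesis .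
  qed
  also have "expectation (\<lambda>\<omega>. J t \<omega> * U t \<omega>) = integral {0..t} (\<lambda>s. expectation (\<lambda>\<omega>. B s \<omega> * U s \<omega>))"
  proof -
    have Uc: "L2_process M (\<lambda>_. U t)" by (rule L2_process_const[OF L2_processD(1,3)[OF U t]])
    have "expectation (\<lambda>\<omega>. J t \<omega> * U t \<omega>) = expectation (\<lambda>\<omega>. integral {0..t} (\<lambda>s. B s \<omega> * U t \<omega>))"
      unfolding J_def by simp
    also have "\<dots> = integral {0..t} (\<lambda>s. expectation (\<lambda>\<omega>. B s \<omega> * U t \<omega>))" by (rule fub(3)[OF B Uc t])
    also have "\<dots> = integral {0..t} (\<lambda>s. expectation (\<lambda>\<omega>. B s \<omega> * U s \<omega>))" by (intro integral_cong BU) auto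
    finally show ?thesis .
  qed
  also have "expectation (\<lambda>\<omega>. I t \<omega> * J t \<omega>) =
      integral {0..t} (\<lambda>s. expectation (\<lambda>\<omega>. A s \<omega> * J s \<omega>)) + integral {0..t} (\<lambda>s. expectation (\<lambda>\<omega>. B s \<omega> * I s \<omega>))"
  proof -
    have "expectation (\<lambda>\<omega>. I t \<omega> * J t \<omega>) =
      expectation (\<lambda>\<omega>. integral {0..t} (\<lambda>s. A s \<omega> * J s \<omega>) + integral {0..t} (\<lambda>s. B s \<omega> * I s \<omega>))"
    proof (rule Bochner_Integration.integral_cong[OF refl])
      fix \<omega> assume \<omega>: "\<omega> \<in> space M"
      note c = L2_process_continuous[OF A \<omega>] L2_process_continuous[OF B \<omega>] L2_process_continuous[OF I \<omega>] L2_process_continuous[OF J \<omega>]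
      have "I t \<omega> * J t \<omega> = integral {0..t} (\<lambda>s. A s \<omega> * J s \<omega> + I s \<omega> * B s \<omega>)"
        unfolding I_def J_def by (rule product_rule_integral[OF t c(1,2)])
      also have "\<dots> = integral {0..t} (\<lambda>s. A s \<omega> * J s \<omega>) + integral {0..t} (\<lambda>s. I s \<omega> * B s \<omega>)"
        by (intro Henstock_Kurzweil_Integration.integral_add integrable_continuous_real continuous_on_mult c)
      finally show "I t \<omega> * J t \<omega> = integral {0..t} (\<lambda>s. A s \<omega> * J s \<omega>) + integral {0..t} (\<lambda>s. B s \<omega> * I s \<omega>)"
        by (simp add: mult.commute)
    qed
    also have "\<dots> = integral {0..t} (\<lambda>s. expectation (\<lambda>\<omega>. A s \<omega> * J s \<omega>)) + integral {0..t} (\<lambda>s. expectation (\<lambda>\<omega>. B s \<omega> * I s \<omega>))"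
      by (simp only: Bochner_Integration.integral_add[OF fub(1)[OF A J t] fub(1)[OF B I t]] fub(3)[OF A J t] fub(3)[OF B I t])
    finally show ?thesis .
  qed
  finally have *: "expectation (\<lambda>\<omega>. X t \<omega> * Y t \<omega>) =
     (integral {0..t} (\<lambda>s. expectation (\<lambda>\<omega>. A s \<omega> * J s \<omega>)) + integral {0..t} (\<lambda>s. expectation (\<lambda>\<omega>. A s \<omega> * V s \<omega>)))
     + (integral {0..t} (\<lambda>s. expectation (\<lambda>\<omega>. B s \<omega> * I s \<omega>)) + integral {0..t} (\<lambda>s. expectation (\<lambda>\<omega>. B s \<omega> * U s \<omega>))) + C * t"
    by simp
  have AY: "expectation (\<lambda>\<omega>. A s \<omega> * Y s \<omega>) = expectation (\<lambda>\<omega>. A s \<omega> * J s \<omega>) + expectation (\<lambda>\<omega>. A s \<omega> * V s \<omega>)"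
    if s: "0 \<le> s" for s
  proof -
    have "expectation (\<lambda>\<omega>. A s \<omega> * Y s \<omega>) = expectation (\<lambda>\<omega>. A s \<omega> * J s \<omega> + A s \<omega> * V s \<omega>)"
    proof (rule integral_cong_AE)
      show "AE \<omega> in M. A s \<omega> * Y s \<omega> = A s \<omega> * J s \<omega> + A s \<omega> * V s \<omega>"
        using Y(2)[OF s] by eventually_elim (simp add: J_def distrib_left)
    qed (intro borel_measurable_times borel_measurable_add L2_processD(1)[OF A s] L2_processD(1)[OF Y(1) s]
      L2_processD(1)[OF J s] L2_processD(1)[OF V s])+
    then show ?thesis using mi[OF A J s s] mi[OF A V s s] by simp
  qed
  have BX: "expectation (\<lambda>\<omega>. B s \<omega> * X s \<omega>) = expectation (\<lambda>\<omega>. B s \<omega> * I s \<omega>) + expectation (\<lambda>\<omega>. B s \<omega> * U s \<omega>)"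
    if s: "0 \<le> s" for s
  proof -
    have "expectation (\<lambda>\<omega>. B s \<omega> * X s \<omega>) = expectation (\<lambda>\<omega>. B s \<omega> * I s \<omega> + B s \<omega> * U s \<omega>)"
    proof (rule integral_cong_AE)
      show "AE \<omega> in M. B s \<omega> * X s \<omega> = B s \<omega> * I s \<omega> + B s \<omega> * U s \<omega>"
        using X(2)[OF s] by eventually_elim (simp add: I_def distrib_left)
    qed (intro borel_measurable_times borel_measurable_add L2_processD(1)[OF B s] L2_processD(1)[OF X(1) s]
      L2_processD(1)[OF I s] L2_processD(1)[OF U s])+
    then show ?thesis using mi[OF B I s s] mi[OF B U s s] by simp
  qed
  have "integral {0..t} (\<lambda>s. expectation (\<lambda>\<omega>. A s \<omega> * Y s \<omega>) + expectation (\<lambda>\<omega>. B s \<omega> * X s \<omega>))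
    = integral {0..t} (\<lambda>s. expectation (\<lambda>\<omega>. A s \<omega> * Y s \<omega>)) + integral {0..t} (\<lambda>s. expectation (\<lambda>\<omega>. B s \<omega> * X s \<omega>))"
    by (intro Henstock_Kurzweil_Integration.integral_add fub(2)[OF A Y(1) t] fub(2)[OF B X(1) t])
  also have "integral {0..t} (\<lambda>s. expectation (\<lambda>\<omega>. A s \<omega> * Y s \<omega>)) =
     integral {0..t} (\<lambda>s. expectation (\<lambda>\<omega>. A s \<omega> * J s \<omega>) + expectation (\<lambda>\<omega>. A s \<omega> * V s \<omega>))"
    using AY by (intro integral_cong) auto
  also have "\<dots> = integral {0..t} (\<lambda>s. expectation (\<lambda>\<omega>. A s \<omega> * J s \<omega>)) + integral {0..t} (\<lambda>s. expectation (\<lambda>\<omega>. A s \<omega> * V s \<omega>))"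
    by (intro Henstock_Kurzweil_Integration.integral_add fub(2)[OF A J t] fub(2)[OF A V t])
  also have "integral {0..t} (\<lambda>s. expectation (\<lambda>\<omega>. B s \<omega> * X s \<omega>)) =
     integral {0..t} (\<lambda>s. expectation (\<lambda>\<omega>. B s \<omega> * I s \<omega>) + expectation (\<lambda>\<omega>. B s \<omega> * U s \<omega>))"
    using BX by (intro integral_cong) auto
  also have "\<dots> = integral {0..t} (\<lambda>s. expectation (\<lambda>\<omega>. B s \<omega> * I s \<omega>)) + integral {0..t} (\<lambda>s. expectation (\<lambda>\<omega>. B s \<omega> * U s \<omega>))"
    by (intro Henstock_Kurzweil_Integration.integral_add fub(2)[OF B I t] fub(2)[OF B U t])
  finally show "expectation (\<lambda>\<omega>. X t \<omega> * Y t \<omega>) =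
      integral {0..t} (\<lambda>s. expectation (\<lambda>\<omega>. A s \<omega> * Y s \<omega>) + expectation (\<lambda>\<omega>. B s \<omega> * X s \<omega>)) + C * t"
    using * by simp
qed

text \<open>The pathwise bound for linear integral equations furnishes an integrable majorant of
  X^2. The equation must hold at all times outside one null set, because the bound at t uses it at
  every earlier time.\<close>

lemma L2_process_linear_equation:
  assumes \<kappa>: "0 \<le> \<kappa>" and R: "L2_process M R"
    and X: "\<And>t. 0 \<le> t \<Longrightarrow> X t \<in> borel_measurable M" "\<And>\<omega>. \<omega> \<in> space M \<Longrightarrow> continuous_on {0..} (\<lambda>t. X t \<omega>)"
    and eq: "AE \<omega> in M. \<forall>t\<ge>0. X t \<omega> = - \<kappa> * integral {0..t} (\<lambda>s. X s \<omega>) + R t \<omega>"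
  shows "L2_process M X"
proof (rule L2_process_dominated[where Z="\<lambda>t \<omega>. 2 * (R t \<omega>)\<^sup>2 + 2 * \<kappa>\<^sup>2 * (t * integral {0..t} (\<lambda>s. (R s \<omega>)\<^sup>2))"])
  have int: "integrable M (\<lambda>\<omega>. integral {0..t} (\<lambda>s. (R s \<omega>)\<^sup>2))" if "0 \<le> t" for t
    using L2_process_fubini(1)[OF R R that] by (simp add: power2_eq_square)
  show "integrable M (\<lambda>\<omega>. 2 * (R t \<omega>)\<^sup>2 + 2 * \<kappa>\<^sup>2 * (t * integral {0..t} (\<lambda>s. (R s \<omega>)\<^sup>2)))" if "0 \<le> t" for t
    by (intro Bochner_Integration.integrable_add integrable_mult_right int L2_processD(3)[OF R] that)
  show "AE \<omega> in M. (X t \<omega>)\<^sup>2 \<le> 2 * (R t \<omega>)\<^sup>2 + 2 * \<kappa>\<^sup>2 * (t * integral {0..t} (\<lambda>s. (R s \<omega>)\<^sup>2))" if t: "0 \<le> t" for t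
    using eq AE_space
  proof eventually_elim
    case (elim \<omega>)
    show ?case
      by (rule linear_integral_equation_bound[where x="\<lambda>s. X s \<omega>" and R="\<lambda>s. R s \<omega>",
            OF \<kappa> t X(2)[OF elim(2)] L2_processD(2)[OF R elim(2)]]) (use elim in auto)
  qed
  fix T :: real assume T: "0 \<le> T"
  obtain C1 where C1: "\<And>s. s \<in> {0..T} \<Longrightarrow> expectation (\<lambda>\<omega>. (R s \<omega>)\<^sup>2) \<le> C1" using L2_processD(4)[OF R T] by blast
  obtain C where C: "0 \<le> C" "\<And>t. t \<in> {0..T} \<Longrightarrow> expectation (\<lambda>\<omega>. integral {0..t} (\<lambda>s. (R s \<omega>)\<^sup>2)) \<le> C"
    using L2_process_square_integral[OF R T] by blast
  show "\<exists>C. \<forall>t\<in>{0..T}. expectation (\<lambda>\<omega>. 2 * (R t \<omega>)\<^sup>2 + 2 * \<kappa>\<^sup>2 * (t * integral {0..t} (\<lambda>s. (R s \<omega>)\<^sup>2))) \<le> C"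
  proof (intro exI ballI)
    fix t assume t: "t \<in> {0..T}"
    have "expectation (\<lambda>\<omega>. 2 * (R t \<omega>)\<^sup>2 + 2 * \<kappa>\<^sup>2 * (t * integral {0..t} (\<lambda>s. (R s \<omega>)\<^sup>2))) =
      2 * expectation (\<lambda>\<omega>. (R t \<omega>)\<^sup>2) + 2 * \<kappa>\<^sup>2 * (t * expectation (\<lambda>\<omega>. integral {0..t} (\<lambda>s. (R s \<omega>)\<^sup>2)))"
      using L2_processD(3)[OF R, of t] int[of t] t by (subst Bochner_Integration.integral_add) auto
    also have "\<dots> \<le> 2 * C1 + 2 * \<kappa>\<^sup>2 * (T * C)"
    proof -
      have "t * expectation (\<lambda>\<omega>. integral {0..t} (\<lambda>s. (R s \<omega>)\<^sup>2)) \<le> t * C" using C(2)[OF t] t by (intro mult_left_mono) auto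
      also have "\<dots> \<le> T * C" using t C(1) by (intro mult_right_mono) auto
      finally show ?thesis using C1[OF t] by (intro add_mono mult_left_mono) auto
    qed
    finally show "expectation (\<lambda>\<omega>. 2 * (R t \<omega>)\<^sup>2 + 2 * \<kappa>\<^sup>2 * (t * integral {0..t} (\<lambda>s. (R s \<omega>)\<^sup>2))) \<le> 2 * C1 + 2 * \<kappa>\<^sup>2 * (T * C)" .
  qed
qed (use X in auto)

end

section \<open>The coordinates of a planar Wiener process\<close>

lemma (in prob_space) indep_var_of_indep_set:
  fixes Z :: "'a \<Rightarrow> real" and \<pi> :: "'b::topological_space \<Rightarrow> real"
  assumes ind: "indep_set (sets G) {V -` A \<inter> space M | A. A \<in> sets borel}"
    and G: "subalgebra M G" and Z: "Z \<in> borel_measurable G"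
    and V: "V \<in> borel_measurable M" and \<pi>: "\<pi> \<in> borel_measurable borel"
  shows "indep_var borel Z borel (\<lambda>\<omega>. \<pi> (V \<omega>))"
proof -
  have sp: "space G = space M" using G by (simp add: subalgebra_def)
  have "sigma_sets (space G) {Z -` A \<inter> space G | A. A \<in> sets borel} \<subseteq> sets G"
    by (rule sets.sigma_sets_subset) (use Z in \<open>auto simp: measurable_def\<close>)
  then have 1: "sigma_sets (space M) {Z -` A \<inter> space M | A. A \<in> sets borel} \<subseteq> sets G" by (simp add: sp)
  have 2: "sigma_sets (space M) {(\<lambda>\<omega>. \<pi> (V \<omega>)) -` A \<inter> space M | A. A \<in> sets borel} \<subseteq> {V -` A \<inter> space M | A. A \<in> sets borel}"
  proof -
    have "sigma_sets (space M) {(\<lambda>\<omega>. \<pi> (V \<omega>)) -` A \<inter> space M | A. A \<in> sets borel} =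
      {(\<lambda>\<omega>. \<pi> (V \<omega>)) -` A \<inter> space M | A. A \<in> sets borel}"
      unfolding sets_vimage_algebra[symmetric] by (rule sets_vimage_algebra2) simp
    also have "\<dots> \<subseteq> {V -` A \<inter> space M | A. A \<in> sets borel}"
    proof clarify
      fix A :: "real set" assume "A \<in> sets borel"
      then have "\<pi> -` A \<in> sets borel" using measurable_sets[OF \<pi>, of A] by simp
      moreover have "(\<lambda>\<omega>. \<pi> (V \<omega>)) -` A \<inter> space M = V -` (\<pi> -` A) \<inter> space M" by auto
      ultimately show "\<exists>B. (\<lambda>\<omega>. \<pi> (V \<omega>)) -` A \<inter> space M = V -` B \<inter> space M \<and> B \<in> sets borel" by blast
    qed
    finally show ?thesis .
  qed
  have "random_variable borel Z" using measurable_from_subalg[OF G Z] .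
  moreover have "random_variable borel (\<lambda>\<omega>. \<pi> (V \<omega>))" by (rule measurable_compose[OF V \<pi>])
  moreover have "indep_set (sigma_sets (space M) {Z -` A \<inter> space M | A. A \<in> sets borel})
    (sigma_sets (space M) {(\<lambda>\<omega>. \<pi> (V \<omega>)) -` A \<inter> space M | A. A \<in> sets borel})"
    by (rule indep_setI[OF order_trans[OF 1 indep_setD_ev1[OF ind]] order_trans[OF 2 indep_setD_ev2[OF ind]]])
      (rule indep_setD[OF ind subsetD[OF 1] subsetD[OF 2]])
  ultimately show ?thesis unfolding indep_var_eq by (intro conjI)
qed

lemma nn_integral_normal_density: "0 < \<sigma> \<Longrightarrow> (\<integral>\<^sup>+x. ennreal (normal_density 0 \<sigma> x) \<partial>lborel) = 1"
  by (subst nn_integral_eq_integral) auto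

text \<open>Each coordinate density is obtained by integrating out the other, a probability density.
  Independence of the past passes to a coordinate since a projection generates a smaller family of
  events.\<close>

lemma wiener_process2_brownian:
  assumes fp: "filtered_prob_space M F" and w: "wiener_process2 M F W1 W2"
  shows "brownian M F W1" and "brownian M F W2"
proof -
  interpret prob_space M using fp by (simp add: filtered_prob_space_def)
  have sub: "subalgebra M (F t)" for t using fp by (simp add: filtered_prob_space_def)
  have mono: "subalgebra (F t) (F s)" if "s \<le> t" for s t
    using fp that filtration.space_F filtration.sets_F_mono
    unfolding filtered_prob_space_def subalgebra_def by metis
  define V where "V s t \<omega> = (W1 t \<omega> - W1 s \<omega>, W2 t \<omega> - W2 s \<omega>)" for s t \<omega>
  define f where "f s t x = normal_density 0 (sqrt (t - s)) x" for s t x :: real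
  have D: "distributed M (lborel \<Otimes>\<^sub>M lborel) (\<lambda>\<omega>. (W1 t \<omega> - W1 s \<omega>, W2 t \<omega> - W2 s \<omega>)) (\<lambda>(x, y). ennreal (f s t x * f s t y))"
    and I: "indep_set (sets (F s)) {V s t -` A \<inter> space M | A. A \<in> sets borel}"
    if "0 \<le> s" "s < t" for s t
    using w that unfolding wiener_process2_def lborel_prod V_def f_def by blast+
  have Vm: "V s t \<in> borel_measurable M" if "0 \<le> s" "s < t" for s t
  proof -
    have "(\<lambda>\<omega>. (W1 t \<omega> - W1 s \<omega>, W2 t \<omega> - W2 s \<omega>)) \<in> measurable M (lborel \<Otimes>\<^sub>M lborel)"
      using D[OF that] by (simp add: distributed_def)
    then show ?thesis by (simp add: V_def[abs_def] lborel_prod)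
  qed
  have N: "distributed M lborel (\<lambda>\<omega>. W1 t \<omega> - W1 s \<omega>) (f s t) \<and> distributed M lborel (\<lambda>\<omega>. W2 t \<omega> - W2 s \<omega>) (f s t)"
    if st: "0 \<le> s" "s < t" for s t
  proof -
    have one: "(\<integral>\<^sup>+x. ennreal (f s t x) \<partial>lborel) = 1" using st unfolding f_def by (intro nn_integral_normal_density) simp
    have f0: "0 \<le> f s t x" for x by (simp add: f_def)
    have [measurable]: "f s t \<in> borel_measurable borel" unfolding f_def[abs_def] by measurable
    have 1: "(\<integral>\<^sup>+y. (case (x, y) of (x, y) \<Rightarrow> ennreal (f s t x * f s t y)) \<partial>lborel) = ennreal (f s t x)" for x
      using one f0 by (simp add: ennreal_mult nn_integral_cmult)
    have 2: "(\<integral>\<^sup>+x. (case (x, y) of (x, y) \<Rightarrow> ennreal (f s t x * f s t y)) \<partial>lborel) = ennreal (f s t y)" for y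
      using one f0 by (simp add: ennreal_mult nn_integral_multc)
    show ?thesis
      using distr_marginal1[OF sigma_finite_lborel sigma_finite_lborel D[OF st]]
        distr_marginal2[OF sigma_finite_lborel sigma_finite_lborel D[OF st]]
      unfolding 1 2 by simp
  qed
  have ca: "continuous_adapted M F W1" "continuous_adapted M F W2"
    and st: "AE \<omega> in M. W1 0 \<omega> = 0 \<and> W2 0 \<omega> = 0"
    using w by (auto simp: wiener_process2_def)
  show "brownian M F W1"
  proof unfold_locales
    show "indep_var borel Z borel (\<lambda>\<omega>. W1 t \<omega> - W1 s \<omega>)" if "0 \<le> s" "s < t" "Z \<in> borel_measurable (F s)" for s t Z
      using indep_var_of_indep_set[OF I[OF that(1,2)] sub that(3) Vm[OF that(1,2)], of fst]
      by (simp add: V_def borel_prod[symmetric])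
    show "distributed M lborel (\<lambda>\<omega>. W1 t \<omega> - W1 s \<omega>) (\<lambda>x. ennreal (normal_density 0 (sqrt (t - s)) x))" if "0 \<le> s" "s < t" for s t
      using N[OF that] by (simp add: f_def[abs_def])
    show "AE \<omega> in M. W1 0 \<omega> = 0" using st by eventually_elim simp
  qed (use sub mono ca in \<open>auto simp: continuous_adapted_def\<close>)
  show "brownian M F W2"
  proof unfold_locales
    show "indep_var borel Z borel (\<lambda>\<omega>. W2 t \<omega> - W2 s \<omega>)" if "0 \<le> s" "s < t" "Z \<in> borel_measurable (F s)" for s t Z
      using indep_var_of_indep_set[OF I[OF that(1,2)] sub that(3) Vm[OF that(1,2)], of snd]
      by (simp add: V_def borel_prod[symmetric])
    show "distributed M lborel (\<lambda>\<omega>. W2 t \<omega> - W2 s \<omega>) (\<lambda>x. ennreal (normal_density 0 (sqrt (t - s)) x))" if "0 \<le> s" "s < t" for s t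
      using N[OF that] by (simp add: f_def[abs_def])
    show "AE \<omega> in M. W2 0 \<omega> = 0" using st by eventually_elim simp
  qed (use sub mono ca in \<open>auto simp: continuous_adapted_def\<close>)
qed

context brownian
begin

lemma W_square:
  assumes "0 \<le> t"
  shows "integrable M (\<lambda>\<omega>. (W t \<omega>)\<^sup>2)" and "expectation (\<lambda>\<omega>. (W t \<omega>)\<^sup>2) = t"
proof -
  note [measurable] = W_measurable[OF assms] W_measurable[OF order_refl]
  have ae: "AE \<omega> in M. (W t \<omega>)\<^sup>2 = (W t \<omega> - W 0 \<omega>)\<^sup>2" using W_start by eventually_elim simp
  have "integrable M (\<lambda>\<omega>. (W t \<omega> - W 0 \<omega>)\<^sup>2) \<and> expectation (\<lambda>\<omega>. (W t \<omega> - W 0 \<omega>)\<^sup>2) = t"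
    using increment_moments(1)[of 0 t 2] increment_moments(3)[of 0 t] assms by (cases "t = 0") auto
  moreover have "integrable M (\<lambda>\<omega>. (W t \<omega>)\<^sup>2) = integrable M (\<lambda>\<omega>. (W t \<omega> - W 0 \<omega>)\<^sup>2)"
    by (rule integrable_cong_AE[OF _ _ ae]) measurable
  moreover have "expectation (\<lambda>\<omega>. (W t \<omega>)\<^sup>2) = expectation (\<lambda>\<omega>. (W t \<omega> - W 0 \<omega>)\<^sup>2)"
    by (rule integral_cong_AE[OF _ _ ae]) measurable
  ultimately show "integrable M (\<lambda>\<omega>. (W t \<omega>)\<^sup>2)" "expectation (\<lambda>\<omega>. (W t \<omega>)\<^sup>2) = t" by auto
qed

lemma L2_process_W: "L2_process M W"
  unfolding L2_process_def using W_measurable W_continuous W_square by auto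

lemma martingale_property:
  assumes Z: "Z \<in> borel_measurable (F s)" "integrable M (\<lambda>\<omega>. (Z \<omega>)\<^sup>2)" and st: "0 \<le> s" "s \<le> t"
  shows "expectation (\<lambda>\<omega>. Z \<omega> * W t \<omega>) = expectation (\<lambda>\<omega>. Z \<omega> * W s \<omega>)"
proof (cases "s = t")
  case False
  then have lt: "s < t" using st by simp
  have ZM [measurable]: "Z \<in> borel_measurable M" by (rule M_measurable[OF Z(1)])
  have Zi: "integrable M Z" by (rule square_integrable_imp_integrable[OF ZM Z(2)])
  have Di: "integrable M (\<lambda>\<omega>. W t \<omega> - W s \<omega>)" using increment_moments(1)[OF st(1) lt, of 1] by simp
  note ind = W_indep[OF st(1) lt Z(1)]
  have "expectation (\<lambda>\<omega>. Z \<omega> * (W t \<omega> - W s \<omega>)) = 0"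
    using indep_var_lebesgue_integral[OF ind Zi Di] increment_moments(2)[OF st(1) lt] by simp
  moreover have "expectation (\<lambda>\<omega>. Z \<omega> * W t \<omega>) = expectation (\<lambda>\<omega>. Z \<omega> * (W t \<omega> - W s \<omega>) + Z \<omega> * W s \<omega>)"
    by (rule Bochner_Integration.integral_cong) (auto simp: algebra_simps)
  moreover have "\<dots> = expectation (\<lambda>\<omega>. Z \<omega> * (W t \<omega> - W s \<omega>)) + expectation (\<lambda>\<omega>. Z \<omega> * W s \<omega>)"
    by (intro Bochner_Integration.integral_add indep_var_integrable[OF ind Zi Di]
        integrable_mult_of_squares Z W_square W_measurable ZM st)
  ultimately show ?thesis by simp
qed simp

text \<open>A constant is a simple integrand up to a null set of times, so the constant sequence
  approximates it and uniqueness identifies the integral.\<close>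

lemma has_ito_integral_constant:
  assumes ito: "has_ito_integral M F W H t Y" and t: "0 < t"
    and H: "AE \<omega> in M. \<forall>s\<in>{0..t}. H s \<omega> = \<kappa>"
  shows "AE \<omega> in M. Y \<omega> = \<kappa> * W t \<omega>"
proof -
  define p where "p i = (if i = 0 then 0 else t)" for i :: nat
  define h where "h = simple_process 1 p (\<lambda>_ _::'a. \<kappa>)"
  define J where "J = simple_integral W 1 p (\<lambda>_ _. \<kappa>)"
  have "simple_integrand M F 1 p (\<lambda>_ _. \<kappa>)"
    using t by (auto simp: simple_integrand_def p_def)
  then have el: "elementary h J" unfolding h_def J_def by (rule elementary_simple)
  have Jt: "J t \<omega> = \<kappa> * (W t \<omega> - W 0 \<omega>)" for \<omega>
    using t by (simp add: J_def simple_integral_def p_def)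
  have "(\<integral>\<^sup>+ r\<in>{0..t}. ennreal ((h r \<omega> - \<kappa>)\<^sup>2) \<partial>lborel) = (\<integral>\<^sup>+ (r::real). 0 \<partial>lborel)" for \<omega>
  proof (rule nn_integral_cong_AE)
    \<comment> \<open>The step interval excludes its left end, so the step process differs from
      \<kappa> at r = 0 only.\<close>
    show "AE r in lborel. ennreal ((h r \<omega> - \<kappa>)\<^sup>2) * indicator {0..t} r = 0"
      using AE_lborel_singleton[of 0]
      by eventually_elim (auto simp: h_def simple_process_def p_def indicator_def)
  qed
  then have D: "AE \<omega> in M. (\<lambda>k::nat. \<integral>\<^sup>+ r\<in>{0..t}. ennreal ((h r \<omega> - \<kappa>)\<^sup>2) \<partial>lborel) \<longlonglongrightarrow> 0" by simp
  have "AE \<omega> in M. \<forall>r\<in>{0..t}. \<kappa> = H r \<omega>" using H by eventually_elim simp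
  from ito_subtime[where h="\<lambda>_. h" and J="\<lambda>_. J" and H="\<lambda>_ _. \<kappa>", OF el D ito t order_refl this]
  have "trunc_mean M (\<lambda>\<omega>. (J t \<omega> - Y \<omega>)\<^sup>2) = 0" by (simp add: LIMSEQ_const_iff)
  moreover have "(\<lambda>\<omega>. (J t \<omega> - Y \<omega>)\<^sup>2) \<in> borel_measurable M"
    using elementaryD(2)[OF el, of t] ito t by (auto simp: has_ito_integral_def)
  ultimately have "AE \<omega> in M. (J t \<omega> - Y \<omega>)\<^sup>2 = 0" by (intro trunc_mean_eq_0_AE)
  then show ?thesis using W_start by eventually_elim (simp add: Jt)
qed

text \<open>A stochastic integral comes with an exceptional null set for each time. Here both sides
  have continuous paths, so agreement at countably many dense times gives a single null set for all
  times. The coefficients may be replaced by simpler ones almost surely, as required when 1 / S * S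
  is cancelled.\<close>

lemma ito_differential_constant_diffusion:
  assumes X: "ito_differential M F W X a b"
    and a': "\<And>\<omega>. \<omega> \<in> space M \<Longrightarrow> continuous_on {0..} (\<lambda>t. a' t \<omega>)"
    and ab: "AE \<omega> in M. \<forall>t\<ge>0. a t \<omega> = a' t \<omega> \<and> b t \<omega> = \<kappa>"
  shows "AE \<omega> in M. \<forall>t\<ge>0. X t \<omega> = X 0 \<omega> + integral {0..t} (\<lambda>s. a' s \<omega>) + \<kappa> * W t \<omega>"
proof -
  have Xc: "continuous_on {0..} (\<lambda>t. X t \<omega>)" if "\<omega> \<in> space M" for \<omega>
    using X that by (auto simp: ito_differential_def continuous_adapted_def)
  have LINT_eq: "(LINT s:{0..t}|lborel. a s \<omega>) = integral {0..t} (\<lambda>s. a' s \<omega>)"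
    if "\<omega> \<in> space M" "\<forall>t\<ge>0. a t \<omega> = a' t \<omega> \<and> b t \<omega> = \<kappa>" for t \<omega>
  proof -
    have "(LINT s:{0..t}|lborel. a s \<omega>) = (LINT s:{0..t}|lborel. a' s \<omega>)"
      using that(2) by (intro set_lebesgue_integral_cong) auto
    also have "\<dots> = integral {0..t} (\<lambda>s. a' s \<omega>)"
      by (intro set_borel_integral_eq_integral borel_integrable_atLeastAtMost' continuous_on_subset[OF a'[OF that(1)]]) auto
    finally show ?thesis .
  qed
  have single: "AE \<omega> in M. X t \<omega> = X 0 \<omega> + integral {0..t} (\<lambda>s. a' s \<omega>) + \<kappa> * W t \<omega>" if t: "0 \<le> t" for t
  proof (cases "t = 0")
    case True
    show ?thesis using W_start by eventually_elim (simp add: True)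
  next
    case False
    have "has_ito_integral M F W b t (\<lambda>\<omega>. X t \<omega> - X 0 \<omega> - (LINT s:{0..t}|lborel. a s \<omega>))"
      using X t by (simp add: ito_differential_def)
    moreover have "AE \<omega> in M. \<forall>s\<in>{0..t}. b s \<omega> = \<kappa>" using ab by eventually_elim simp
    ultimately have "AE \<omega> in M. X t \<omega> - X 0 \<omega> - (LINT s:{0..t}|lborel. a s \<omega>) = \<kappa> * W t \<omega>"
      using False t by (intro has_ito_integral_constant) auto
    then show ?thesis using ab AE_space by eventually_elim (simp add: LINT_eq)
  qed
  \<comment> \<open>These times run through all nonnegative rationals.\<close>
  have "AE \<omega> in M. \<forall>(l::nat) (i::int). X (max 0 (of_int i / real (Suc l))) \<omega> = X 0 \<omega>
      + integral {0..max 0 (of_int i / real (Suc l))} (\<lambda>s. a' s \<omega>) + \<kappa> * W (max 0 (of_int i / real (Suc l))) \<omega>"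
    unfolding AE_all_countable by (intro allI single) simp
  then show ?thesis using AE_space
  proof eventually_elim
    case (elim \<omega>)
    show ?case
    proof (intro allI impI)
      fix t :: real assume t: "0 \<le> t"
      define q where "q l = max 0 (of_int \<lfloor>t * real (Suc l)\<rfloor> / real (Suc l))" for l
      have q: "q \<longlonglongrightarrow> t"
        unfolding q_def using tendsto_max[OF tendsto_const[of 0] floor_fraction_tendsto[of t]] t by simp
      have q0: "\<forall>\<^sub>F l in sequentially. q l \<in> {0..}" by (simp add: q_def)
      have "(\<lambda>l. X (q l) \<omega>) \<longlonglongrightarrow> X t \<omega>"
        by (rule continuous_on_tendsto_compose[OF Xc[OF elim(2)] q _ q0]) (use t in simp)
      moreover have "(\<lambda>l. X 0 \<omega> + integral {0..q l} (\<lambda>s. a' s \<omega>) + \<kappa> * W (q l) \<omega>) \<longlonglongrightarrow>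
        X 0 \<omega> + integral {0..t} (\<lambda>s. a' s \<omega>) + \<kappa> * W t \<omega>"
        using t by (intro tendsto_add tendsto_mult tendsto_const
            continuous_on_tendsto_compose[OF continuous_on_integral_upto[OF a'[OF elim(2)]] q _ q0]
            continuous_on_tendsto_compose[OF W_continuous[OF elim(2)] q _ q0]) auto
      moreover have "(\<lambda>l. X (q l) \<omega>) = (\<lambda>l. X 0 \<omega> + integral {0..q l} (\<lambda>s. a' s \<omega>) + \<kappa> * W (q l) \<omega>)"
        using elim(1) by (auto simp: q_def)
      ultimately show "X t \<omega> = X 0 \<omega> + integral {0..t} (\<lambda>s. a' s \<omega>) + \<kappa> * W t \<omega>"
        by (metis LIMSEQ_unique)
    qed
  qed
qed

end

text \<open>The joint density of the increments from 0 factorises, so their covariance is a product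
  of odd Gaussian moments. The starting values vanish almost surely, which turns increments into
  values.\<close>

lemma wiener_process2_uncorrelated:
  assumes fp: "filtered_prob_space M F" and w: "wiener_process2 M F W1 W2" and t: "0 \<le> t"
  shows "(\<integral>\<omega>. W1 t \<omega> * W2 t \<omega> \<partial>M) = 0"
proof -
  interpret B1: brownian M F W1 by (rule wiener_process2_brownian[OF fp w])
  interpret B2: brownian M F W2 by (rule wiener_process2_brownian[OF fp w])
  note [measurable] = B1.W_measurable[OF t] B2.W_measurable[OF t] B1.W_measurable[OF order_refl] B2.W_measurable[OF order_refl]
  have "(\<integral>\<omega>. W1 t \<omega> * W2 t \<omega> \<partial>M) = (\<integral>\<omega>. (W1 t \<omega> - W1 0 \<omega>) * (W2 t \<omega> - W2 0 \<omega>) \<partial>M)"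
  proof (rule integral_cong_AE)
    show "AE \<omega> in M. W1 t \<omega> * W2 t \<omega> = (W1 t \<omega> - W1 0 \<omega>) * (W2 t \<omega> - W2 0 \<omega>)"
      using B1.W_start B2.W_start by eventually_elim simp
  qed measurable
  also have "\<dots> = 0"
  proof (cases "t = 0")
    case False
    then have t: "0 < t" using t by simp
    define f where "f x = normal_density 0 (sqrt t) x" for x
    define d where "d p = f (fst p) * f (snd p)" for p
    have D: "distributed M (lborel \<Otimes>\<^sub>M lborel) (\<lambda>\<omega>. (W1 t \<omega> - W1 0 \<omega>, W2 t \<omega> - W2 0 \<omega>)) (\<lambda>p. ennreal (d p))"
    proof -
      have "distributed M lborel (\<lambda>\<omega>. (W1 t \<omega> - W1 0 \<omega>, W2 t \<omega> - W2 0 \<omega>))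
          (\<lambda>(x, y). ennreal (normal_density 0 (sqrt (t - 0)) x * normal_density 0 (sqrt (t - 0)) y))"
        using w t unfolding wiener_process2_def by blast
      then show ?thesis by (simp add: lborel_prod d_def f_def case_prod_beta')
    qed
    have d0: "0 \<le> d p" for p by (simp add: d_def f_def)
    have g: "(\<lambda>p. fst p * snd p) \<in> borel_measurable (lborel \<Otimes>\<^sub>M lborel :: (real \<times> real) measure)" by measurable
    have "integrable M (\<lambda>\<omega>. (W1 t \<omega> - W1 0 \<omega>) * (W2 t \<omega> - W2 0 \<omega>))"
      by (rule B1.integrable_mult_of_squares) (use B1.increment_moments(1)[of 0 t 2] B2.increment_moments(1)[of 0 t 2] t in auto)
    then have int: "integrable (lborel \<Otimes>\<^sub>M lborel) (\<lambda>p. d p * (fst p * snd p))"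
      using distributed_integrable[OF D g d0] by simp
    have "(\<integral>\<omega>. (W1 t \<omega> - W1 0 \<omega>) * (W2 t \<omega> - W2 0 \<omega>) \<partial>M) = (\<integral>p. d p * (fst p * snd p) \<partial>(lborel \<Otimes>\<^sub>M lborel))"
      using distributed_integral[OF D g d0] by simp
    also have "\<dots> = (\<integral>x. (\<integral>y. d (x, y) * (fst (x, y) * snd (x, y)) \<partial>lborel) \<partial>lborel)"
      by (rule lborel_pair.integral_fst'[OF int, symmetric])
    also have "\<dots> = (\<integral>x. (f x * x) * (\<integral>y. f y * y \<partial>lborel) \<partial>lborel)"
      by (intro Bochner_Integration.integral_cong refl) (simp add: d_def mult_ac flip: integral_mult_right_zero)
    also have "(\<integral>y. f y * y \<partial>lborel) = 0"
      using integral_normal_moment_odd[of "sqrt t" 0 0] t by (simp add: f_def)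
    finally show ?thesis by simp
  qed simp
  finally show ?thesis .
qed

subsection \<open>The moving-average strategy\<close>

locale ema_market =
  fixes M :: "'a measure" and F :: "real \<Rightarrow> 'a measure"
    and WS W\<mu> S \<mu> \<mu>' P :: "real \<Rightarrow> 'a \<Rightarrow> real"
    and lam \<sigma>\<mu> \<sigma>S \<tau> m x :: real
  assumes lam: "lam > 0" and \<sigma>\<mu>: "\<sigma>\<mu> > 0" and \<sigma>S: "\<sigma>S > 0" and \<tau>: "\<tau> > 0" and m: "m > 0" and x: "x > 0"
    and fp: "filtered_prob_space M F"
    and wiener: "wiener_process2 M F WS W\<mu>"
    and model: "price_trend_model M F WS W\<mu> lam \<sigma>\<mu> \<sigma>S S \<mu>"
    and ema: "ema_of_returns M F WS \<tau> S \<mu>'"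
    and portfolio: "portfolio_value M F WS m \<sigma>S x S \<mu>' P"
begin

sublocale B: brownian M F WS by (rule wiener_process2_brownian[OF fp wiener])
sublocale C: brownian M F W\<mu> by (rule wiener_process2_brownian[OF fp wiener])

lemma price_process: "AE \<omega> in M. \<forall>t\<ge>0. S t \<omega> \<noteq> 0"
    "ito_differential M F WS S (\<lambda>t \<omega>. S t \<omega> * \<mu> t \<omega>) (\<lambda>t \<omega>. S t \<omega> * \<sigma>S)"
  using model by (auto simp: price_trend_model_def)

lemma trend_ito: "ito_differential M F W\<mu> \<mu> (\<lambda>t \<omega>. - lam * \<mu> t \<omega>) (\<lambda>t \<omega>. \<sigma>\<mu>)"
  using model by (auto simp: price_trend_model_def)

text \<open>The equation against \<open>S\<close>, instantiated with the price coefficients of the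
  model. The factors 1 / S and S stay uncancelled because \<open>S\<close> is nonzero only almost
  surely.\<close>

lemma ema_ito: "ito_differential M F WS \<mu>'
    (\<lambda>t \<omega>. - (1 / \<tau>) * \<mu>' t \<omega> + (1 / \<tau>) * (1 / S t \<omega>) * (S t \<omega> * \<mu> t \<omega>))
    (\<lambda>t \<omega>. (1 / \<tau>) * (1 / S t \<omega>) * (S t \<omega> * \<sigma>S))"
  using ema price_process(2) unfolding ema_of_returns_def ito_differential_wrt_def by blast

lemma portfolio_ito: "ito_differential M F WS P
    (\<lambda>t \<omega>. 0 + P t \<omega> * (m * (\<mu>' t \<omega> / \<sigma>S\<^sup>2)) * (1 / S t \<omega>) * (S t \<omega> * \<mu> t \<omega>))
    (\<lambda>t \<omega>. P t \<omega> * (m * (\<mu>' t \<omega> / \<sigma>S\<^sup>2)) * (1 / S t \<omega>) * (S t \<omega> * \<sigma>S))"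
  using portfolio price_process(2) unfolding portfolio_value_def ito_differential_wrt_def by blast

lemma adapted: "0 \<le> t \<Longrightarrow> \<mu> t \<in> borel_measurable (F t)" "0 \<le> t \<Longrightarrow> \<mu>' t \<in> borel_measurable (F t)"
    "0 \<le> t \<Longrightarrow> P t \<in> borel_measurable (F t)"
  and continuous: "\<omega> \<in> space M \<Longrightarrow> continuous_on {0..} (\<lambda>t. \<mu> t \<omega>)"
    "\<omega> \<in> space M \<Longrightarrow> continuous_on {0..} (\<lambda>t. \<mu>' t \<omega>)" "\<omega> \<in> space M \<Longrightarrow> continuous_on {0..} (\<lambda>t. P t \<omega>)"
  using trend_ito ema_ito portfolio_ito by (auto simp: ito_differential_def continuous_adapted_def)

lemma trend_equation: "AE \<omega> in M. \<forall>t\<ge>0. \<mu> t \<omega> = integral {0..t} (\<lambda>s. - lam * \<mu> s \<omega>) + \<sigma>\<mu> * W\<mu> t \<omega>"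
proof -
  have "AE \<omega> in M. \<forall>t\<ge>0. \<mu> t \<omega> = \<mu> 0 \<omega> + integral {0..t} (\<lambda>s. - lam * \<mu> s \<omega>) + \<sigma>\<mu> * W\<mu> t \<omega>"
    by (rule C.ito_differential_constant_diffusion[OF trend_ito]) (auto intro!: continuous_intros continuous)
  moreover have "AE \<omega> in M. \<mu> 0 \<omega> = 0" using model by (auto simp: price_trend_model_def)
  ultimately show ?thesis by eventually_elim simp
qed

lemma ema_equation:
  "AE \<omega> in M. \<forall>t\<ge>0. \<mu>' t \<omega> = integral {0..t} (\<lambda>s. (\<mu> s \<omega> - \<mu>' s \<omega>) / \<tau>) + \<sigma>S / \<tau> * WS t \<omega>"
proof -
  have "AE \<omega> in M. \<forall>t\<ge>0. \<mu>' t \<omega> = \<mu>' 0 \<omega> + integral {0..t} (\<lambda>s. (\<mu> s \<omega> - \<mu>' s \<omega>) / \<tau>) + \<sigma>S / \<tau> * WS t \<omega>"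
  proof (rule B.ito_differential_constant_diffusion[OF ema_ito])
    show "continuous_on {0..} (\<lambda>t. (\<mu> t \<omega> - \<mu>' t \<omega>) / \<tau>)" if "\<omega> \<in> space M" for \<omega>
      using \<tau> by (intro continuous_intros continuous that) simp
    show "AE \<omega> in M. \<forall>t\<ge>0. - (1 / \<tau>) * \<mu>' t \<omega> + (1 / \<tau>) * (1 / S t \<omega>) * (S t \<omega> * \<mu> t \<omega>) = (\<mu> t \<omega> - \<mu>' t \<omega>) / \<tau>
        \<and> (1 / \<tau>) * (1 / S t \<omega>) * (S t \<omega> * \<sigma>S) = \<sigma>S / \<tau>"
      using price_process(1) by eventually_elim (use \<tau> in \<open>simp add: field_simps\<close>)
  qed
  moreover have "AE \<omega> in M. \<mu>' 0 \<omega> = 0" using ema by (auto simp: ema_of_returns_def)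
  ultimately show ?thesis by eventually_elim simp
qed

text \<open>The logarithm formula for p = P and z = \<mu>', with c = m / \<sigma>S, \<kappa> =
  \<sigma>S / \<tau>, relative drift m * \<mu> * \<mu>' / \<sigma>S^2 of \<open>P\<close> and drift
  (\<mu> - \<mu>') / \<tau> of \<mu>'.\<close>

lemma log_portfolio:
  assumes T: "T > 0"
  shows "AE \<omega> in M. ln (P T \<omega> / P 0 \<omega>) = m * \<tau> / (2 * \<sigma>S\<^sup>2) * (\<mu>' T \<omega>)\<^sup>2 - m * T / (2 * \<tau>)
    + m / \<sigma>S\<^sup>2 * (1 - m / 2) * integral {0..T} (\<lambda>s. \<mu>' s \<omega> * \<mu>' s \<omega>)"
proof -
  define \<alpha> where "\<alpha> t \<omega> = m / \<sigma>S\<^sup>2 * (\<mu>' t \<omega> * \<mu> t \<omega>)" for t \<omega>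
  define A where "A t \<omega> = (\<mu> t \<omega> - \<mu>' t \<omega>) / \<tau>" for t \<omega>
  define a where "a t \<omega> = 0 + P t \<omega> * (m * (\<mu>' t \<omega> / \<sigma>S\<^sup>2)) * (1 / S t \<omega>) * (S t \<omega> * \<mu> t \<omega>)" for t \<omega>
  define H where "H t \<omega> = P t \<omega> * (m * (\<mu>' t \<omega> / \<sigma>S\<^sup>2)) * (1 / S t \<omega>) * (S t \<omega> * \<sigma>S)" for t \<omega>
  define Y where "Y t \<omega> = P t \<omega> - P 0 \<omega> - (LINT s:{0..t}|lborel. a s \<omega>)" for t \<omega>
  have \<alpha>c: "continuous_on {0..} (\<lambda>t. \<alpha> t \<omega>)" and Ac: "continuous_on {0..} (\<lambda>t. A t \<omega>)" if "\<omega> \<in> space M" for \<omega>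
    unfolding \<alpha>_def A_def using \<tau> \<sigma>S by (auto intro!: continuous_intros continuous that)
  have ito: "has_ito_integral M F WS H t (Y t)" if "0 \<le> t" for t
    using portfolio_ito that unfolding ito_differential_def H_def[abs_def] Y_def[abs_def] a_def by blast
  have Y0: "Y 0 \<omega> = 0" for \<omega>
  proof -
    have "(LINT s:{0..0}|lborel. a s \<omega>) = 0" unfolding set_lebesgue_integral_def
    proof (rule integral_eq_zero_AE)
      show "AE s in lborel. indicator {0..0::real} s *\<^sub>R a s \<omega> = 0"
        using AE_lborel_singleton[of "0::real"] by eventually_elim auto
    qed
    then show ?thesis by (simp add: Y_def)
  qed
  have Pnz: "AE \<omega> in M. \<forall>t\<ge>0. P t \<omega> \<noteq> 0" using portfolio by (auto simp: portfolio_value_def)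
  have H: "AE \<omega> in M. \<forall>t\<in>{0..T}. P t \<omega> \<noteq> 0 \<and> H t \<omega> = P t \<omega> * (m / \<sigma>S * \<mu>' t \<omega>)"
    using Pnz price_process(1) by eventually_elim (use \<sigma>S in \<open>simp add: H_def field_simps power2_eq_square\<close>)
  have Y: "AE \<omega> in M. \<forall>t\<in>{0..T}. Y t \<omega> = P t \<omega> - P 0 \<omega> - integral {0..t} (\<lambda>s. P s \<omega> * \<alpha> s \<omega>)"
    using price_process(1) AE_space
  proof eventually_elim
    case (elim \<omega>)
    show ?case
    proof
      fix t assume "t \<in> {0..T}"
      have "(LINT s:{0..t}|lborel. a s \<omega>) = (LINT s:{0..t}|lborel. P s \<omega> * \<alpha> s \<omega>)"
        using elim(1) \<sigma>S by (intro set_lebesgue_integral_cong) (auto simp: a_def \<alpha>_def field_simps)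
      also have "\<dots> = integral {0..t} (\<lambda>s. P s \<omega> * \<alpha> s \<omega>)"
        by (intro set_borel_integral_eq_integral borel_integrable_atLeastAtMost' continuous_on_mult
            continuous_on_subset[OF continuous(3)[OF elim(2)]] continuous_on_subset[OF \<alpha>c[OF elim(2)]]) auto
      finally show "Y t \<omega> = P t \<omega> - P 0 \<omega> - integral {0..t} (\<lambda>s. P s \<omega> * \<alpha> s \<omega>)" by (simp add: Y_def)
    qed
  qed
  have zt: "AE \<omega> in M. \<forall>t\<in>{0..T}. \<mu>' t \<omega> = integral {0..t} (\<lambda>s. A s \<omega>) + \<sigma>S / \<tau> * WS t \<omega>"
    using ema_equation by eventually_elim (simp add: A_def)
  have "\<sigma>S / \<tau> \<noteq> 0" using \<sigma>S \<tau> by simp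
  note log_ito = B.log_ito_exponential[where p=P and z=\<mu>' and \<alpha>=\<alpha> and A=A and Y=Y and H=H and c="m / \<sigma>S" and \<kappa>="\<sigma>S / \<tau>",
      OF T this adapted(3) continuous(3) adapted(2) continuous(2) \<alpha>c Ac H ito Y0 Y zt]
  have log: "AE \<omega> in M. ln (P T \<omega> / P 0 \<omega>) =
    integral {0..T} (\<lambda>s. \<alpha> s \<omega>) - (m / \<sigma>S)\<^sup>2 / 2 * integral {0..T} (\<lambda>s. (\<mu>' s \<omega>)\<^sup>2)
    + m / \<sigma>S * ((((\<mu>' T \<omega>)\<^sup>2 - (\<mu>' 0 \<omega>)\<^sup>2 - (\<sigma>S / \<tau>)\<^sup>2 * T) / 2 - integral {0..T} (\<lambda>s. \<mu>' s \<omega> * A s \<omega>)) / (\<sigma>S / \<tau>))"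
    by (rule log_ito)
  have "AE \<omega> in M. \<mu>' 0 \<omega> = 0" using ema by (auto simp: ema_of_returns_def)
  with log show ?thesis using AE_space
  proof eventually_elim
    case (elim \<omega>)
    define I1 where "I1 = integral {0..T} (\<lambda>s. \<mu>' s \<omega> * \<mu> s \<omega>)"
    define I2 where "I2 = integral {0..T} (\<lambda>s. \<mu>' s \<omega> * \<mu>' s \<omega>)"
    have c: "continuous_on {0..T} (\<lambda>t. \<mu> t \<omega>)" "continuous_on {0..T} (\<lambda>t. \<mu>' t \<omega>)"
      by (rule continuous_on_subset[OF continuous(1)[OF elim(3)]] continuous_on_subset[OF continuous(2)[OF elim(3)]]; force)+
    have 1: "integral {0..T} (\<lambda>s. \<alpha> s \<omega>) = m / \<sigma>S\<^sup>2 * I1"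
      unfolding \<alpha>_def I1_def by (rule Henstock_Kurzweil_Integration.integral_mult_right)
    have "integral {0..T} (\<lambda>s. \<mu>' s \<omega> * A s \<omega>) = integral {0..T} (\<lambda>s. (1 / \<tau>) * (\<mu>' s \<omega> * \<mu> s \<omega> - \<mu>' s \<omega> * \<mu>' s \<omega>))"
      using \<tau> by (intro integral_cong) (simp add: A_def field_simps)
    also have "\<dots> = (1 / \<tau>) * integral {0..T} (\<lambda>s. \<mu>' s \<omega> * \<mu> s \<omega> - \<mu>' s \<omega> * \<mu>' s \<omega>)"
      by (rule Henstock_Kurzweil_Integration.integral_mult_right)
    also have "integral {0..T} (\<lambda>s. \<mu>' s \<omega> * \<mu> s \<omega> - \<mu>' s \<omega> * \<mu>' s \<omega>) = I1 - I2"
      unfolding I1_def I2_def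
      by (intro Henstock_Kurzweil_Integration.integral_diff integrable_continuous_real continuous_on_mult c)
    finally have 2: "integral {0..T} (\<lambda>s. \<mu>' s \<omega> * A s \<omega>) = (I1 - I2) / \<tau>" by simp
    have 3: "integral {0..T} (\<lambda>s. (\<mu>' s \<omega>)\<^sup>2) = I2" by (simp add: I2_def power2_eq_square)
    have "ln (P T \<omega> / P 0 \<omega>) = m / \<sigma>S\<^sup>2 * I1 - (m / \<sigma>S)\<^sup>2 / 2 * I2
      + m / \<sigma>S * ((((\<mu>' T \<omega>)\<^sup>2 - 0\<^sup>2 - (\<sigma>S / \<tau>)\<^sup>2 * T) / 2 - (I1 - I2) / \<tau>) / (\<sigma>S / \<tau>))"
      using elim(1) unfolding 1 2 3 elim(2) .
    \<comment> \<open>As c / \<kappa> = m * \<tau> / \<sigma>S^2, the integral I1 of \<mu> * \<mu>'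
      appears with coefficients m / \<sigma>S^2 and -m / \<sigma>S^2. For I2 the coefficients m /
      \<sigma>S^2 and -m^2 / (2 * \<sigma>S^2) remain.\<close>
    also have "\<dots> = m * \<tau> / (2 * \<sigma>S\<^sup>2) * (\<mu>' T \<omega>)\<^sup>2 - m * T / (2 * \<tau>) + m / \<sigma>S\<^sup>2 * (1 - m / 2) * I2"
      using \<sigma>S \<tau> by (simp add: field_simps power2_eq_square)
    finally show ?case unfolding I2_def .
  qed
qed

lemma L2_trend: "L2_process M \<mu>"
proof (rule B.L2_process_linear_equation[OF less_imp_le[OF lam] B.L2_process_cmult[OF C.L2_process_W, of \<sigma>\<mu>]])
  show "AE \<omega> in M. \<forall>t\<ge>0. \<mu> t \<omega> = - lam * integral {0..t} (\<lambda>s. \<mu> s \<omega>) + \<sigma>\<mu> * W\<mu> t \<omega>"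
    using trend_equation by eventually_elim (simp only: Henstock_Kurzweil_Integration.integral_mult_right)
qed (rule B.M_measurable[OF adapted(1)] continuous(1); assumption)+

text \<open>Once the trend is known to have second moments, its time integral can be treated as
  forcing, next to the noise, in a linear equation for \<mu>' with rate 1 / \<tau>.\<close>

lemma L2_ema: "L2_process M \<mu>'"
proof (rule B.L2_process_linear_equation[where \<kappa>="1 / \<tau>" and R="\<lambda>t \<omega>. (1 / \<tau>) * integral {0..t} (\<lambda>s. \<mu> s \<omega>) + \<sigma>S / \<tau> * WS t \<omega>"])
  show "L2_process M (\<lambda>t \<omega>. (1 / \<tau>) * integral {0..t} (\<lambda>s. \<mu> s \<omega>) + \<sigma>S / \<tau> * WS t \<omega>)"
    by (intro B.L2_process_add B.L2_process_cmult B.L2_process_integral L2_trend B.L2_process_W)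
  show "AE \<omega> in M. \<forall>t\<ge>0. \<mu>' t \<omega> = - (1 / \<tau>) * integral {0..t} (\<lambda>s. \<mu>' s \<omega>)
      + ((1 / \<tau>) * integral {0..t} (\<lambda>s. \<mu> s \<omega>) + \<sigma>S / \<tau> * WS t \<omega>)"
    using ema_equation AE_space
  proof eventually_elim
    case (elim \<omega>)
    have "integral {0..t} (\<lambda>s. (\<mu> s \<omega> - \<mu>' s \<omega>) / \<tau>) = (1 / \<tau>) * integral {0..t} (\<lambda>s. \<mu> s \<omega>) - (1 / \<tau>) * integral {0..t} (\<lambda>s. \<mu>' s \<omega>)" for t
    proof -
      have "integral {0..t} (\<lambda>s. (\<mu> s \<omega> - \<mu>' s \<omega>) / \<tau>) = integral {0..t} (\<lambda>s. (1 / \<tau>) * \<mu> s \<omega> - (1 / \<tau>) * \<mu>' s \<omega>)"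
        by (simp add: diff_divide_distrib)
      also have "\<dots> = integral {0..t} (\<lambda>s. (1 / \<tau>) * \<mu> s \<omega>) - integral {0..t} (\<lambda>s. (1 / \<tau>) * \<mu>' s \<omega>)"
        by (intro Henstock_Kurzweil_Integration.integral_diff integrable_continuous_real continuous_on_mult continuous_on_const
            L2_process_continuous[OF L2_trend elim(2)] continuous_on_subset[OF continuous(2)[OF elim(2)]]) auto
      finally show ?thesis by (simp only: Henstock_Kurzweil_Integration.integral_mult_right)
    qed
    with elim(1) show ?case by (simp add: algebra_simps)
  qed
qed (use \<tau> in simp, (rule B.M_measurable[OF adapted(2)] continuous(2); assumption)+)

section \<open>The second-moment system and its time averages\<close>

abbreviation "trend_var t \<equiv> B.expectation (\<lambda>\<omega>. \<mu> t \<omega> * \<mu> t \<omega>)"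
abbreviation "cross_cov t \<equiv> B.expectation (\<lambda>\<omega>. \<mu> t \<omega> * \<mu>' t \<omega>)"
abbreviation "ema_var t \<equiv> B.expectation (\<lambda>\<omega>. \<mu>' t \<omega> * \<mu>' t \<omega>)"

lemma moment_integrable:
  assumes "0 \<le> t"
  shows "trend_var integrable_on {0..t}" "cross_cov integrable_on {0..t}" "ema_var integrable_on {0..t}"
  by (intro B.L2_process_fubini(2) L2_trend L2_ema assms)+

text \<open>All three are instances of \<open>product_expectation\<close>. The terms proportional to
  time are the covariances of the driving noises: \<sigma>\<mu>^2 for the trend, (\<sigma>S /
  \<tau>)^2 for the moving average, and none for the mixed moment because the two noises are
  uncorrelated.\<close>

lemma moment_equations:
  assumes t: "0 \<le> t"
  shows "trend_var t = - (2 * lam) * integral {0..t} trend_var + \<sigma>\<mu>\<^sup>2 * t"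
    and "cross_cov t = - (lam + 1 / \<tau>) * integral {0..t} cross_cov + (1 / \<tau>) * integral {0..t} trend_var"
    and "ema_var t = - (2 / \<tau>) * integral {0..t} ema_var + ((2 / \<tau>) * integral {0..t} cross_cov + (\<sigma>S / \<tau>)\<^sup>2 * t)"
proof -
  define A where "A t \<omega> = - lam * \<mu> t \<omega>" for t \<omega>
  define B where "B t \<omega> = (1 / \<tau>) * (\<mu> t \<omega> + (- 1) * \<mu>' t \<omega>)" for t \<omega>
  define U where "U t \<omega> = \<sigma>\<mu> * W\<mu> t \<omega>" for t \<omega>
  define V where "V t \<omega> = \<sigma>S / \<tau> * WS t \<omega>" for t \<omega>
  note L2 = L2_trend L2_ema
  have A: "L2_process M A" unfolding A_def[abs_def] by (rule B.L2_process_cmult[OF L2(1)])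
  have B: "L2_process M B" unfolding B_def[abs_def] by (intro B.L2_process_cmult B.L2_process_add L2)
  have U: "L2_process M U" unfolding U_def[abs_def] by (intro B.L2_process_cmult C.L2_process_W)
  have V: "L2_process M V" unfolding V_def[abs_def] by (intro B.L2_process_cmult B.L2_process_W)
  have AF: "A s \<in> borel_measurable (F s)" and BF: "B s \<in> borel_measurable (F s)" if "0 \<le> s" for s
    unfolding A_def[abs_def] B_def[abs_def]
    by (intro borel_measurable_times borel_measurable_add borel_measurable_const adapted that)+
  \<comment> \<open>Both Wiener processes have increments independent of the same filtration, so the
    martingale property applies also across coordinates, for instance to the trend against
    \<open>WS\<close>.\<close>
  have mU: "B.expectation (\<lambda>\<omega>. Z s \<omega> * U t \<omega>) = B.expectation (\<lambda>\<omega>. Z s \<omega> * U s \<omega>)"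
    and mV: "B.expectation (\<lambda>\<omega>. Z s \<omega> * V t \<omega>) = B.expectation (\<lambda>\<omega>. Z s \<omega> * V s \<omega>)"
    if Z: "L2_process M Z" "Z s \<in> borel_measurable (F s)" and st: "0 \<le> s" "s \<le> t" for Z s t
    using C.martingale_property[OF Z(2) L2_processD(3)[OF Z(1) st(1)] st] B.martingale_property[OF Z(2) L2_processD(3)[OF Z(1) st(1)] st]
    unfolding U_def V_def mult.left_commute[of _ \<sigma>\<mu>] mult.left_commute[of _ "\<sigma>S / \<tau>"] by simp_all
  have \<mu>: "AE \<omega> in M. \<mu> t \<omega> = integral {0..t} (\<lambda>s. A s \<omega>) + U t \<omega>" if "0 \<le> t" for t
    using trend_equation by eventually_elim (use that in \<open>simp add: A_def U_def\<close>)
  have \<mu>': "AE \<omega> in M. \<mu>' t \<omega> = integral {0..t} (\<lambda>s. B s \<omega>) + V t \<omega>" if "0 \<le> t" for t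
    using ema_equation by eventually_elim (use that in \<open>simp add: B_def V_def\<close>)
  have UU: "B.expectation (\<lambda>\<omega>. U t \<omega> * U t \<omega>) = \<sigma>\<mu>\<^sup>2 * t" if "0 \<le> t" for t
    using C.W_square(2)[OF that] by (simp add: U_def power2_eq_square mult_ac)
  have VV: "B.expectation (\<lambda>\<omega>. V t \<omega> * V t \<omega>) = (\<sigma>S / \<tau>)\<^sup>2 * t" if "0 \<le> t" for t
  proof -
    have "(\<lambda>\<omega>. V t \<omega> * V t \<omega>) = (\<lambda>\<omega>. (\<sigma>S / \<tau>)\<^sup>2 * (WS t \<omega>)\<^sup>2)" by (simp add: V_def power2_eq_square mult_ac)
    then show ?thesis using B.W_square(2)[OF that] by simp
  qed
  have UV: "B.expectation (\<lambda>\<omega>. U t \<omega> * V t \<omega>) = 0 * t" if "0 \<le> t" for t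
  proof -
    have "(\<lambda>\<omega>. U t \<omega> * V t \<omega>) = (\<lambda>\<omega>. (\<sigma>\<mu> * (\<sigma>S / \<tau>)) * (WS t \<omega> * W\<mu> t \<omega>))" by (simp add: U_def V_def mult_ac)
    then show ?thesis using wiener_process2_uncorrelated[OF fp wiener that] by simp
  qed
  have prod_int: "integrable M (\<lambda>\<omega>. \<mu> s \<omega> * \<mu> s \<omega>)" "integrable M (\<lambda>\<omega>. \<mu> s \<omega> * \<mu>' s \<omega>)" "integrable M (\<lambda>\<omega>. \<mu>' s \<omega> * \<mu>' s \<omega>)" if "0 \<le> s" for s
    by (intro B.L2_process_mult_integrable L2 that)+
  have eA: "B.expectation (\<lambda>\<omega>. A s \<omega> * \<mu> s \<omega>) = - lam * trend_var s" "B.expectation (\<lambda>\<omega>. A s \<omega> * \<mu>' s \<omega>) = - lam * cross_cov s" for s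
    unfolding A_def mult.assoc by simp_all
  have eB: "B.expectation (\<lambda>\<omega>. B s \<omega> * \<mu> s \<omega>) = (1 / \<tau>) * (trend_var s - cross_cov s)"
    "B.expectation (\<lambda>\<omega>. B s \<omega> * \<mu>' s \<omega>) = (1 / \<tau>) * (cross_cov s - ema_var s)" if s: "0 \<le> s" for s
  proof -
    have 1: "(\<lambda>\<omega>. B s \<omega> * \<mu> s \<omega>) = (\<lambda>\<omega>. (1 / \<tau>) * (\<mu> s \<omega> * \<mu> s \<omega> - \<mu> s \<omega> * \<mu>' s \<omega>))"
      and 2: "(\<lambda>\<omega>. B s \<omega> * \<mu>' s \<omega>) = (\<lambda>\<omega>. (1 / \<tau>) * (\<mu> s \<omega> * \<mu>' s \<omega> - \<mu>' s \<omega> * \<mu>' s \<omega>))"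
      by (auto simp: B_def algebra_simps)
    show "B.expectation (\<lambda>\<omega>. B s \<omega> * \<mu> s \<omega>) = (1 / \<tau>) * (trend_var s - cross_cov s)"
      unfolding 1 by (simp only: integral_mult_right_zero Bochner_Integration.integral_diff[OF prod_int(1,2)[OF s]])
    show "B.expectation (\<lambda>\<omega>. B s \<omega> * \<mu>' s \<omega>) = (1 / \<tau>) * (cross_cov s - ema_var s)"
      unfolding 2 by (simp only: integral_mult_right_zero Bochner_Integration.integral_diff[OF prod_int(2,3)[OF s]])
  qed
  note ti = moment_integrable[OF t]
  have "trend_var t = integral {0..t} (\<lambda>s. B.expectation (\<lambda>\<omega>. A s \<omega> * \<mu> s \<omega>) + B.expectation (\<lambda>\<omega>. A s \<omega> * \<mu> s \<omega>)) + \<sigma>\<mu>\<^sup>2 * t"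
    by (rule B.product_expectation[OF A A U U L2(1) \<mu> L2(1) \<mu> UU mU[OF A AF] mU[OF A AF] t])
  also have "(\<lambda>s. B.expectation (\<lambda>\<omega>. A s \<omega> * \<mu> s \<omega>) + B.expectation (\<lambda>\<omega>. A s \<omega> * \<mu> s \<omega>)) = (\<lambda>s. - (2 * lam) * trend_var s)"
    by (simp add: eA mult.assoc)
  finally show "trend_var t = - (2 * lam) * integral {0..t} trend_var + \<sigma>\<mu>\<^sup>2 * t"
    by (simp only: Henstock_Kurzweil_Integration.integral_mult_right)
  have "cross_cov t = integral {0..t} (\<lambda>s. B.expectation (\<lambda>\<omega>. A s \<omega> * \<mu>' s \<omega>) + B.expectation (\<lambda>\<omega>. B s \<omega> * \<mu> s \<omega>)) + 0 * t"
    by (rule B.product_expectation[OF A B U V L2(1) \<mu> L2(2) \<mu>' UV mV[OF A AF] mU[OF B BF] t])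
  also have "integral {0..t} (\<lambda>s. B.expectation (\<lambda>\<omega>. A s \<omega> * \<mu>' s \<omega>) + B.expectation (\<lambda>\<omega>. B s \<omega> * \<mu> s \<omega>)) =
    integral {0..t} (\<lambda>s. - (lam + 1 / \<tau>) * cross_cov s + (1 / \<tau>) * trend_var s)"
    by (intro integral_cong) (simp add: eA eB algebra_simps)
  also have "\<dots> = integral {0..t} (\<lambda>s. - (lam + 1 / \<tau>) * cross_cov s) + integral {0..t} (\<lambda>s. (1 / \<tau>) * trend_var s)"
    by (intro Henstock_Kurzweil_Integration.integral_add integrable_on_mult_right ti)
  finally show "cross_cov t = - (lam + 1 / \<tau>) * integral {0..t} cross_cov + (1 / \<tau>) * integral {0..t} trend_var"
    by (simp only: Henstock_Kurzweil_Integration.integral_mult_right mult_zero_left add_0_right)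
  have "ema_var t = integral {0..t} (\<lambda>s. B.expectation (\<lambda>\<omega>. B s \<omega> * \<mu>' s \<omega>) + B.expectation (\<lambda>\<omega>. B s \<omega> * \<mu>' s \<omega>)) + (\<sigma>S / \<tau>)\<^sup>2 * t"
    by (rule B.product_expectation[OF B B V V L2(2) \<mu>' L2(2) \<mu>' VV mV[OF B BF] mV[OF B BF] t])
  also have "integral {0..t} (\<lambda>s. B.expectation (\<lambda>\<omega>. B s \<omega> * \<mu>' s \<omega>) + B.expectation (\<lambda>\<omega>. B s \<omega> * \<mu>' s \<omega>)) =
    integral {0..t} (\<lambda>s. - (2 / \<tau>) * ema_var s + (2 / \<tau>) * cross_cov s)"
    by (intro integral_cong) (simp add: eB algebra_simps diff_divide_distrib)
  also have "\<dots> = integral {0..t} (\<lambda>s. - (2 / \<tau>) * ema_var s) + integral {0..t} (\<lambda>s. (2 / \<tau>) * cross_cov s)"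
    by (intro Henstock_Kurzweil_Integration.integral_add integrable_on_mult_right ti)
  finally show "ema_var t = - (2 / \<tau>) * integral {0..t} ema_var + ((2 / \<tau>) * integral {0..t} cross_cov + (\<sigma>S / \<tau>)\<^sup>2 * t)"
    by (simp only: Henstock_Kurzweil_Integration.integral_mult_right add.assoc)
qed

lemma moment_continuous:
  "continuous_on {0..} trend_var" "continuous_on {0..} cross_cov" "continuous_on {0..} ema_var"
proof -
  note I = continuous_on_indefinite_integral_halfline[OF moment_integrable(1)]
    continuous_on_indefinite_integral_halfline[OF moment_integrable(2)]
    continuous_on_indefinite_integral_halfline[OF moment_integrable(3)]
  have "continuous_on {0..} (\<lambda>t. - (2 * lam) * integral {0..t} trend_var + \<sigma>\<mu>\<^sup>2 * t)"
    by (intro continuous_on_add continuous_on_mult continuous_on_const continuous_on_id I)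
  then show "continuous_on {0..} trend_var"
    by (rule continuous_on_eq) (simp add: moment_equations(1))
  have "continuous_on {0..} (\<lambda>t. - (lam + 1 / \<tau>) * integral {0..t} cross_cov + (1 / \<tau>) * integral {0..t} trend_var)"
    by (intro continuous_on_add continuous_on_mult continuous_on_const I)
  then show "continuous_on {0..} cross_cov"
    by (rule continuous_on_eq) (simp add: moment_equations(2))
  have "continuous_on {0..} (\<lambda>t. - (2 / \<tau>) * integral {0..t} ema_var + ((2 / \<tau>) * integral {0..t} cross_cov + (\<sigma>S / \<tau>)\<^sup>2 * t))"
    by (intro continuous_on_add continuous_on_mult continuous_on_const continuous_on_id I)
  then show "continuous_on {0..} ema_var"
    by (rule continuous_on_eq) (simp add: moment_equations(3))
qed

text \<open>Each average is the average forcing divided by the rate of its equation: the rates are 2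
  * lam, lam + 1 / \<tau> and 2 / \<tau>, and each result feeds the next forcing. The second limit
  shows that the boundary term (\<mu>' T)^2 is negligible on average.\<close>

lemma ema_var_average:
  shows "((\<lambda>t. integral {0..t} ema_var / t) \<longlongrightarrow>
      ((2 / \<tau>) * ((1 / \<tau>) * (\<sigma>\<mu>\<^sup>2 / (2 * lam)) / (lam + 1 / \<tau>)) + (\<sigma>S / \<tau>)\<^sup>2) / (2 / \<tau>)) at_top"
    and "((\<lambda>t. ema_var t / t) \<longlongrightarrow> 0) at_top"
proof -
  have lin: "((\<lambda>t. c * t / t) \<longlongrightarrow> c) at_top" for c :: real
  proof (rule Lim_transform_eventually[OF tendsto_const])
    show "\<forall>\<^sub>F t in at_top. c = c * t / t" using eventually_gt_at_top[of 0] by eventually_elim simp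
  qed
  have 1: "((\<lambda>t. integral {0..t} trend_var / t) \<longlongrightarrow> \<sigma>\<mu>\<^sup>2 / (2 * lam)) at_top"
    by (rule linear_integral_equation_average(1)[OF _ moment_continuous(1) moment_equations(1) lin]) (use lam in auto)
  have R2: "((\<lambda>t. (1 / \<tau>) * integral {0..t} trend_var / t) \<longlongrightarrow> (1 / \<tau>) * (\<sigma>\<mu>\<^sup>2 / (2 * lam))) at_top"
    using tendsto_mult[OF tendsto_const 1] by (simp only: times_divide_eq_right)
  have 2: "((\<lambda>t. integral {0..t} cross_cov / t) \<longlongrightarrow> (1 / \<tau>) * (\<sigma>\<mu>\<^sup>2 / (2 * lam)) / (lam + 1 / \<tau>)) at_top"
    by (rule linear_integral_equation_average(1)[OF _ moment_continuous(2) moment_equations(2) R2]) (use lam \<tau> in \<open>auto simp: add_pos_pos\<close>)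
  have R3: "((\<lambda>t. ((2 / \<tau>) * integral {0..t} cross_cov + (\<sigma>S / \<tau>)\<^sup>2 * t) / t) \<longlongrightarrow>
      (2 / \<tau>) * ((1 / \<tau>) * (\<sigma>\<mu>\<^sup>2 / (2 * lam)) / (lam + 1 / \<tau>)) + (\<sigma>S / \<tau>)\<^sup>2) at_top"
  proof -
    have eq: "(a * b + c) / t = a * (b / t) + c / t" for a b c t :: real by (simp add: add_divide_distrib)
    show ?thesis unfolding eq by (intro tendsto_add tendsto_mult tendsto_const 2 lin)
  qed
  note L = linear_integral_equation_average[OF _ moment_continuous(3) moment_equations(3) R3]
  show "((\<lambda>t. integral {0..t} ema_var / t) \<longlongrightarrow>
      ((2 / \<tau>) * ((1 / \<tau>) * (\<sigma>\<mu>\<^sup>2 / (2 * lam)) / (lam + 1 / \<tau>)) + (\<sigma>S / \<tau>)\<^sup>2) / (2 / \<tau>)) at_top"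
    by (rule L(1)) (use \<tau> in auto)
  show "((\<lambda>t. ema_var t / t) \<longlongrightarrow> 0) at_top" by (rule L(2)) (use \<tau> in auto)
qed

lemma log_return_measurable: "0 \<le> T \<Longrightarrow> (\<lambda>\<omega>. ln (P T \<omega> / P 0 \<omega>)) \<in> borel_measurable M"
  using B.M_measurable[OF adapted(3)[of T]] B.M_measurable[OF adapted(3)[of 0]] by measurable

text \<open>The pathwise identity contains no stochastic integral, so expectations can be taken term
  by term with Fubini alone; integrability of the logarithm is inherited from the quadratic
  expression.\<close>

lemma expected_log_return:
  assumes T: "T > 0"
  shows "integrable M (\<lambda>\<omega>. ln (P T \<omega> / P 0 \<omega>))"
    and "B.expectation (\<lambda>\<omega>. ln (P T \<omega> / P 0 \<omega>)) =
      m * \<tau> / (2 * \<sigma>S\<^sup>2) * ema_var T - m * T / (2 * \<tau>) + m / \<sigma>S\<^sup>2 * (1 - m / 2) * integral {0..T} ema_var"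
proof -
  have T0: "0 \<le> T" using T by simp
  define G where "G \<omega> = m * \<tau> / (2 * \<sigma>S\<^sup>2) * (\<mu>' T \<omega> * \<mu>' T \<omega>) - m * T / (2 * \<tau>)
    + m / \<sigma>S\<^sup>2 * (1 - m / 2) * integral {0..T} (\<lambda>s. \<mu>' s \<omega> * \<mu>' s \<omega>)" for \<omega>
  have i1: "integrable M (\<lambda>\<omega>. \<mu>' T \<omega> * \<mu>' T \<omega>)" by (intro B.L2_process_mult_integrable L2_ema T0)
  note fub = B.L2_process_fubini[OF L2_ema L2_ema T0]
  have G: "integrable M G" "B.expectation G = m * \<tau> / (2 * \<sigma>S\<^sup>2) * ema_var T - m * T / (2 * \<tau>)
      + m / \<sigma>S\<^sup>2 * (1 - m / 2) * integral {0..T} ema_var"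
    unfolding G_def[abs_def] using i1 fub(1,3) by (simp_all add: B.prob_space)
  have ae: "AE \<omega> in M. ln (P T \<omega> / P 0 \<omega>) = G \<omega>"
    using log_portfolio[OF T] by eventually_elim (simp add: G_def power2_eq_square)
  have Gm: "G \<in> borel_measurable M" using G(1) by simp
  show "integrable M (\<lambda>\<omega>. ln (P T \<omega> / P 0 \<omega>))"
    using G(1) integrable_cong_AE[OF log_return_measurable[OF T0] Gm ae] by simp
  show "B.expectation (\<lambda>\<omega>. ln (P T \<omega> / P 0 \<omega>)) =
      m * \<tau> / (2 * \<sigma>S\<^sup>2) * ema_var T - m * T / (2 * \<tau>) + m / \<sigma>S\<^sup>2 * (1 - m / 2) * integral {0..T} ema_var"
    using G(2) integral_cong_AE[OF log_return_measurable[OF T0] Gm ae] by simp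
qed

lemma log_return_integrable:
  assumes "0 \<le> T"
  shows "integrable M (\<lambda>\<omega>. ln (P T \<omega> / P 0 \<omega>))"
proof (cases "T = 0")
  case True
  \<comment> \<open>This holds for every path, even one with P 0 = 0: then the quotient is 0 and
    \<open>ln\<close> of it is 0 by convention.\<close>
  have "(\<lambda>\<omega>. ln (P T \<omega> / P 0 \<omega>)) = (\<lambda>\<omega>. 0)" by (rule ext) (simp add: True)
  then show ?thesis by simp
qed (use assms expected_log_return(1) in auto)

lemma log_return_limit:
  "((\<lambda>T. B.expectation (\<lambda>\<omega>. ln (P T \<omega> / P 0 \<omega>)) / T)
    \<longlongrightarrow> asymptotic_log_return m \<tau> lam (\<sigma>\<mu>\<^sup>2 / (2 * lam * \<sigma>S\<^sup>2))) at_top"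
proof -
  define v where "v = ((2 / \<tau>) * ((1 / \<tau>) * (\<sigma>\<mu>\<^sup>2 / (2 * lam)) / (lam + 1 / \<tau>)) + (\<sigma>S / \<tau>)\<^sup>2) / (2 / \<tau>)"
  have "((\<lambda>T. m * \<tau> / (2 * \<sigma>S\<^sup>2) * (ema_var T / T) - m / (2 * \<tau>) + m / \<sigma>S\<^sup>2 * (1 - m / 2) * (integral {0..T} ema_var / T))
    \<longlongrightarrow> m * \<tau> / (2 * \<sigma>S\<^sup>2) * 0 - m / (2 * \<tau>) + m / \<sigma>S\<^sup>2 * (1 - m / 2) * v) at_top"
    unfolding v_def by (intro tendsto_add tendsto_diff tendsto_mult tendsto_const ema_var_average)
  moreover have "\<forall>\<^sub>F T in at_top. m * \<tau> / (2 * \<sigma>S\<^sup>2) * (ema_var T / T) - m / (2 * \<tau>) + m / \<sigma>S\<^sup>2 * (1 - m / 2) * (integral {0..T} ema_var / T)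
    = B.expectation (\<lambda>\<omega>. ln (P T \<omega> / P 0 \<omega>)) / T"
    using eventually_gt_at_top[of 0]
    by eventually_elim (simp add: expected_log_return(2) add_divide_distrib diff_divide_distrib)
  ultimately have "((\<lambda>T. B.expectation (\<lambda>\<omega>. ln (P T \<omega> / P 0 \<omega>)) / T) \<longlongrightarrow>
    m * \<tau> / (2 * \<sigma>S\<^sup>2) * 0 - m / (2 * \<tau>) + m / \<sigma>S\<^sup>2 * (1 - m / 2) * v) at_top"
    by (rule Lim_transform_eventually)
  moreover have "m * \<tau> / (2 * \<sigma>S\<^sup>2) * 0 - m / (2 * \<tau>) + m / \<sigma>S\<^sup>2 * (1 - m / 2) * v
    = asymptotic_log_return m \<tau> lam (\<sigma>\<mu>\<^sup>2 / (2 * lam * \<sigma>S\<^sup>2))"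
  proof -
    define D where "D = lam * \<tau> + 1"
    have D: "D > 0" using lam \<tau> by (simp add: D_def add_pos_pos)
    have "lam + 1 / \<tau> = D / \<tau>" using \<tau> by (simp add: D_def field_simps)
    \<comment> \<open>The long-run second moment of \<mu>' is a trend part plus a noise part.
      Divided by \<sigma>S^2, the trend part becomes the signal-to-noise ratio over
      \<open>D\<close>; the noise part combines with -m / (2 * \<tau>) to -m^2 / (4 *
      \<tau>).\<close>
    then have v: "v = \<sigma>\<mu>\<^sup>2 / (2 * lam) / D + \<sigma>S\<^sup>2 / (2 * \<tau>)"
      unfolding v_def using \<tau> D lam by (simp add: field_simps power2_eq_square)
    show ?thesis
      unfolding asymptotic_log_return_def v D_def[symmetric] using \<tau> D lam \<sigma>S
      by (simp add: field_simps power2_eq_square)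
  qed
  ultimately show ?thesis by simp
qed

end

section \<open>Monotonicity in the parameters\<close>

text \<open>Both parameters enter only through the quotient r / (l * \<tau> + 1), whose coefficient,
  for positive \<open>m\<close>, has the sign of 2 - m. Monotonicity in either one is then
  visible.\<close>

lemma asymptotic_log_return_split:
  assumes "\<tau> > 0" "l > 0"
  shows "asymptotic_log_return m \<tau> l r = m * (2 - m) / 2 * (r / (l * \<tau> + 1)) - m\<^sup>2 / (4 * \<tau>)"
proof -
  have "l * \<tau> + 1 > 0" using assms by (simp add: add_pos_pos)
  then show ?thesis using assms unfolding asymptotic_log_return_def
    by (simp add: divide_simps power2_eq_square) (simp add: algebra_simps)
qed

text \<open>Integrability is part of the conclusion because the expectation of a non-integrable
  variable is 0 by convention, and the limit alone would say little. In the monotonicity claims the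
  rate and the ratio vary independently, as separate arguments of
  \<open>asymptotic_log_return\<close>. The decrease in the rate is stated for m < 2, like the
  increase in the ratio: at m = 2 the value does not depend on the rate, and for m > 2 it increases
  with it.\<close>

theorem corollary2p4:
  fixes M :: "'a measure" and F :: "real \<Rightarrow> 'a measure"
    and WS W\<mu> S \<mu> \<mu>' P :: "real \<Rightarrow> 'a \<Rightarrow> real"
    and lam \<sigma>\<mu> \<sigma>S \<tau> m x SNR :: real
  assumes "lam > 0" and "\<sigma>\<mu> > 0" and "\<sigma>S > 0" and "\<tau> > 0" and "m > 0" and "x > 0"
    and "filtered_prob_space M F"
    and "wiener_process2 M F WS W\<mu>"
    and "price_trend_model M F WS W\<mu> lam \<sigma>\<mu> \<sigma>S S \<mu>"
    and "ema_of_returns M F WS \<tau> S \<mu>'"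
    and "portfolio_value M F WS m \<sigma>S x S \<mu>' P"
    and "SNR = \<sigma>\<mu>\<^sup>2 / (2 * lam * \<sigma>S\<^sup>2)"
  shows "(\<forall>T\<ge>0. integrable M (\<lambda>\<omega>. ln (P T \<omega> / P 0 \<omega>))) \<and>
         ((\<lambda>T. prob_space.expectation M (\<lambda>\<omega>. ln (P T \<omega> / P 0 \<omega>)) / T)
            \<longlongrightarrow> asymptotic_log_return m \<tau> lam SNR) at_top \<and>
         (m < 2 \<longrightarrow> (\<forall>l>0. strict_mono_on {0<..} (\<lambda>r. asymptotic_log_return m \<tau> l r))) \<and>
         (m < 2 \<longrightarrow> (\<forall>r>0. strict_antimono_on {0<..} (\<lambda>l. asymptotic_log_return m \<tau> l r)))"
proof -
  interpret ema_market M F WS W\<mu> S \<mu> \<mu>' P lam \<sigma>\<mu> \<sigma>S \<tau> m x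
    by unfold_locales (use assms in auto)
  have "strict_mono_on {0<..} (\<lambda>r. asymptotic_log_return m \<tau> l r)" if "m < 2" "l > 0" for l
  proof (rule strict_mono_onI)
    fix r s :: real assume "r < s"
    have "l * \<tau> + 1 > 0" using that \<tau> by (simp add: add_pos_pos)
    with \<open>r < s\<close> have "r / (l * \<tau> + 1) < s / (l * \<tau> + 1)" by (rule divide_strict_right_mono)
    then show "asymptotic_log_return m \<tau> l r < asymptotic_log_return m \<tau> l s"
      unfolding asymptotic_log_return_split[OF \<tau> that(2)] using that m
      by (intro diff_strict_right_mono mult_strict_left_mono) auto
  qed
  moreover have "strict_antimono_on {0<..} (\<lambda>l. asymptotic_log_return m \<tau> l r)" if "m < 2" "r > 0" for r
  proof (rule monotone_onI)
    fix k l :: real assume kl: "k \<in> {0<..}" "l \<in> {0<..}" "k < l"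
    then have "0 < k * \<tau> + 1" "k * \<tau> + 1 < l * \<tau> + 1" using \<tau> by (simp_all add: add_pos_pos)
    then have "r / (l * \<tau> + 1) < r / (k * \<tau> + 1)" using that(2) by (intro divide_strict_left_mono) auto
    then show "asymptotic_log_return m \<tau> k r > asymptotic_log_return m \<tau> l r"
      using kl that m unfolding greaterThan_iff
      by (subst (1 2) asymptotic_log_return_split[OF \<tau>])
        (auto intro!: diff_strict_right_mono mult_strict_left_mono simp del: times_divide_eq_left times_divide_eq_right)
  qed
  ultimately show ?thesis
    using log_return_integrable log_return_limit assms(12) by simp
qed

end
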